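(* Let $b:[0,1]\to\mathbb{R}$ be continuous, let $\sigma\neq 0$ be real, let $B(u):=\int_0^u b(v)\,dv$, and assume that $B(1)=0$ and that $b$ is (strictly) decreasing on $[0,1]$. Set $$\mathcal{V}:=\{r\in\mathbb{R}: -2b(0)/\sigma^2<r<-2b(1)/\sigma^2\},\qquad \mathcal{V}_2:=\{(s,t)\in\mathcal{V}\times\mathcal{V}: s+t\in\mathcal{V}\}.$$ With $\Phi$, $p_\infty$, $p^n_\infty$, $L_\infty$ and $L^{2,n}_\infty$ as defined in the context, the following hold. (i) For all $r\in\mathcal{V}$, $L_\infty(r)$ is finite and $$L_\infty(r)=\int_0^1\exp(r\Phi(u))\,du.$$ (ii) For all $(s,t)\in\mathcal{V}_2$, there exists $n_0\geq 2$ such that, for all $n\geq n_0$, $L^{2,n}_\infty(s,t)$ is finite and $$L^{2,n}_\infty(s,t)=\frac{1}{n(n-1)}\sum_{i=1}^n\sum_{j\neq i}J^n_{i,j}(s,t),$$ where, for all $1\leq i<j\leq n$, $$J^n_{i,j}(s,t):=\prod_{k=1}^{i-1}\frac{1}{1-(s+t)\frac{\sigma^2}{2n}\frac{k/n}{B(k/n)}}\ \prod_{k=i}^{j-1}\frac{1}{1-t\frac{\sigma^2}{2n}\frac{k/n}{B(k/n)}+s\frac{\sigma^2}{2n}\frac{1-k/n}{B(k/n)}}\ \prod_{k=j}^{n-1}\frac{1}{1+(s+t)\frac{\sigma^2}{2n}\frac{1-k/n}{B(k/n)}},$$ while, for all $1\leq j<i\leq n$, $$J^n_{i,j}(s,t):=\prod_{k=1}^{j-1}\frac{1}{1-(s+t)\frac{\sigma^2}{2n}\frac{k/n}{B(k/n)}}\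 \prod_{k=j}^{i-1}\frac{1}{1-s\frac{\sigma^2}{2n}\frac{k/n}{B(k/n)}+t\frac{\sigma^2}{2n}\frac{1-k/n}{B(k/n)}}\ \prod_{k=i}^{n-1}\frac{1}{1+(s+t)\frac{\sigma^2}{2n}\frac{1-k/n}{B(k/n)}}$$ (empty products equal $1$). (iii) For all $(s,t)\in\mathcal{V}_2$, $$\lim_{n\to+\infty}L^{2,n}_\infty(s,t)=L_\infty(s)L_\infty(t).$$
   Context: For $n\geq 1$ and $k\in\{1,\dots,n\}$, set $b_n(k):=n\left(B(k/n)-B((k-1)/n)\right)$. Let $M_n:=\{(z_1,\dots,z_n)\in\mathbb{R}^n: z_1+\cdots+z_n=0\}$, equipped with its surface measure $dz$ (the $(n-1)$-dimensional Lebesgue measure induced by the Euclidean structure of $\mathbb{R}^n$). For $z\in\mathbb{R}^n$, $z_{(1)}\leq\cdots\leq z_{(n)}$ denote its order statistics (coordinates sorted in nondecreasing order). Under the stated assumptions on $b$, $$\mathcal{Z}_n:=\int_{z\in M_n}\exp\left(\frac{2}{\sigma^2}\sum_{k=1}^n b_n(k)z_{(k)}\right)dz<+\infty,$$ and one defines the probability density on $M_n$ $$p^n_\infty(z):=\frac{1}{\mathcal{Z}_n}\exp\left(\frac{2}{\sigma^2}\sum_{k=1}^n b_n(k)z_{(k)}\right).$$ For $n\geq 2$ and $s,t\in\mathbb{R}$, define (with values in $(0,+\infty]$) $$L^{2,n}_\infty(s,t):=\int_{z\in M_n}\exp(sz_1+tz_2)\,p^n_\infty(z)\,dz.$$ Under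 the stated assumptions on $b$, one has $B>0$ on $(0,1)$, and the function $\Phi:(0,1)\to\mathbb{R}$, $$\Phi(u):=\int_0^u\frac{v\sigma^2}{2B(v)}\,dv-\int_u^1\frac{(1-v)\sigma^2}{2B(v)}\,dv,$$ is a well-defined increasing bijection from $(0,1)$ onto $\mathbb{R}$. Its inverse $F_\infty:=\Phi^{-1}$ is the cumulative distribution function of a probability distribution $P_\infty$ on $\mathbb{R}$, with density $p_\infty(x)=\frac{2}{\sigma^2}B(F_\infty(x))$ with respect to Lebesgue measure. For $r\in\mathbb{R}$, define (with values in $(0,+\infty]$) $$L_\infty(r):=\int_{\mathbb{R}}\exp(rx)\,p_\infty(x)\,dx.$$ *)

theory Defs
  imports "HOL-Analysis.Analysis"
begin

text \<open>Throughout, \<open>b :: real \<Rightarrow> real\<close> is only ever used on the interval \<open>[0,1]\<close>.\<close>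

definition prim :: "(real \<Rightarrow> real) \<Rightarrow> real \<Rightarrow> real" where
  "prim b u = integral {0..u} b"

subsection \<open>The limiting distribution\<close>

definition Phi :: "(real \<Rightarrow> real) \<Rightarrow> real \<Rightarrow> real \<Rightarrow> real" where
  "Phi b \<sigma> u =
     integral {0..u} (\<lambda>v. v * \<sigma>\<^sup>2 / (2 * prim b v))
     - integral {u..1} (\<lambda>v. (1 - v) * \<sigma>\<^sup>2 / (2 * prim b v))"

definition F_inf :: "(real \<Rightarrow> real) \<Rightarrow> real \<Rightarrow> real \<Rightarrow> real" where
  "F_inf b \<sigma> = the_inv_into {0<..<1} (Phi b \<sigma>)"

definition p_inf :: "(real \<Rightarrow> real) \<Rightarrow> real \<Rightarrow> real \<Rightarrow> real" where
  "p_inf b \<sigma> x = 2 / \<sigma>\<^sup>2 * prim b (F_inf b \<sigma> x)"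

definition L_inf :: "(real \<Rightarrow> real) \<Rightarrow> real \<Rightarrow> real \<Rightarrow> ennreal" where
  "L_inf b \<sigma> r = (\<integral>\<^sup>+x. ennreal (exp (r * x) * p_inf b \<sigma> x) \<partial>lborel)"

subsection \<open>The hyperplane and its surface measure\<close>

text \<open>Vectors of \<open>\<real>\<^sup>n\<close> are the functions in \<open>{1..n} \<rightarrow>\<^sub>E UNIV\<close>, i.e. functions
  on \<open>nat\<close> that are \<open>undefined\<close> outside \<open>{1..n}\<close>.\<close>

definition hyperplane :: "nat \<Rightarrow> (nat \<Rightarrow> real) set" where
  "hyperplane n = {z \<in> {1..n} \<rightarrow>\<^sub>E UNIV. (\<Sum>i=1..n. z i) = 0}"

definition hyperplane_graph :: "nat \<Rightarrow> (nat \<Rightarrow> real) \<Rightarrow> nat \<Rightarrow> real" where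
  "hyperplane_graph n x = (\<lambda>i\<in>{1..n}. if i = n then - (\<Sum>k=1..<n. x k) else x i)"

text \<open>For \<open>n \<ge> 1\<close> the hyperplane is the graph of \<open>g x = - (x\<^sub>1 + \<dots> + x\<^sub>n\<^sub>-\<^sub>1)\<close> over
  \<open>\<real>\<^sup>n\<^sup>-\<^sup>1\<close>.  Its surface measure is the image of the measure with constant area element
  \<open>sqrt (1 + \<bar>grad g\<bar>\<^sup>2) = sqrt (1 + (n - 1)) = sqrt n\<close>.\<close>

definition surface_measure :: "nat \<Rightarrow> (nat \<Rightarrow> real) measure" where
  "surface_measure n =
     distr (scale_measure (ennreal (sqrt (real n))) (\<Pi>\<^sub>M k\<in>{1..<n}. lborel))
       (restrict_space (\<Pi>\<^sub>M k\<in>{1..n}. borel) (hyperplane n))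
       (hyperplane_graph n)"

lemma space_surface_measure: "space (surface_measure n) = hyperplane n"
  by (auto simp: surface_measure_def space_restrict_space space_PiM hyperplane_def)

lemma hyperplane_graph_in_hyperplane:
  assumes "n \<ge> 1"
  shows "hyperplane_graph n x \<in> hyperplane n"
proof -
  have "{1..n} = insert n {1..<n}"
    using assms by auto
  then show ?thesis
    by (auto simp: hyperplane_def hyperplane_graph_def)
qed

lemma measurable_hyperplane_graph:
  assumes "n \<ge> 1"
  shows "hyperplane_graph n \<in> (\<Pi>\<^sub>M k\<in>{1..<n}. lborel)
    \<rightarrow>\<^sub>M restrict_space (\<Pi>\<^sub>M k\<in>{1..n}. borel) (hyperplane n)"
proof (rule measurable_restrict_space2)
  show "hyperplane_graph n \<in> space (\<Pi>\<^sub>M k\<in>{1..<n}. lborel) \<rightarrow> hyperplane n"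
    using hyperplane_graph_in_hyperplane[OF assms] by auto
  have "(\<lambda>x. if i = n then - (\<Sum>k=1..<n. x k) else x i)
      \<in> borel_measurable (\<Pi>\<^sub>M k\<in>{1..<n}. lborel)" if "i \<in> {1..n}" for i
    using that by (cases "i = n") (auto intro!: borel_measurable_sum borel_measurable_uminus)
  then show "hyperplane_graph n \<in> (\<Pi>\<^sub>M k\<in>{1..<n}. lborel) \<rightarrow>\<^sub>M (\<Pi>\<^sub>M k\<in>{1..n}. borel)"
    unfolding hyperplane_graph_def by (intro measurable_restrict) auto
qed

subsection \<open>The stationary distribution of the projected particle system\<close>

definition drift :: "(real \<Rightarrow> real) \<Rightarrow> nat \<Rightarrow> nat \<Rightarrow> real" where
  "drift b n k = real n * (prim b (real k / real n) - prim b ((real k - 1) / real n))"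

definition order_stat :: "nat \<Rightarrow> (nat \<Rightarrow> real) \<Rightarrow> nat \<Rightarrow> real" where
  "order_stat n z k = sort (map z [1..<Suc n]) ! (k - 1)"

definition gibbs_weight :: "(real \<Rightarrow> real) \<Rightarrow> real \<Rightarrow> nat \<Rightarrow> (nat \<Rightarrow> real) \<Rightarrow> real" where
  "gibbs_weight b \<sigma> n z = exp (2 / \<sigma>\<^sup>2 * (\<Sum>k=1..n. drift b n k * order_stat n z k))"

definition partition_fn :: "(real \<Rightarrow> real) \<Rightarrow> real \<Rightarrow> nat \<Rightarrow> ennreal" where
  "partition_fn b \<sigma> n = (\<integral>\<^sup>+z. ennreal (gibbs_weight b \<sigma> n z) \<partial>surface_measure n)"

definition p_inf_n :: "(real \<Rightarrow> real) \<Rightarrow> real \<Rightarrow> nat \<Rightarrow> (nat \<Rightarrow> real) \<Rightarrow> ennreal" where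
  "p_inf_n b \<sigma> n z = 1 / partition_fn b \<sigma> n * ennreal (gibbs_weight b \<sigma> n z)"

definition L2_inf :: "(real \<Rightarrow> real) \<Rightarrow> real \<Rightarrow> nat \<Rightarrow> real \<Rightarrow> real \<Rightarrow> ennreal" where
  "L2_inf b \<sigma> n s t =
     (\<integral>\<^sup>+z. ennreal (exp (s * z 1 + t * z 2)) * p_inf_n b \<sigma> n z \<partial>surface_measure n)"

subsection \<open>Parameter sets and the product formula\<close>

definition V_set :: "(real \<Rightarrow> real) \<Rightarrow> real \<Rightarrow> real set" where
  "V_set b \<sigma> = {r. - 2 * b 0 / \<sigma>\<^sup>2 < r \<and> r < - 2 * b 1 / \<sigma>\<^sup>2}"

definition V2_set :: "(real \<Rightarrow> real) \<Rightarrow> real \<Rightarrow> (real \<times> real) set" where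
  "V2_set b \<sigma> = {(s, t) \<in> V_set b \<sigma> \<times> V_set b \<sigma>. s + t \<in> V_set b \<sigma>}"

text \<open>Only used for \<open>i \<noteq> j\<close>; the last branch is the case \<open>j < i\<close>.\<close>

definition J_prod ::
  "(real \<Rightarrow> real) \<Rightarrow> real \<Rightarrow> nat \<Rightarrow> nat \<Rightarrow> nat \<Rightarrow> real \<Rightarrow> real \<Rightarrow> real" where
  "J_prod b \<sigma> n i j s t =
     (let c = \<sigma>\<^sup>2 / (2 * real n);
          l = (\<lambda>k::nat. (real k / real n) / prim b (real k / real n));
          u = (\<lambda>k::nat. (1 - real k / real n) / prim b (real k / real n))
      in if i < j then
           (\<Prod>k\<in>{1..<i}. 1 / (1 - (s + t) * c * l k))
           * (\<Prod>k\<in>{i..<j}. 1 / (1 - t * c * l k + s * c * u k))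
           * (\<Prod>k\<in>{j..<n}. 1 / (1 + (s + t) * c * u k))
         else
           (\<Prod>k\<in>{1..<j}. 1 / (1 - (s + t) * c * l k))
           * (\<Prod>k\<in>{j..<i}. 1 / (1 - s * c * l k + t * c * u k))
           * (\<Prod>k\<in>{i..<n}. 1 / (1 + (s + t) * c * u k)))"

end

theory Submission
  imports Defs "HOL-Real_Asymp.Real_Asymp"
begin

text \<open>Write \<open>u \<mapsto> K u\<close> for the kernel
\<open>K u x = (\<sigma>\<^sup>2/2) * (if x < u then x else x - 1) / B x\<close>, where \<open>B = prim b\<close>. Its integral over \<open>[0,1]\<close>
is \<open>Phi u\<close>, and a Riemann sum of it is hidden in the finite systems; this is what links the two.

Finite systems. The Gibbs weight depends on \<open>z\<close> through its order statistics only, so splitting the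
space according to the permutation that sorts \<open>z\<close> turns the integral that defines \<open>L2_inf\<close> into an
average, over the ranks \<open>i \<noteq> j\<close> of the first two coordinates, of integrals over the cone of increasing
vectors. On that cone every \<open>z\<^sub>i\<close> and the exponent are linear in the gaps \<open>z\<^sub>k\<^sub>+\<^sub>1 - z\<^sub>k\<close>, so the integral
is a product of one-dimensional exponential integrals (\<open>nn_integral_exp_cone\<close>). Relative to the
partition function the \<open>k\<close>-th factor is \<open>1 / (1 - (s * K u x + t * K v x) / n)\<close> with \<open>x = k/n\<close>,
\<open>u = i/n\<close>, \<open>v = j/n\<close>; this is the product formula \<open>J_prod\<close> in a form that treats \<open>i < j\<close> and
\<open>j < i\<close> alike.

The hyperplane is awkward for a symmetry argument, because its parametrisation singles out the last
coordinate. Every integrand is therefore extended to \<open>\<real>\<^sup>n\<close> by translation invariance and integrated over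
the slab on which the smallest coordinate lies in \<open>[0,1]\<close> (\<open>nn_integral_translation_invariant\<close>). The slab is
invariant under permutations, and the factor \<open>n\<close> cancels against the partition function.

Limit. Taking logarithms, the product is a Riemann sum of \<open>s * K u + t * K v\<close>, so it tends to
\<open>exp (s * Phi u + t * Phi v)\<close> (\<open>gap_product_tendsto\<close>). The double average over \<open>i\<close> and \<open>j\<close> is the integral over
the unit square of a step function, and the limit is exchanged with the integral by dominated
convergence. The domination is the heart of the matter (\<open>gap_product_bounds\<close>): near \<open>1\<close> the function
\<open>B x\<close> behaves like \<open>- b 1 * (1 - x)\<close>, and near \<open>0\<close> like \<open>b 0 * x\<close>; the condition that \<open>s\<close>, \<open>t\<close> and \<open>s + t\<close>
lie in \<open>V_set\<close> says exactly that the resulting singularities \<open>\<gamma> / (1 - x)\<close> and \<open>\<gamma> / x\<close> of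
\<open>s * K u x + t * K v x\<close> have \<open>\<gamma> < 1\<close>. Products of \<open>1 / (1 - \<gamma> / k)\<close> grow like a power \<open>\<gamma>\<close> of the number of
factors, which gives an integrable bound \<open>u\<^sup>-\<^sup>\<gamma> (1 - u)\<^sup>-\<^sup>\<gamma> v\<^sup>-\<^sup>\<gamma> (1 - v)\<^sup>-\<^sup>\<gamma>\<close>. The same estimate makes all factors
positive for large \<open>n\<close>, hence \<open>L2_inf\<close> finite, and in the limit it bounds \<open>exp (r * Phi u)\<close>, hence
\<open>L_inf\<close> is finite. The formula for \<open>L_inf\<close> is the substitution \<open>x = Phi u\<close>, for which
\<open>Phi' u * p_inf (Phi u) = 1\<close>.\<close>

section \<open>Order statistics and Lebesgue measure on finite products\<close>

text \<open>The sorted list of indices, read as a function of the position, is a permutation of the indices. All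
facts about \<open>order_stat\<close> below are obtained by evaluating it along such a permutation.\<close>

lemma sorting_permutation_exists:
  fixes z :: "nat \<Rightarrow> real"
  shows "\<exists>p. p permutes {1..n} \<and> mono_on {1..n} (z \<circ> p)"
proof -
  define ys where "ys = sort_key z [1..<Suc n]"
  define p where "p k = (if k \<in> {1..n} then ys ! (k - 1) else k)" for k
  have len: "length ys = n" and dist: "distinct ys" and set: "set ys = {1..n}"
    by (auto simp: ys_def)
  have "bij_betw (\<lambda>k. k - 1) {1..n} {..<n}"
    by (rule bij_betw_byWitness[where f' = Suc]) auto
  moreover have "bij_betw ((!) ys) {..<n} {1..n}"
    using bij_betw_nth[OF dist] len set by auto
  ultimately have "bij_betw ((!) ys \<circ> (\<lambda>k. k - 1)) {1..n} {1..n}"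
    by (rule bij_betw_trans)
  then have "bij_betw p {1..n} {1..n}"
    by (rule bij_betw_cong[THEN iffD1, rotated]) (auto simp: p_def)
  then have "p permutes {1..n}"
    by (rule bij_imp_permutes) (auto simp: p_def)
  moreover have "sorted (map z ys)"
    by (simp add: ys_def)
  then have "mono_on {1..n} (z \<circ> p)"
    by (intro mono_onI) (auto simp: p_def sorted_iff_nth_mono len)
  ultimately show ?thesis by blast
qed

lemma order_stat_eq:
  assumes p: "p permutes {1..n}" and mono: "mono_on {1..n} (z \<circ> p)" and k: "k \<in> {1..n}"
  shows "order_stat n z k = z (p k)"
proof -
  have "mset (map (z \<circ> p) [1..<Suc n]) = image_mset z (image_mset p (mset_set {1..n}))"
    by (simp add: mset_upt atLeastLessThanSuc_atLeastAtMost image_mset.compositionality del: upt_Suc)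
  also have "image_mset p (mset_set {1..n}) = mset_set {1..n}"
    using p by (simp add: image_mset_mset_set permutes_image permutes_inj_on)
  also have "image_mset z (mset_set {1..n}) = mset (map z [1..<Suc n])"
    by (simp add: mset_upt atLeastLessThanSuc_atLeastAtMost del: upt_Suc)
  finally have "mset (map (z \<circ> p) [1..<Suc n]) = mset (map z [1..<Suc n])" .
  moreover have "sorted (map (z \<circ> p) [1..<Suc n])"
    using mono_onD[OF mono]
    by (auto simp: sorted_iff_nth_mono simp del: upt_Suc)
  ultimately have "sort (map z [1..<Suc n]) = map (z \<circ> p) [1..<Suc n]"
    by (rule properties_for_sort)
  moreover have "map (z \<circ> p) [1..<Suc n] ! (k - 1) = z (p k)"
    using k by (subst nth_map) (auto simp del: upt_Suc)
  ultimately show ?thesis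
    by (simp add: order_stat_def del: upt_Suc)
qed

lemma order_stat_translate:
  assumes "k \<in> {1..n}"
  shows "order_stat n (\<lambda>i\<in>{1..n}. z i + c) k = order_stat n z k + c"
proof -
  obtain p where p: "p permutes {1..n}" "mono_on {1..n} (z \<circ> p)"
    using sorting_permutation_exists by blast
  have in': "p i \<in> {1..n}" if "i \<in> {1..n}" for i
    using permutes_in_image[OF p(1)] that by blast
  have "mono_on {1..n} ((\<lambda>i\<in>{1..n}. z i + c) \<circ> p)"
    using mono_onD[OF p(2)] in' by (intro mono_onI) auto
  from order_stat_eq[OF p(1) this assms] order_stat_eq[OF p assms] show ?thesis
    using in'[OF assms] by simp
qed

text \<open>The sublevel sets are finite unions, over the permutations \<open>p\<close>, of the closed sets on which \<open>p\<close> sorts \<open>z\<close>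
and \<open>z (p k)\<close> is small.\<close>

lemma measurable_order_stat:
  assumes "k \<in> {1..n}"
  shows "(\<lambda>z. order_stat n z k) \<in> borel_measurable (\<Pi>\<^sub>M k\<in>{1..n}. (lborel :: real measure))"
    (is "_ \<in> borel_measurable ?M")
proof (rule borel_measurableI_le)
  fix a :: real
  let ?S = "{p. p permutes {1..n}}"
  have "{z \<in> space ?M. order_stat n z k \<le> a}
      = (\<Union>p\<in>?S. {z \<in> space ?M. (\<forall>i\<in>{1..n}. \<forall>j\<in>{1..n}. i \<le> j \<longrightarrow> z (p i) \<le> z (p j)) \<and> z (p k) \<le> a})"
    (is "?L = ?R")
  proof (intro set_eqI iffI)
    fix z assume z: "z \<in> ?L"
    obtain p where p: "p permutes {1..n}" "mono_on {1..n} (z \<circ> p)"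
      using sorting_permutation_exists by blast
    show "z \<in> ?R"
      using z p order_stat_eq[OF p assms] mono_onD[OF p(2)] by auto
  next
    fix z assume "z \<in> ?R"
    then obtain p where p: "p permutes {1..n}" "mono_on {1..n} (z \<circ> p)" "z (p k) \<le> a"
      and "z \<in> space ?M"
      by (auto simp: mono_on_def)
    then show "z \<in> ?L"
      using order_stat_eq[OF p(1,2) assms] by simp
  qed
  also have "\<dots> \<in> sets ?M"
  proof (rule sets.finite_UN)
    show "finite ?S" by (simp add: finite_permutations)
    fix p assume "p \<in> ?S"
    then have p: "p i \<in> {1..n}" if "i \<in> {1..n}" for i
      using that by (metis mem_Collect_eq permutes_in_image)
    have comp: "(\<lambda>z. z (p i)) \<in> borel_measurable ?M" if "i \<in> {1..n}" for i
    proof -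
      have "(\<lambda>z. z (p i)) \<in> ?M \<rightarrow>\<^sub>M lborel"
        by (rule measurable_component_singleton) (use p that in blast)
      then show ?thesis by simp
    qed
    have le: "Measurable.pred ?M (\<lambda>z. z (p i) \<le> z (p j))" if "i \<in> {1..n}" "j \<in> {1..n}" for i j
      unfolding pred_def by (rule borel_measurable_le[OF comp[OF that(1)] comp[OF that(2)]])
    have "Measurable.pred ?M (\<lambda>z. z (p k) \<le> a)"
      unfolding pred_def by (rule borel_measurable_le[OF comp[OF assms] borel_measurable_const])
    then have "Measurable.pred ?M (\<lambda>z. (\<forall>i\<in>{1..n}. \<forall>j\<in>{1..n}. i \<le> j \<longrightarrow> z (p i) \<le> z (p j)) \<and> z (p k) \<le> a)"
      by (intro pred_intros_logic pred_intros_finite finite_atLeastAtMost le measurable_const) auto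
    then show "{z \<in> space ?M. (\<forall>i\<in>{1..n}. \<forall>j\<in>{1..n}. i \<le> j \<longrightarrow> z (p i) \<le> z (p j)) \<and> z (p k) \<le> a} \<in> sets ?M"
      by (rule predE)
  qed
  finally show "?L \<in> sets ?M" .
qed

interpretation lborel_product: product_sigma_finite "\<lambda>_::nat. lborel :: real measure"
  by unfold_locales

lemma nn_integral_PiM_lborel_translate:
  fixes I :: "nat set"
  assumes "finite I" and f: "f \<in> borel_measurable (\<Pi>\<^sub>M i\<in>I. (lborel :: real measure))"
  shows "(\<integral>\<^sup>+x. f (\<lambda>i\<in>I. x i + c) \<partial>(\<Pi>\<^sub>M i\<in>I. lborel)) = (\<integral>\<^sup>+x. f x \<partial>(\<Pi>\<^sub>M i\<in>I. lborel))"
proof -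
  let ?M = "\<Pi>\<^sub>M i\<in>I. (lborel :: real measure)"
  have meas: "(\<lambda>x. \<lambda>i\<in>I. x i + c) \<in> ?M \<rightarrow>\<^sub>M ?M"
    by (intro measurable_restrict) auto
  have "distr ?M ?M (\<lambda>x. \<lambda>i\<in>I. x i + c) = ?M"
  proof (rule lborel_product.PiM_eqI)
    fix A :: "nat \<Rightarrow> real set" assume A: "\<And>i. i \<in> I \<Longrightarrow> A i \<in> sets lborel"
    have shift: "(\<lambda>x. x + c) -` A i \<inter> space lborel \<in> sets lborel" if "i \<in> I" for i
      by (rule measurable_sets[where A = lborel]) (use A[OF that] in auto)
    have "emeasure (distr ?M ?M (\<lambda>x. \<lambda>i\<in>I. x i + c)) (Pi\<^sub>E I A)
        = emeasure ?M ((\<lambda>x. \<lambda>i\<in>I. x i + c) -` Pi\<^sub>E I A \<inter> space ?M)"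
      using A assms(1) by (intro emeasure_distr meas sets_PiM_I_finite) auto
    also have "(\<lambda>x. \<lambda>i\<in>I. x i + c) -` Pi\<^sub>E I A \<inter> space ?M = Pi\<^sub>E I (\<lambda>i. (\<lambda>x. x + c) -` A i)"
      by (auto simp: space_PiM PiE_iff extensional_def)
    also have "emeasure ?M \<dots> = (\<Prod>i\<in>I. emeasure lborel ((\<lambda>x. x + c) -` A i))"
      using shift assms(1) by (intro lborel_product.emeasure_PiM) auto
    also have "\<dots> = (\<Prod>i\<in>I. emeasure lborel (A i))"
    proof (rule prod.cong)
      fix i assume i: "i \<in> I"
      have "emeasure lborel (A i) = emeasure (distr lborel borel ((+) c)) (A i)"
        by (simp add: lborel_distr_plus)
      also have "\<dots> = emeasure lborel ((+) c -` A i)"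
        using A[OF i] by (simp add: emeasure_distr)
      also have "(+) c = (\<lambda>x. x + c)" by auto
      finally show "emeasure lborel ((\<lambda>x. x + c) -` A i) = emeasure lborel (A i)" by simp
    qed simp
    finally show "emeasure (distr ?M ?M (\<lambda>x. \<lambda>i\<in>I. x i + c)) (Pi\<^sub>E I A)
        = (\<Prod>i\<in>I. emeasure lborel (A i))" .
  qed (use assms in auto)
  then have "(\<integral>\<^sup>+x. f x \<partial>?M) = (\<integral>\<^sup>+x. f x \<partial>distr ?M ?M (\<lambda>x. \<lambda>i\<in>I. x i + c))"
    by simp
  also have "\<dots> = (\<integral>\<^sup>+x. f (\<lambda>i\<in>I. x i + c) \<partial>?M)"
    by (rule nn_integral_distr[OF meas]) (use f in simp)
  finally show ?thesis ..
qed

lemma measurable_PiM_permute: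
  assumes p: "p permutes I"
  shows "(\<lambda>x. x \<circ> p) \<in> (\<Pi>\<^sub>M i\<in>I. (lborel :: real measure)) \<rightarrow>\<^sub>M (\<Pi>\<^sub>M i\<in>I. lborel)"
proof (rule measurable_PiM_single')
  fix i assume "i \<in> I"
  then have "p i \<in> I" using p by (simp add: permutes_in_image)
  then show "(\<lambda>x. (x \<circ> p) i) \<in> (\<Pi>\<^sub>M i\<in>I. lborel) \<rightarrow>\<^sub>M (lborel :: real measure)"
    using measurable_component_singleton[of "p i" I "\<lambda>_. lborel"] by simp
next
  show "(\<lambda>x. x \<circ> p) \<in> space (\<Pi>\<^sub>M i\<in>I. (lborel :: real measure)) \<rightarrow> (\<Pi>\<^sub>E i\<in>I. space lborel)"
    using p by (auto simp: space_PiM PiE_iff extensional_def permutes_not_in)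
qed

lemma nn_integral_PiM_lborel_permute:
  fixes I :: "nat set"
  assumes "finite I" and p: "p permutes I"
    and f: "f \<in> borel_measurable (\<Pi>\<^sub>M i\<in>I. (lborel :: real measure))"
  shows "(\<integral>\<^sup>+x. f (x \<circ> p) \<partial>(\<Pi>\<^sub>M i\<in>I. lborel)) = (\<integral>\<^sup>+x. f x \<partial>(\<Pi>\<^sub>M i\<in>I. lborel))"
proof -
  let ?M = "\<Pi>\<^sub>M i\<in>I. (lborel :: real measure)"
  note meas = measurable_PiM_permute[OF p]
  have "distr ?M ?M (\<lambda>x. x \<circ> p) = ?M"
  proof (rule lborel_product.PiM_eqI)
    fix A :: "nat \<Rightarrow> real set" assume A: "\<And>i. i \<in> I \<Longrightarrow> A i \<in> sets lborel"
    have inv: "inv p i \<in> I" if "i \<in> I" for i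
      using that permutes_inv[OF p] by (simp add: permutes_in_image)
    have "emeasure (distr ?M ?M (\<lambda>x. x \<circ> p)) (Pi\<^sub>E I A)
        = emeasure ?M ((\<lambda>x. x \<circ> p) -` Pi\<^sub>E I A \<inter> space ?M)"
      using A assms(1) by (intro emeasure_distr meas sets_PiM_I_finite) auto
    also have "(\<lambda>x. x \<circ> p) -` Pi\<^sub>E I A \<inter> space ?M = Pi\<^sub>E I (\<lambda>i. A (inv p i))"
    proof (intro set_eqI iffI)
      fix x assume x: "x \<in> (\<lambda>x. x \<circ> p) -` Pi\<^sub>E I A \<inter> space ?M"
      have "x i \<in> A (inv p i)" if "i \<in> I" for i
        using x inv[OF that] permutes_inverses(1)[OF p, of i] by (auto simp: PiE_iff)
      then show "x \<in> Pi\<^sub>E I (\<lambda>i. A (inv p i))"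
        using x by (auto simp: space_PiM PiE_iff)
    next
      fix x assume x: "x \<in> Pi\<^sub>E I (\<lambda>i. A (inv p i))"
      have "x (p i) \<in> A i" if "i \<in> I" for i
      proof -
        have "p i \<in> I" using p that by (simp add: permutes_in_image)
        then show ?thesis
          using x permutes_inverses(2)[OF p, of i] by (auto simp: PiE_iff)
      qed
      then show "x \<in> (\<lambda>x. x \<circ> p) -` Pi\<^sub>E I A \<inter> space ?M"
        using x p by (auto simp: space_PiM PiE_iff extensional_def permutes_not_in)
    qed
    also have "emeasure ?M \<dots> = (\<Prod>i\<in>I. emeasure lborel (A (inv p i)))"
      using A inv assms(1) by (intro lborel_product.emeasure_PiM) auto
    also have "\<dots> = (\<Prod>i\<in>I. emeasure lborel (A i))"
      using prod.permute[OF permutes_inv[OF p], of "\<lambda>i. emeasure lborel (A i)"] by (simp add: o_def)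
    finally show "emeasure (distr ?M ?M (\<lambda>x. x \<circ> p)) (Pi\<^sub>E I A)
        = (\<Prod>i\<in>I. emeasure lborel (A i))" .
  qed (use assms in auto)
  then have "(\<integral>\<^sup>+x. f x \<partial>?M) = (\<integral>\<^sup>+x. f x \<partial>distr ?M ?M (\<lambda>x. x \<circ> p))"
    by simp
  also have "\<dots> = (\<integral>\<^sup>+x. f (x \<circ> p) \<partial>?M)"
    by (rule nn_integral_distr[OF meas]) (use f in simp)
  finally show ?thesis ..
qed

lemma nn_integral_PiM_interval_Suc:
  fixes f :: "(nat \<Rightarrow> real) \<Rightarrow> ennreal"
  assumes "n \<ge> 1" and f: "f \<in> borel_measurable (\<Pi>\<^sub>M k\<in>{1..n}. lborel)"
  shows "(\<integral>\<^sup>+z. f z \<partial>(\<Pi>\<^sub>M k\<in>{1..n}. lborel))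
    = (\<integral>\<^sup>+x. (\<integral>\<^sup>+y. f (x(n := y)) \<partial>lborel) \<partial>(\<Pi>\<^sub>M k\<in>{1..<n}. lborel))"
proof -
  have eq: "{1..n} = insert n {1..<n}" using assms(1) by auto
  show ?thesis
    using lborel_product.product_nn_integral_insert[of "{1..<n}" n f] f unfolding eq by simp
qed

text \<open>Integrating over the hyperplane is the same, up to the factor \<open>n\<close>, as integrating over a slab of
thickness one transversal to it, where the slab is measured by any function \<open>l\<close> that moves with
translations along the diagonal. The freedom in the choice of \<open>l\<close> allows a slab adapted to the
symmetries of the integrand. In the proof the last coordinate is written as \<open>- (x\<^sub>1 + \<dots> + x\<^sub>n\<^sub>-\<^sub>1) + n * y\<close>,
and the remaining ones are shifted by \<open>y\<close>; this reaches the point of the hyperplane over \<open>x\<close>, translated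
by \<open>y\<close>, and needs no change of variables beyond one-dimensional ones.\<close>

lemma nn_integral_translation_invariant:
  fixes F :: "(nat \<Rightarrow> real) \<Rightarrow> ennreal" and l :: "(nat \<Rightarrow> real) \<Rightarrow> real"
  assumes n: "n \<ge> 1"
    and F [measurable]: "F \<in> borel_measurable (\<Pi>\<^sub>M k\<in>{1..n}. lborel)"
    and l [measurable]: "l \<in> borel_measurable (\<Pi>\<^sub>M k\<in>{1..n}. lborel)"
    and F_translate: "\<And>z c. F (\<lambda>i\<in>{1..n}. z i + c) = F z"
    and l_translate: "\<And>z c. l (\<lambda>i\<in>{1..n}. z i + c) = l z + c"
  shows "(\<integral>\<^sup>+z. F z * indicator {0..1} (l z) \<partial>(\<Pi>\<^sub>M k\<in>{1..n}. lborel))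
    = of_nat n * (\<integral>\<^sup>+x. F (hyperplane_graph n x) \<partial>(\<Pi>\<^sub>M k\<in>{1..<n}. lborel))"
proof -
  let ?I = "{1..<n}" and ?M = "\<Pi>\<^sub>M k\<in>{1..<n}. (lborel :: real measure)"
    and ?N = "\<Pi>\<^sub>M k\<in>{1..n}. (lborel :: real measure)"
  interpret M: sigma_finite_measure ?M
    by (rule lborel_product.sigma_finite) simp
  interpret pair_sigma_finite ?M "lborel :: real measure" ..
  define f where "f z = F z * indicator {0..1} (l z)" for z
  have [measurable]: "f \<in> borel_measurable ?N" unfolding f_def by measurable
  have eq: "{1..n} = insert n ?I" using n by auto
  have upd: "(\<lambda>p. f ((fst p)(n := g p))) \<in> borel_measurable (?M \<Otimes>\<^sub>M lborel)"
    if [measurable]: "g \<in> borel_measurable (?M \<Otimes>\<^sub>M lborel)" for g :: "(nat \<Rightarrow> real) \<times> real \<Rightarrow> real"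
  proof -
    have "(\<lambda>p. (fst p)(n := g p)) \<in> ?M \<Otimes>\<^sub>M lborel \<rightarrow>\<^sub>M ?N"
    proof (rule measurable_fun_upd[OF _ measurable_fst])
      show "{1..n} = ?I \<union> {n}" using eq by simp
      show "g \<in> ?M \<Otimes>\<^sub>M lborel \<rightarrow>\<^sub>M lborel" using that by simp
    qed
    then show ?thesis by measurable
  qed
  have graph_meas: "hyperplane_graph n \<in> ?M \<rightarrow>\<^sub>M ?N"
  proof -
    have "hyperplane_graph n \<in> ?M \<rightarrow>\<^sub>M (\<Pi>\<^sub>M k\<in>{1..n}. borel)"
      using measurable_hyperplane_graph[OF n] by (rule measurable_restrict_space2_iff[THEN iffD1, THEN conjunct1])
    moreover have "sets (\<Pi>\<^sub>M k\<in>{1..n}. borel) = sets ?N" by (intro sets_PiM_cong) auto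
    ultimately show ?thesis using measurable_cong_sets[OF refl, of "\<Pi>\<^sub>M k\<in>{1..n}. borel" ?N ?M] by blast
  qed
  note [measurable] = graph_meas
  let ?S = "\<lambda>x. \<Sum>k=1..<n. x k"
  let ?g = "\<lambda>x y. - ?S x + real n * y"
  have g_meas [measurable]: "(\<lambda>p. ?g (fst p) (snd p)) \<in> borel_measurable (?M \<Otimes>\<^sub>M lborel)"
  proof -
    have "(\<lambda>p. fst p i) \<in> borel_measurable (?M \<Otimes>\<^sub>M lborel)" if "i \<in> ?I" for i
      using measurable_compose[OF measurable_fst
          measurable_component_singleton[OF that, of "\<lambda>_. lborel :: real measure"]] by simp
    then show ?thesis
      by (intro borel_measurable_add borel_measurable_uminus borel_measurable_sum
          borel_measurable_times) auto
  qed
  have upd1: "(\<lambda>p. f ((fst p)(n := snd p))) \<in> borel_measurable (?M \<Otimes>\<^sub>M lborel)"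
    by (rule upd) (use measurable_snd[of ?M "lborel :: real measure"] in simp)
  note upd2 = upd[OF g_meas]
  have "(\<integral>\<^sup>+z. f z \<partial>?N) = (\<integral>\<^sup>+x. (\<integral>\<^sup>+y. f (x(n := y)) \<partial>lborel) \<partial>?M)"
    by (rule nn_integral_PiM_interval_Suc[OF n]) measurable
  also have "\<dots> = (\<integral>\<^sup>+x. of_nat n * (\<integral>\<^sup>+y. f (x(n := ?g x y)) \<partial>lborel) \<partial>?M)"
  proof (rule nn_integral_cong)
    fix x assume x: "x \<in> space ?M"
    have "(\<lambda>y. f (x(n := y))) \<in> borel_measurable lborel"
      using measurable_compose[OF measurable_Pair1'[OF x] upd1] by simp
    then show "(\<integral>\<^sup>+y. f (x(n := y)) \<partial>lborel) = of_nat n * (\<integral>\<^sup>+y. f (x(n := ?g x y)) \<partial>lborel)"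
      using n by (subst nn_integral_real_affine[where c = "real n" and t = "- ?S x"]) (auto simp: ennreal_of_nat_eq_real_of_nat)
  qed
  also have "\<dots> = of_nat n * (\<integral>\<^sup>+x. (\<integral>\<^sup>+y. f (x(n := ?g x y)) \<partial>lborel) \<partial>?M)"
    by (rule nn_integral_cmult, rule lborel.borel_measurable_nn_integral)
      (use upd2 in \<open>simp add: case_prod_beta\<close>)
  also have "(\<integral>\<^sup>+x. (\<integral>\<^sup>+y. f (x(n := ?g x y)) \<partial>lborel) \<partial>?M)
      = (\<integral>\<^sup>+y. (\<integral>\<^sup>+x. f (x(n := ?g x y)) \<partial>?M) \<partial>lborel)"
    by (rule Fubini'[symmetric]) (use upd2 in \<open>simp add: case_prod_beta\<close>)
  also have "\<dots> = (\<integral>\<^sup>+y. (\<integral>\<^sup>+x. F (hyperplane_graph n x) * indicator {0..1} (l (hyperplane_graph n x) + y) \<partial>?M) \<partial>lborel)"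
  proof (rule nn_integral_cong)
    fix y :: real
    have "(\<lambda>x. f (x(n := ?g x y))) \<in> borel_measurable ?M"
      using measurable_compose[OF measurable_Pair2'[of y lborel ?M] upd2] by simp
    then have "(\<integral>\<^sup>+x. f (x(n := ?g x y)) \<partial>?M)
        = (\<integral>\<^sup>+x. f ((\<lambda>i\<in>?I. x i + y)(n := ?g (\<lambda>i\<in>?I. x i + y) y)) \<partial>?M)"
      by (subst nn_integral_PiM_lborel_translate) auto
    also have "\<dots> = (\<integral>\<^sup>+x. F (hyperplane_graph n x) * indicator {0..1} (l (hyperplane_graph n x) + y) \<partial>?M)"
    proof (rule nn_integral_cong)
      fix x
      have "?S (\<lambda>i\<in>?I. x i + y) = ?S x + (real n - 1) * y"
        using n by (simp add: sum.distrib of_nat_diff)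
      then have "(\<lambda>i\<in>?I. x i + y)(n := ?g (\<lambda>i\<in>?I. x i + y) y)
          = (\<lambda>i\<in>{1..n}. hyperplane_graph n x i + y)"
        using n by (auto simp: fun_eq_iff hyperplane_graph_def algebra_simps)
      then show "f ((\<lambda>i\<in>?I. x i + y)(n := ?g (\<lambda>i\<in>?I. x i + y) y))
          = F (hyperplane_graph n x) * indicator {0..1} (l (hyperplane_graph n x) + y)"
        by (simp only: f_def F_translate l_translate)
    qed
    finally show "(\<integral>\<^sup>+x. f (x(n := ?g x y)) \<partial>?M)
        = (\<integral>\<^sup>+x. F (hyperplane_graph n x) * indicator {0..1} (l (hyperplane_graph n x) + y) \<partial>?M)" .
  qed
  also have "\<dots> = (\<integral>\<^sup>+x. (\<integral>\<^sup>+y. F (hyperplane_graph n x) * indicator {0..1} (l (hyperplane_graph n x) + y) \<partial>lborel) \<partial>?M)"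
    by (rule Fubini') measurable
  also have "\<dots> = (\<integral>\<^sup>+x. F (hyperplane_graph n x) \<partial>?M)"
  proof (rule nn_integral_cong)
    fix x
    have "(\<integral>\<^sup>+y. indicator {0..1} (a + y) \<partial>lborel) = (1 :: ennreal)" for a :: real
    proof -
      have "(\<integral>\<^sup>+y. indicator {0..1} (a + y) \<partial>lborel)
          = (\<integral>\<^sup>+y. indicator {- a..1 - a} y \<partial>(lborel :: real measure))"
        by (intro nn_integral_cong) (auto split: split_indicator)
      then show ?thesis by simp
    qed
    then show "(\<integral>\<^sup>+y. F (hyperplane_graph n x) * indicator {0..1} (l (hyperplane_graph n x) + y) \<partial>lborel)
        = F (hyperplane_graph n x)"
      by (subst nn_integral_cmult) auto
  qed
  finally show ?thesis unfolding f_def .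
qed

lemma borel_measurable_PiM_component:
  "i \<in> I \<Longrightarrow> (\<lambda>z. z i) \<in> borel_measurable (\<Pi>\<^sub>M k\<in>I. (lborel :: real measure))"
  using measurable_component_singleton[of i I "\<lambda>_. lborel"] by simp

lemma measurable_strict_mono_on:
  assumes "finite I"
  shows "Measurable.pred (\<Pi>\<^sub>M k\<in>I. (lborel :: real measure)) (strict_mono_on (I :: nat set))"
proof -
  have "Measurable.pred (\<Pi>\<^sub>M k\<in>I. (lborel :: real measure)) (\<lambda>z. z i < z j)" if "i \<in> I" "j \<in> I" for i j
    unfolding pred_def by (intro borel_measurable_less borel_measurable_PiM_component that)
  then have "Measurable.pred (\<Pi>\<^sub>M k\<in>I. (lborel :: real measure)) (\<lambda>z. \<forall>i\<in>I. \<forall>j\<in>I. i < j \<longrightarrow> z i < z j)"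
    using assms by (intro pred_intros_logic pred_intros_finite measurable_const) auto
  also have "(\<lambda>z. \<forall>i\<in>I. \<forall>j\<in>I. i < j \<longrightarrow> z i < z j) = strict_mono_on I"
    by (auto simp: fun_eq_iff strict_mono_on_def)
  finally show ?thesis .
qed

lemma nn_integral_exp_tail:
  fixes a c :: real
  assumes "c < 0"
  shows "(\<integral>\<^sup>+y. (if a < y then ennreal (exp (c * y)) else 0) \<partial>lborel) = ennreal (exp (c * a) / - c)"
proof -
  have "(\<integral>\<^sup>+y. (if a < y then ennreal (exp (c * y)) else 0) \<partial>lborel)
      = (\<integral>\<^sup>+y. ennreal (exp (c * y)) * indicator {a..} y \<partial>lborel)"
    by (rule nn_integral_cong_AE, rule AE_mp[OF AE_lborel_singleton[of a]])
      (auto intro!: AE_I2 split: split_indicator)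
  also have "\<dots> = ennreal (0 - exp (c * a) / c)"
  proof (rule nn_integral_FTC_atLeast)
    show "((\<lambda>y. exp (c * y) / c) has_real_derivative exp (c * y)) (at y)" for y
      using assms by (auto intro!: derivative_eq_intros)
    have "filterlim (\<lambda>y. c * y) at_bot at_top"
      using assms by (simp add: filterlim_tendsto_neg_mult_at_bot[OF tendsto_const] filterlim_ident)
    then have "((\<lambda>y. exp (c * y)) \<longlongrightarrow> 0) at_top"
      by (rule filterlim_compose[OF exp_at_bot])
    then show "((\<lambda>y. exp (c * y) / c) \<longlongrightarrow> 0) at_top"
      by (rule tendsto_divide_zero)
  qed auto
  finally show ?thesis by simp
qed

text \<open>Integrating out the largest coordinate \<open>y > z\<^sub>n\<close> leaves \<open>exp (c\<^sub>n\<^sub>+\<^sub>1 * z\<^sub>n) / - c\<^sub>n\<^sub>+\<^sub>1\<close>, that is, an integral of the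
same kind in which \<open>c\<^sub>n\<^sub>+\<^sub>1\<close> has been added to the coefficient of \<open>z\<^sub>n\<close>. Thus the tail sums of \<open>c\<close> appear
one after the other, and the integrals converge because these sums are negative. The last remaining
integral runs over \<open>z\<^sub>1\<close> in \<open>[0,1]\<close> with exponent \<open>0\<close>.\<close>

lemma nn_integral_exp_cone:
  fixes c :: "nat \<Rightarrow> real"
  assumes "n \<ge> 1" and "(\<Sum>k=1..n. c k) = 0" and "\<And>k. k \<in> {1..<n} \<Longrightarrow> (\<Sum>l=Suc k..n. c l) < 0"
  shows "(\<integral>\<^sup>+z. (if strict_mono_on {1..n} z \<and> z 1 \<in> {0..1} then ennreal (exp (\<Sum>k=1..n. c k * z k)) else 0)
      \<partial>(\<Pi>\<^sub>M k\<in>{1..n}. lborel)) = ennreal (\<Prod>k=1..<n. 1 / - (\<Sum>l=Suc k..n. c l))"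
  using assms
proof (induction n arbitrary: c rule: nat_induct_at_least)
  case base
  have "(\<integral>\<^sup>+z. (if strict_mono_on {1..1} z \<and> z 1 \<in> {0..1} then ennreal (exp (\<Sum>k=1..1. c k * z k)) else 0)
      \<partial>(\<Pi>\<^sub>M k\<in>{1..1}. lborel)) = (\<integral>\<^sup>+z. indicator {0..1} (z 1) \<partial>(\<Pi>\<^sub>M k\<in>{1::nat}. (lborel :: real measure)))"
    using base by (auto intro!: nn_integral_cong simp: strict_mono_on_def)
  also have "\<dots> = (\<integral>\<^sup>+y. indicator {0..1} y \<partial>(lborel :: real measure))"
    by (rule lborel_product.product_nn_integral_singleton) simp
  finally show ?case by simp
next
  case (Suc n)
  let ?M = "\<Pi>\<^sub>M k\<in>{1..n}. (lborel :: real measure)" and ?N = "\<Pi>\<^sub>M k\<in>{1..Suc n}. (lborel :: real measure)"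
  \<comment> \<open>the coefficients left after the coordinate \<open>Suc n\<close> has been integrated out\<close>
  define c' where "c' = c(n := c n + c (Suc n))"
  have tail: "(\<Sum>l=k..n. c' l) = (\<Sum>l=k..Suc n. c l)" if "k \<le> n" for k
  proof -
    have "{k..n} = insert n {k..<n}" "{k..Suc n} = insert (Suc n) (insert n {k..<n})"
      using that by auto
    then show ?thesis by (simp add: c'_def)
  qed
  have c: "c (Suc n) < 0" using Suc.prems(2)[of n] Suc.hyps by simp
  let ?f = "\<lambda>z. if strict_mono_on {1..Suc n} z \<and> z 1 \<in> {0..1} then ennreal (exp (\<Sum>k=1..Suc n. c k * z k)) else 0"
  let ?g = "\<lambda>z. if strict_mono_on {1..n} z \<and> z 1 \<in> {0..1} then ennreal (exp (\<Sum>k=1..n. c' k * z k)) else 0"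
  note comp = borel_measurable_PiM_component
  have meas: "(\<lambda>z. if strict_mono_on {1..n} z \<and> z 1 \<in> {0..1} then ennreal (exp (\<Sum>k=1..n. c k * z k)) else 0)
      \<in> borel_measurable (\<Pi>\<^sub>M k\<in>{1..n}. (lborel :: real measure))" if "n \<ge> 1" for c :: "nat \<Rightarrow> real" and n
  proof -
    have [measurable]: "(\<lambda>z. z 1) \<in> borel_measurable (\<Pi>\<^sub>M k\<in>{1..n}. (lborel :: real measure))"
      using that by (intro comp) simp
    have [measurable]: "(\<lambda>z. \<Sum>k=1..n. c k * z k) \<in> borel_measurable (\<Pi>\<^sub>M k\<in>{1..n}. (lborel :: real measure))"
      by (intro borel_measurable_sum borel_measurable_times comp) auto
    note [measurable] = measurable_strict_mono_on[OF finite_atLeastAtMost[of 1 n]]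
    show ?thesis by measurable
  qed
  have strict: "strict_mono_on {1..Suc n} (x(Suc n := y)) \<longleftrightarrow> strict_mono_on {1..n} x \<and> x n < y"
    for x :: "nat \<Rightarrow> real" and y
  proof (intro iffI conjI)
    assume L: "strict_mono_on {1..Suc n} (x(Suc n := y))"
    show "strict_mono_on {1..n} x"
      using L by (force simp: strict_mono_on_def)
    show "x n < y"
      using strict_mono_onD[OF L, of n "Suc n"] Suc.hyps by simp
  next
    assume R: "strict_mono_on {1..n} x \<and> x n < y"
    then have "x i < y" if "i \<in> {1..n}" for i
      using that strict_mono_onD[of "{1..n}" x i n] Suc.hyps by (cases "i = n") auto
    then show "strict_mono_on {1..Suc n} (x(Suc n := y))"
      using R by (auto simp: strict_mono_on_def le_Suc_eq)
  qed
  have "(\<integral>\<^sup>+z. ?f z \<partial>?N) = (\<integral>\<^sup>+x. (\<integral>\<^sup>+y. ?f (x(Suc n := y)) \<partial>lborel) \<partial>(\<Pi>\<^sub>M k\<in>{1..<Suc n}. lborel))"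
    by (rule nn_integral_PiM_interval_Suc) (use meas in auto)
  also have "{1..<Suc n} = {1..n}" by auto
  also have "(\<integral>\<^sup>+x. (\<integral>\<^sup>+y. ?f (x(Suc n := y)) \<partial>lborel) \<partial>?M) = (\<integral>\<^sup>+x. ?g x * ennreal (1 / - c (Suc n)) \<partial>?M)"
  proof (rule nn_integral_cong)
    fix x :: "nat \<Rightarrow> real"
    let ?E = "exp (\<Sum>k=1..n. c k * x k)"
    have "(\<integral>\<^sup>+y. ?f (x(Suc n := y)) \<partial>lborel)
        = (\<integral>\<^sup>+y. (if strict_mono_on {1..n} x \<and> x 1 \<in> {0..1} then ennreal ?E else 0)
            * (if x n < y then ennreal (exp (c (Suc n) * y)) else 0) \<partial>lborel)"
      using Suc.hyps by (intro nn_integral_cong) (auto simp: strict[unfolded One_nat_def] exp_add ennreal_mult)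
    also have "\<dots> = (if strict_mono_on {1..n} x \<and> x 1 \<in> {0..1} then ennreal ?E else 0)
        * ennreal (exp (c (Suc n) * x n) / - c (Suc n))"
      by (subst nn_integral_cmult) (simp_all add: nn_integral_exp_tail[OF c])
    also have "\<dots> = ?g x * ennreal (1 / - c (Suc n))"
    proof -
      have "(\<Sum>k=1..n. c' k * x k) = (\<Sum>k=1..n. c k * x k) + c (Suc n) * x n"
      proof -
        have "{1..n} = insert n {1..<n}" using Suc.hyps by auto
        then show ?thesis by (simp add: c'_def algebra_simps)
      qed
      then have "?E * (exp (c (Suc n) * x n) / - c (Suc n)) = exp (\<Sum>k=1..n. c' k * x k) * (1 / - c (Suc n))"
        by (simp add: exp_add)
      moreover have "0 \<le> exp (c (Suc n) * x n) / - c (Suc n)" "0 \<le> 1 / - c (Suc n)"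
        using c by (simp_all add: divide_nonneg_neg)
      ultimately have "ennreal ?E * ennreal (exp (c (Suc n) * x n) / - c (Suc n))
          = ennreal (exp (\<Sum>k=1..n. c' k * x k)) * ennreal (1 / - c (Suc n))"
        by (simp only: ennreal_mult[symmetric] exp_ge_zero)
      then show ?thesis by simp
    qed
    finally show "(\<integral>\<^sup>+y. ?f (x(Suc n := y)) \<partial>lborel) = ?g x * ennreal (1 / - c (Suc n))" .
  qed
  also have "\<dots> = (\<integral>\<^sup>+x. ?g x \<partial>?M) * ennreal (1 / - c (Suc n))"
    by (rule nn_integral_multc, rule meas, rule Suc.hyps)
  also have "(\<integral>\<^sup>+x. ?g x \<partial>?M) = ennreal (\<Prod>k=1..<n. 1 / - (\<Sum>l=Suc k..n. c' l))"
  proof (rule Suc.IH)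
    show "(\<Sum>k=1..n. c' k) = 0" using tail[of 1] Suc.prems(1) Suc.hyps by simp
    show "(\<Sum>l=Suc k..n. c' l) < 0" if "k \<in> {1..<n}" for k
      using tail[of "Suc k"] Suc.prems(2)[of k] that by simp
  qed
  also have "(\<Prod>k=1..<n. 1 / - (\<Sum>l=Suc k..n. c' l)) = (\<Prod>k=1..<n. 1 / - (\<Sum>l=Suc k..Suc n. c l))"
    by (rule prod.cong) (auto simp: tail)
  also have "ennreal \<dots> * ennreal (1 / - c (Suc n))
      = ennreal ((\<Prod>k=1..<n. 1 / - (\<Sum>l=Suc k..Suc n. c l)) * (1 / - c (Suc n)))"
    using c Suc.prems(2) by (intro ennreal_mult[symmetric] prod_nonneg) (force intro: less_imp_le)+
  also have "(\<Prod>k=1..<n. 1 / - (\<Sum>l=Suc k..Suc n. c l)) * (1 / - c (Suc n))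
      = (\<Prod>k=1..<Suc n. 1 / - (\<Sum>l=Suc k..Suc n. c l))"
  proof -
    have "(\<Sum>l=Suc n..Suc n. c l) = c (Suc n)" by simp
    then show ?thesis by (simp only: prod.atLeastLessThan_Suc[OF Suc.hyps])
  qed
  finally show ?case .
qed

lemma AE_PiM_lborel_inj_on:
  fixes I :: "nat set"
  assumes "finite I"
  shows "AE z in \<Pi>\<^sub>M k\<in>I. (lborel :: real measure). inj_on z I"
proof -
  let ?M = "\<Pi>\<^sub>M k\<in>I. (lborel :: real measure)"
  note comp = borel_measurable_PiM_component
  have ne: "AE z in ?M. z i \<noteq> z j" if ij: "i \<in> I" "j \<in> I" "i \<noteq> j" for i j
  proof -
    let ?f = "\<lambda>z :: nat \<Rightarrow> real. indicator {z. z i = z j} z :: ennreal"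
    have eq: "I = insert i (I - {i})" using ij by auto
    have "{z \<in> space ?M. z i = z j} \<in> sets ?M"
      by (intro borel_measurable_eq comp ij)
    then have meas: "?f \<in> borel_measurable ?M"
      by (subst measurable_cong[where g = "indicator {z \<in> space ?M. z i = z j}"]) (auto split: split_indicator)
    have "(\<integral>\<^sup>+z. ?f z \<partial>?M) = (\<integral>\<^sup>+x. (\<integral>\<^sup>+y. ?f (x(i := y)) \<partial>lborel) \<partial>(\<Pi>\<^sub>M k\<in>I-{i}. lborel))"
      using lborel_product.product_nn_integral_insert[of "I - {i}" i ?f] meas assms unfolding eq[symmetric] by simp
    also have "\<dots> = (\<integral>\<^sup>+x. (\<integral>\<^sup>+y. indicator {x j} y \<partial>lborel) \<partial>(\<Pi>\<^sub>M k\<in>I-{i}. (lborel :: real measure)))"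
      using ij by (intro nn_integral_cong) (auto split: split_indicator)
    finally have "(\<integral>\<^sup>+z. ?f z \<partial>?M) = 0" by simp
    then have "AE z in ?M. ?f z = 0" using nn_integral_0_iff_AE[OF meas] by simp
    then show ?thesis by eventually_elim (auto split: split_indicator_asm)
  qed
  have "AE z in ?M. \<forall>i\<in>I. \<forall>j\<in>I. i \<noteq> j \<longrightarrow> z i \<noteq> z j"
  proof (intro AE_finite_allI assms)
    fix i j assume "i \<in> I" "j \<in> I"
    then show "AE z in ?M. i \<noteq> j \<longrightarrow> z i \<noteq> z j" using ne[of i j] by (cases "i = j") auto
  qed
  then show ?thesis by eventually_elim (auto simp: inj_on_def)
qed

text \<open>If the coordinates are distinct, then a sorting permutation is determined by the order statistics.\<close>

lemma ex1_sorting_permutation: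
  fixes z :: "nat \<Rightarrow> real"
  assumes inj: "inj_on z {1..n}"
  shows "\<exists>!p. p permutes {1..n} \<and> strict_mono_on {1..n} (z \<circ> p)"
proof -
  obtain p where p: "p permutes {1..n}" "mono_on {1..n} (z \<circ> p)"
    using sorting_permutation_exists by blast
  have "inj_on (z \<circ> p) {1..n}"
    using p(1) inj by (simp add: comp_inj_on permutes_inj_on permutes_image)
  then have "strict_mono_on {1..n} (z \<circ> p)"
    using p(2) unfolding strict_mono_on_def mono_on_def inj_on_def
    by (metis order_less_irrefl order_less_le)
  moreover have "q = p" if q: "q permutes {1..n}" "strict_mono_on {1..n} (z \<circ> q)" for q
  proof
    fix k
    show "q k = p k"
    proof (cases "k \<in> {1..n}")
      case True
      have "z (q k) = z (p k)"
        using order_stat_eq[OF p True] order_stat_eq[OF q(1) strict_mono_on_imp_mono_on[OF q(2)] True] by simp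
      then show ?thesis
        using inj_onD[OF inj] permutes_in_image[OF p(1)] permutes_in_image[OF q(1)] True by blast
    next
      case False
      then show ?thesis using p(1) q(1) by (simp add: permutes_not_in del: atLeastAtMost_iff)
    qed
  qed
  ultimately show ?thesis using p(1) by blast
qed

text \<open>Almost every vector has distinct coordinates and is sorted by exactly one permutation; on the part
belonging to \<open>p\<close> the coordinates are relabelled so that the vector becomes increasing.\<close>

lemma nn_integral_sum_over_orderings:
  fixes f :: "(nat \<Rightarrow> real) \<Rightarrow> ennreal"
  assumes f [measurable]: "f \<in> borel_measurable (\<Pi>\<^sub>M k\<in>{1..n}. lborel)"
  shows "(\<integral>\<^sup>+z. f z \<partial>(\<Pi>\<^sub>M k\<in>{1..n}. lborel))
    = (\<Sum>p | p permutes {1..n}. \<integral>\<^sup>+w. (if strict_mono_on {1..n} w then f (w \<circ> p) else 0) \<partial>(\<Pi>\<^sub>M k\<in>{1..n}. lborel))"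
proof -
  let ?M = "\<Pi>\<^sub>M k\<in>{1..n}. (lborel :: real measure)" and ?P = "{p. p permutes {1..n}}"
  have fin: "finite ?P" by (simp add: finite_permutations)
  note strict_sets = predE[OF measurable_strict_mono_on[OF finite_atLeastAtMost[of 1 n]]]
  have meas: "(\<lambda>w. if strict_mono_on {1..n} w then f (w \<circ> p) else 0) \<in> borel_measurable ?M"
    if "p \<in> ?P" for p
    using that by (intro measurable_If measurable_compose[OF measurable_PiM_permute f] strict_sets) auto
  have inv: "inv p \<in> ?P" if "p \<in> ?P" for p using that by (simp add: permutes_inv)
  have undo: "w \<circ> p \<circ> inv p = w" if "p \<in> ?P" for p and w :: "nat \<Rightarrow> real"
    using that permutes_inverses(1)[of p "{1..n}"] by (simp add: fun_eq_iff)
  have meas': "(\<lambda>z. if strict_mono_on {1..n} (z \<circ> p) then f z else 0) \<in> borel_measurable ?M"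
    if "p \<in> ?P" for p
    using measurable_compose[OF measurable_PiM_permute meas[OF inv[OF that]], of p] that
    by (simp add: undo[OF that] cong: if_cong)
  have "(\<integral>\<^sup>+z. f z \<partial>?M) = (\<integral>\<^sup>+z. (\<Sum>p\<in>?P. if strict_mono_on {1..n} (z \<circ> p) then f z else 0) \<partial>?M)"
  proof (rule nn_integral_cong_AE)
    show "AE z in ?M. f z = (\<Sum>p\<in>?P. if strict_mono_on {1..n} (z \<circ> p) then f z else 0)"
      using AE_PiM_lborel_inj_on[OF finite_atLeastAtMost[of 1 n]]
    proof eventually_elim
      case (elim z)
      from ex1_sorting_permutation[OF this] obtain p
        where p: "p permutes {1..n} \<and> strict_mono_on {1..n} (z \<circ> p)"
          and uniq: "\<forall>q. q permutes {1..n} \<and> strict_mono_on {1..n} (z \<circ> q) \<longrightarrow> q = p"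
        by (rule ex1E)
      have iff: "strict_mono_on {1..n} (z \<circ> q) \<longleftrightarrow> q = p" if "q \<in> ?P" for q
        using p uniq[rule_format, of q] that by blast
      have "(\<Sum>q\<in>?P. if strict_mono_on {1..n} (z \<circ> q) then f z else 0) = (\<Sum>q\<in>?P. if q = p then f z else 0)"
        by (rule sum.cong[OF refl]) (simp only: iff)
      also have "\<dots> = f z" using p fin by simp
      finally show ?case by simp
    qed
  qed
  also have "\<dots> = (\<Sum>p\<in>?P. \<integral>\<^sup>+z. (if strict_mono_on {1..n} (z \<circ> p) then f z else 0) \<partial>?M)"
    by (rule nn_integral_sum) (rule meas')
  also have "\<dots> = (\<Sum>p\<in>?P. \<integral>\<^sup>+w. (if strict_mono_on {1..n} w then f (w \<circ> inv p) else 0) \<partial>?M)"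
  proof (rule sum.cong)
    fix p assume p: "p \<in> ?P"
    show "(\<integral>\<^sup>+z. (if strict_mono_on {1..n} (z \<circ> p) then f z else 0) \<partial>?M)
        = (\<integral>\<^sup>+w. (if strict_mono_on {1..n} w then f (w \<circ> inv p) else 0) \<partial>?M)"
      using nn_integral_PiM_lborel_permute[OF _ _ meas[OF inv[OF p]], of p] p
      by (simp add: undo[OF p] cong: if_cong)
  qed simp
  also have "\<dots> = (\<Sum>p\<in>?P. \<integral>\<^sup>+w. (if strict_mono_on {1..n} w then f (w \<circ> p) else 0) \<partial>?M)"
    by (rule sum_permutations_inverse[symmetric])
  finally show ?thesis .
qed

section \<open>The Gibbs integrals as sums over ranks\<close>

text \<open>Every pair \<open>i \<noteq> j\<close> is the image of \<open>(1, 2)\<close> under equally many permutations, since composing with a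
permutation that moves \<open>(1, 2)\<close> to \<open>(i, j)\<close> is a bijection; the common number is
\<open>fact n / (n * (n - 1))\<close> by counting all permutations.\<close>

lemma sum_permutations_pair:
  fixes g :: "nat \<Rightarrow> nat \<Rightarrow> real"
  assumes n: "n \<ge> 2"
  shows "real n * (real n - 1) * (\<Sum>p | p permutes {1..n}. g (p 1) (p 2))
    = fact n * (\<Sum>i\<in>{1..n}. \<Sum>j\<in>{1..n} - {i}. g i j)"
proof -
  let ?P = "{p. p permutes {1..n}}"
  define D where "D = Sigma {1..n} (\<lambda>i. {1..n} - {i})"
  define N where "N d = card {p \<in> ?P. (p 1, p 2) = d}" for d :: "nat \<times> nat"
  have finP: "finite ?P" by (simp add: finite_permutations)
  have finD: "finite D" by (simp add: D_def)
  have im: "(p 1, p 2) \<in> D" if "p \<in> ?P" for p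
  proof -
    have p: "p permutes {1..n}" using that by simp
    have "p 1 \<in> {1..n}" "p 2 \<in> {1..n}" using n permutes_in_image[OF p] by auto
    moreover have "p 1 \<noteq> p 2" using injD[OF permutes_inj[OF p], of 1 2] by auto
    ultimately show ?thesis by (auto simp: D_def)
  qed
  have group: "(\<Sum>p\<in>?P. h (p 1) (p 2)) = (\<Sum>d\<in>D. real (N d) * case_prod h d)" for h :: "nat \<Rightarrow> nat \<Rightarrow> real"
  proof -
    have "(\<Sum>d\<in>D. \<Sum>p | p \<in> ?P \<and> (p 1, p 2) = d. h (p 1) (p 2)) = (\<Sum>p\<in>?P. h (p 1) (p 2))"
      by (rule sum.group) (use finP finD im in auto)
    moreover have "(\<Sum>p | p \<in> ?P \<and> (p 1, p 2) = d. h (p 1) (p 2)) = real (N d) * case_prod h d" for d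
    proof -
      have "(\<Sum>p | p \<in> ?P \<and> (p 1, p 2) = d. h (p 1) (p 2)) = (\<Sum>p | p \<in> ?P \<and> (p 1, p 2) = d. case_prod h d)"
        by (rule sum.cong) auto
      then show ?thesis by (simp add: N_def)
    qed
    ultimately show ?thesis by simp
  qed
  have const: "N d = N (1, 2)" if d: "d \<in> D" for d
  proof -
    obtain i j where ij: "d = (i, j)" "i \<in> {1..n}" "j \<in> {1..n}" "j \<noteq> i"
      using d unfolding D_def by blast
    \<comment> \<open>first \<open>1\<close> is moved to \<open>i\<close>, which may move \<open>2\<close> to some \<open>a \<noteq> i\<close>; then \<open>a\<close> is moved to \<open>j\<close>\<close>
    define a where "a = Transposition.transpose 1 i (2 :: nat)"
    define \<tau> where "\<tau> = Transposition.transpose a j \<circ> Transposition.transpose 1 i"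
    have a: "a \<in> {1..n}" "a \<noteq> i"
      using ij n by (auto simp: a_def Transposition.transpose_def)
    have \<tau>: "\<tau> permutes {1..n}"
      unfolding \<tau>_def by (intro permutes_compose permutes_swap_id) (use a ij n in auto)
    have \<tau>12: "\<tau> 1 = i" "\<tau> 2 = j"
      using a ij by (auto simp: \<tau>_def a_def[symmetric, unfolded One_nat_def])
    have inj: "inj \<tau>" using \<tau> by (rule permutes_inj)
    have "bij_betw (\<lambda>p. \<tau> \<circ> p) {p \<in> ?P. (p 1, p 2) = (1, 2)} {p \<in> ?P. (p 1, p 2) = d}"
    proof (rule bij_betw_byWitness[where f' = "\<lambda>p. inv \<tau> \<circ> p"])
      show "\<forall>p\<in>{p \<in> ?P. (p 1, p 2) = (1, 2)}. inv \<tau> \<circ> (\<tau> \<circ> p) = p"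
        using inj by (auto simp: fun_eq_iff)
      show "\<forall>p\<in>{p \<in> ?P. (p 1, p 2) = d}. \<tau> \<circ> (inv \<tau> \<circ> p) = p"
        using permutes_inverses(1)[OF \<tau>] by (auto simp: fun_eq_iff)
      show "(\<lambda>p. \<tau> \<circ> p) ` {p \<in> ?P. (p 1, p 2) = (1, 2)} \<subseteq> {p \<in> ?P. (p 1, p 2) = d}"
        using \<tau> \<tau>12 ij(1) by (auto intro: permutes_compose)
      have "inv \<tau> i = 1" "inv \<tau> j = 2"
        using inj \<tau>12 by (metis inv_f_f)+
      then show "(\<lambda>p. inv \<tau> \<circ> p) ` {p \<in> ?P. (p 1, p 2) = d} \<subseteq> {p \<in> ?P. (p 1, p 2) = (1, 2)}"
        using permutes_inv[OF \<tau>] ij(1) by (auto intro: permutes_compose)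
    qed
    then show ?thesis unfolding N_def by (rule bij_betw_same_card[symmetric])
  qed
  have cardD: "real (card D) = real n * (real n - 1)"
    using n by (simp add: D_def of_nat_diff)
  have "fact n = (\<Sum>p\<in>?P. (1 :: real))"
    using card_permutations[of "{1..n}" n] by simp
  also have "\<dots> = (\<Sum>d\<in>D. real (N d))"
    using group[of "\<lambda>_ _. 1"] by (simp add: case_prod_beta)
  also have "\<dots> = real n * (real n - 1) * real (N (1, 2))"
    using const cardD by simp
  finally have N: "fact n = real n * (real n - 1) * real (N (1, 2))" .
  have "(\<Sum>p\<in>?P. g (p 1) (p 2)) = real (N (1, 2)) * (\<Sum>d\<in>D. case_prod g d)"
    unfolding group[of g] sum_distrib_left by (rule sum.cong[OF refl]) (simp only: const)
  also have "(\<Sum>d\<in>D. case_prod g d) = (\<Sum>i\<in>{1..n}. \<Sum>j\<in>{1..n} - {i}. g i j)"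
    unfolding D_def by (subst sum.Sigma) auto
  finally show ?thesis by (simp add: N)
qed

text \<open>The coefficient of the \<open>k\<close>-th gap in the \<open>i\<close>-th smallest coordinate of a vector with sum zero.\<close>

definition rank_slope :: "nat \<Rightarrow> nat \<Rightarrow> nat \<Rightarrow> real" where
  "rank_slope n i k = (if k < i then real k / real n else real k / real n - 1)"

text \<open>The rate of the exponential in the \<open>k\<close>-th gap when the first two coordinates have ranks \<open>i\<close> and \<open>j\<close>.\<close>

definition gap_rate :: "(real \<Rightarrow> real) \<Rightarrow> real \<Rightarrow> nat \<Rightarrow> real \<Rightarrow> real \<Rightarrow> nat \<Rightarrow> nat \<Rightarrow> nat \<Rightarrow> real" where
  "gap_rate b \<sigma> n s t i j k =
     2 * real n / \<sigma>\<^sup>2 * prim b (real k / real n) - s * rank_slope n i k - t * rank_slope n j k"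

text \<open>The extension of the integrand from the hyperplane to \<open>\<real>\<^sup>n\<close> that is invariant under translations along
the diagonal.\<close>

definition centered_weight ::
  "(real \<Rightarrow> real) \<Rightarrow> real \<Rightarrow> nat \<Rightarrow> real \<Rightarrow> real \<Rightarrow> (nat \<Rightarrow> real) \<Rightarrow> real" where
  "centered_weight b \<sigma> n s t z =
     exp (s * (z 1 - (\<Sum>k=1..n. z k) / real n) + t * (z 2 - (\<Sum>k=1..n. z k) / real n))
     * gibbs_weight b \<sigma> n z"

lemma borel_measurable_centered_weight:
  assumes "n \<ge> 2"
  shows "(\<lambda>z. centered_weight b \<sigma> n s t z) \<in> borel_measurable (\<Pi>\<^sub>M k\<in>{1..n}. (lborel :: real measure))"
  unfolding centered_weight_def gibbs_weight_def
  using assms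
  by (intro borel_measurable_times borel_measurable_exp[THEN measurable_compose[rotated]]
      borel_measurable_add borel_measurable_diff borel_measurable_divide borel_measurable_sum
      borel_measurable_const borel_measurable_PiM_component measurable_order_stat) auto

lemma sum_drift_interval:
  assumes "k \<le> n" "n \<ge> 1"
  shows "(\<Sum>l=Suc k..n. drift b n l) = real n * (prim b 1 - prim b (real k / real n))"
proof -
  have "(\<Sum>l=Suc k..n. drift b n l)
      = real n * (\<Sum>l=Suc k..n. prim b (real l / real n) - prim b (real (l - 1) / real n))"
    unfolding drift_def sum_distrib_left by (rule sum.cong) (auto simp: of_nat_diff)
  also have "(\<Sum>l=Suc k..n. prim b (real l / real n) - prim b (real (l - 1) / real n))
      = prim b (real n / real n) - prim b (real k / real n)"
    using sum_telescope''[of k n "\<lambda>l. prim b (real l / real n)"] assms by simp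
  finally show ?thesis using assms by simp
qed

lemma centered_weight_translate:
  assumes n: "n \<ge> 2" and prim1: "prim b 1 = 0"
  shows "centered_weight b \<sigma> n s t (\<lambda>i\<in>{1..n}. z i + c) = centered_weight b \<sigma> n s t z"
proof -
  have "(\<Sum>k=1..n. drift b n k) = 0"
    using sum_drift_interval[of 0 n b] n prim1 by (simp add: prim_def)
  moreover have "(\<Sum>k=1..n. drift b n k * order_stat n (\<lambda>i\<in>{1..n}. z i + c) k)
      = (\<Sum>k=1..n. drift b n k * order_stat n z k) + (\<Sum>k=1..n. drift b n k) * c"
  proof -
    have "(\<Sum>k=1..n. drift b n k * order_stat n (\<lambda>i\<in>{1..n}. z i + c) k)
        = (\<Sum>k=1..n. drift b n k * (order_stat n z k + c))"
      by (rule sum.cong[OF refl]) (simp only: order_stat_translate)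
    then show ?thesis by (simp add: distrib_left sum.distrib sum_distrib_right)
  qed
  moreover have "(\<Sum>k=1..n. (\<lambda>i\<in>{1..n}. z i + c) k) / real n = (\<Sum>k=1..n. z k) / real n + c"
    using n by (simp add: sum.distrib field_simps)
  ultimately show ?thesis
    using n by (simp add: centered_weight_def gibbs_weight_def)
qed

lemma order_stat_permuted_increasing:
  assumes p: "p permutes {1..n}" and w: "strict_mono_on {1..n} w" and k: "k \<in> {1..n}"
  shows "order_stat n (w \<circ> p) k = w k"
proof -
  have inv: "w \<circ> p \<circ> inv p = w"
    using permutes_inverses(1)[OF p] by (simp add: fun_eq_iff)
  have "order_stat n (w \<circ> p) k = (w \<circ> p) (inv p k)"
    by (rule order_stat_eq[OF permutes_inv[OF p] _ k])
      (simp only: inv strict_mono_on_imp_mono_on[OF w])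
  then show ?thesis using permutes_inverses(1)[OF p] by simp
qed

text \<open>In the sector where \<open>p\<close> relates the coordinates to their ranks the exponent is linear in the sorted
vector. Its coefficients sum to zero, by translation invariance, and the negatives of their tail sums
are the rates of the gaps.\<close>

lemma nn_integral_centered_weight_cone:
  assumes n: "n \<ge> 2" and prim1: "prim b 1 = 0" and p: "p permutes {1..n}"
    and pos: "\<And>k. k \<in> {1..<n} \<Longrightarrow> 0 < gap_rate b \<sigma> n s t (p 1) (p 2) k"
  shows "(\<integral>\<^sup>+w. (if strict_mono_on {1..n} w then
        ennreal (centered_weight b \<sigma> n s t (w \<circ> p)) * indicator {0..1} (order_stat n (w \<circ> p) 1) else 0)
      \<partial>(\<Pi>\<^sub>M k\<in>{1..n}. lborel)) = ennreal (\<Prod>k=1..<n. 1 / gap_rate b \<sigma> n s t (p 1) (p 2) k)"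
proof -
  \<comment> \<open>the coefficient of the \<open>k\<close>-th smallest coordinate in the exponent\<close>
  define c where "c k = 2 / \<sigma>\<^sup>2 * drift b n k + s * (of_bool (k = p 1) - 1 / real n)
      + t * (of_bool (k = p 2) - 1 / real n)" for k
  have p12: "p 1 \<in> {1..n}" "p 2 \<in> {1..n}"
    using permutes_in_image[OF p] n by auto
  have delta: "(\<Sum>l=Suc k..n. of_bool (l = m) - 1 / real n) = rank_slope n m k"
    if "k \<le> n" "m \<in> {1..n}" for k m
  proof -
    have "(\<Sum>l=Suc k..n. of_bool (l = m) :: real) = (\<Sum>l=Suc k..n. if l = m then 1 else 0)"
      by (rule sum.cong) auto
    also have "\<dots> = of_bool (k < m)" using that by (subst sum.delta) auto
    finally have "(\<Sum>l=Suc k..n. of_bool (l = m) :: real) = of_bool (k < m)" .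
    then have "(\<Sum>l=Suc k..n. of_bool (l = m) - 1 / real n) = of_bool (k < m) - (real n - real k) / real n"
      using that by (simp only: sum_subtractf) (simp add: of_nat_diff)
    then show ?thesis
      using n by (simp only:) (simp add: rank_slope_def diff_divide_distrib)
  qed
  have tail: "(\<Sum>l=Suc k..n. c l) = - gap_rate b \<sigma> n s t (p 1) (p 2) k" if "k \<le> n" for k
  proof -
    have "(\<Sum>l=Suc k..n. c l) = 2 / \<sigma>\<^sup>2 * (\<Sum>l=Suc k..n. drift b n l)
        + s * (\<Sum>l=Suc k..n. of_bool (l = p 1) - 1 / real n)
        + t * (\<Sum>l=Suc k..n. of_bool (l = p 2) - 1 / real n)"
      unfolding c_def by (simp only: sum.distrib sum_distrib_left)
    also have "\<dots> = 2 / \<sigma>\<^sup>2 * (real n * (0 - prim b (real k / real n)))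
        + s * rank_slope n (p 1) k + t * rank_slope n (p 2) k"
      using that n p12 by (simp only: delta sum_drift_interval prim1)
    finally show ?thesis by (simp add: gap_rate_def)
  qed
  have c0: "(\<Sum>k=1..n. c k) = 0"
    using tail[of 0] p12 by (simp add: gap_rate_def rank_slope_def prim_def)
  have weight: "centered_weight b \<sigma> n s t (w \<circ> p) = exp (\<Sum>k=1..n. c k * w k)"
    if w: "strict_mono_on {1..n} w" for w
  proof -
    have mean: "(\<Sum>k=1..n. (w \<circ> p) k) = (\<Sum>k=1..n. w k)"
      using sum.permute[OF p, of w] by simp
    have pick: "(\<Sum>k=1..n. (of_bool (k = m) - 1 / real n) * w k) = w m - (\<Sum>k=1..n. w k) / real n"
      if "m \<in> {1..n}" for m
    proof -
      have "(\<Sum>k=1..n. of_bool (k = m) * w k) = (\<Sum>k=1..n. if k = m then w k else 0)"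
        by (rule sum.cong) auto
      also have "\<dots> = w m" using that by (subst sum.delta) auto
      finally show ?thesis
        by (simp add: left_diff_distrib sum_subtractf sum_divide_distrib)
    qed
    have "(\<Sum>k=1..n. c k * w k) = 2 / \<sigma>\<^sup>2 * (\<Sum>k=1..n. drift b n k * w k)
        + s * (\<Sum>k=1..n. (of_bool (k = p 1) - 1 / real n) * w k)
        + t * (\<Sum>k=1..n. (of_bool (k = p 2) - 1 / real n) * w k)"
      unfolding c_def by (simp add: distrib_right sum.distrib sum_distrib_left mult.assoc del: of_bool_eq_iff)
    also have "\<dots> = 2 / \<sigma>\<^sup>2 * (\<Sum>k=1..n. drift b n k * order_stat n (w \<circ> p) k)
        + s * ((w \<circ> p) 1 - (\<Sum>k=1..n. (w \<circ> p) k) / real n)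
        + t * ((w \<circ> p) 2 - (\<Sum>k=1..n. (w \<circ> p) k) / real n)"
      using p12 by (simp only: pick mean[unfolded o_apply] o_apply order_stat_permuted_increasing[OF p w] cong: sum.cong)
    finally show ?thesis
      by (simp add: centered_weight_def gibbs_weight_def exp_add)
  qed
  have "(\<integral>\<^sup>+w. (if strict_mono_on {1..n} w then
        ennreal (centered_weight b \<sigma> n s t (w \<circ> p)) * indicator {0..1} (order_stat n (w \<circ> p) 1) else 0)
      \<partial>(\<Pi>\<^sub>M k\<in>{1..n}. lborel))
    = (\<integral>\<^sup>+w. (if strict_mono_on {1..n} w \<and> w 1 \<in> {0..1} then ennreal (exp (\<Sum>k=1..n. c k * w k)) else 0)
      \<partial>(\<Pi>\<^sub>M k\<in>{1..n}. lborel))"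
  proof (rule nn_integral_cong)
    fix w :: "nat \<Rightarrow> real"
    show "(if strict_mono_on {1..n} w then
        ennreal (centered_weight b \<sigma> n s t (w \<circ> p)) * indicator {0..1} (order_stat n (w \<circ> p) 1) else 0)
      = (if strict_mono_on {1..n} w \<and> w 1 \<in> {0..1} then ennreal (exp (\<Sum>k=1..n. c k * w k)) else 0)"
    proof (cases "strict_mono_on {1..n} w")
      case True
      have "order_stat n (w \<circ> p) 1 = w 1"
        using order_stat_permuted_increasing[OF p True, of 1] n by simp
      then show ?thesis using True weight[OF True] by (simp split: split_indicator)
    qed simp
  qed
  also have "\<dots> = ennreal (\<Prod>k=1..<n. 1 / - (\<Sum>l=Suc k..n. c l))"
    using n c0 pos tail by (intro nn_integral_exp_cone) auto
  also have "(\<Prod>k=1..<n. 1 / - (\<Sum>l=Suc k..n. c l)) = (\<Prod>k=1..<n. 1 / gap_rate b \<sigma> n s t (p 1) (p 2) k)"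
    by (rule prod.cong) (auto simp: tail)
  finally show ?thesis .
qed

lemma nn_integral_centered_weight_graph:
  assumes n: "n \<ge> 2" and prim1: "prim b 1 = 0"
    and pos: "\<And>i j k. i \<in> {1..n} \<Longrightarrow> j \<in> {1..n} \<Longrightarrow> i \<noteq> j \<Longrightarrow> k \<in> {1..<n} \<Longrightarrow> 0 < gap_rate b \<sigma> n s t i j k"
  shows "(\<integral>\<^sup>+x. ennreal (centered_weight b \<sigma> n s t (hyperplane_graph n x)) \<partial>(\<Pi>\<^sub>M k\<in>{1..<n}. lborel))
    = ennreal (fact n / (real n * (real n * (real n - 1)))
        * (\<Sum>i\<in>{1..n}. \<Sum>j\<in>{1..n} - {i}. \<Prod>k=1..<n. 1 / gap_rate b \<sigma> n s t i j k))"
    (is "?A = ennreal (?C * ?S)")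
proof -
  let ?N = "\<Pi>\<^sub>M k\<in>{1..n}. (lborel :: real measure)"
  let ?F = "\<lambda>z. ennreal (centered_weight b \<sigma> n s t z)" and ?l = "\<lambda>z. order_stat n z 1"
  let ?g = "\<lambda>i j. \<Prod>k=1..<n. 1 / gap_rate b \<sigma> n s t i j k"
  have F [measurable]: "?F \<in> borel_measurable ?N"
    using borel_measurable_centered_weight[OF n] by measurable
  have l [measurable]: "?l \<in> borel_measurable ?N"
    using n by (intro measurable_order_stat) auto
  have g_nonneg: "0 \<le> ?g (p 1) (p 2)" and
    cone: "(\<integral>\<^sup>+w. (if strict_mono_on {1..n} w then ?F (w \<circ> p) * indicator {0..1} (?l (w \<circ> p)) else 0) \<partial>?N)
      = ennreal (?g (p 1) (p 2))"
    if p: "p permutes {1..n}" for p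
  proof -
    have "p 1 \<in> {1..n}" "p 2 \<in> {1..n}" using permutes_in_image[OF p] n by auto
    moreover have "p 1 \<noteq> p 2" using injD[OF permutes_inj[OF p], of 1 2] by auto
    ultimately have pos': "0 < gap_rate b \<sigma> n s t (p 1) (p 2) k" if "k \<in> {1..<n}" for k
      using pos that by blast
    then show "0 \<le> ?g (p 1) (p 2)" by (intro prod_nonneg) (auto intro: less_imp_le)
    show "(\<integral>\<^sup>+w. (if strict_mono_on {1..n} w then ?F (w \<circ> p) * indicator {0..1} (?l (w \<circ> p)) else 0) \<partial>?N)
      = ennreal (?g (p 1) (p 2))"
      by (rule nn_integral_centered_weight_cone[OF n prim1 p pos'])
  qed
  have "of_nat n * ?A = (\<integral>\<^sup>+z. ?F z * indicator {0..1} (?l z) \<partial>?N)"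
  proof (rule nn_integral_translation_invariant[symmetric, OF _ F l])
    show "1 \<le> n" using n by simp
    show "?F (\<lambda>i\<in>{1..n}. z i + c) = ?F z" for z c
      by (simp only: centered_weight_translate[OF n prim1])
    show "?l (\<lambda>i\<in>{1..n}. z i + c) = ?l z + c" for z c
      by (rule order_stat_translate) (use n in simp)
  qed
  also have "\<dots> = (\<Sum>p | p permutes {1..n}. \<integral>\<^sup>+w. (if strict_mono_on {1..n} w then
      ?F (w \<circ> p) * indicator {0..1} (?l (w \<circ> p)) else 0) \<partial>?N)"
    by (rule nn_integral_sum_over_orderings) measurable
  also have "\<dots> = (\<Sum>p | p permutes {1..n}. ennreal (?g (p 1) (p 2)))"
    by (rule sum.cong) (use cone in auto)
  also have "\<dots> = ennreal (\<Sum>p | p permutes {1..n}. ?g (p 1) (p 2))"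
    by (rule sum_ennreal) (use g_nonneg in auto)
  also have "(\<Sum>p | p permutes {1..n}. ?g (p 1) (p 2)) = real n * (?C * ?S)"
  proof -
    have "P = m * (f / (m * (m * (m - 1))) * T)" if "m * (m - 1) * P = f * T" "m \<ge> 2" for m f P T :: real
    proof -
      have "P = f * T / (m * (m - 1))" using that by (simp add: eq_divide_eq mult.commute)
      then show ?thesis using that(2) by simp
    qed
    from this[OF sum_permutations_pair[OF n, of ?g]] show ?thesis using n by simp
  qed
  finally have "ennreal (real n) * ?A = ennreal (real n * (?C * ?S))"
    by (simp add: ennreal_of_nat_eq_real_of_nat)
  also have "\<dots> = ennreal (real n) * ennreal (?C * ?S)"
    by (rule ennreal_mult') simp
  finally show ?thesis
    using n by (subst (asm) ennreal_mult_cancel_left) auto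
qed

lemma borel_measurable_surface_measure:
  assumes f: "f \<in> borel_measurable (\<Pi>\<^sub>M k\<in>{1..n}. (lborel :: real measure))"
  shows "f \<in> borel_measurable (restrict_space (\<Pi>\<^sub>M k\<in>{1..n}. (borel :: real measure)) (hyperplane n))"
    and "f \<in> borel_measurable (surface_measure n)"
proof -
  let ?R = "restrict_space (\<Pi>\<^sub>M k\<in>{1..n}. (borel :: real measure)) (hyperplane n)"
  have "sets (\<Pi>\<^sub>M k\<in>{1..n}. (lborel :: real measure)) = sets (\<Pi>\<^sub>M k\<in>{1..n}. (borel :: real measure))"
    by (intro sets_PiM_cong) auto
  from measurable_cong_sets[OF this refl, of borel] f
  have "f \<in> borel_measurable (\<Pi>\<^sub>M k\<in>{1..n}. (borel :: real measure))" by blast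
  then show R: "f \<in> borel_measurable ?R" by (rule measurable_restrict_space1)
  have "sets (surface_measure n) = sets ?R" by (simp add: surface_measure_def)
  from measurable_cong_sets[OF this refl, of borel] R
  show "f \<in> borel_measurable (surface_measure n)" by blast
qed

lemma nn_integral_surface_measure:
  assumes n: "n \<ge> 1"
    and f: "f \<in> borel_measurable (\<Pi>\<^sub>M k\<in>{1..n}. (lborel :: real measure))"
  shows "(\<integral>\<^sup>+z. f z \<partial>surface_measure n)
    = ennreal (sqrt (real n)) * (\<integral>\<^sup>+x. f (hyperplane_graph n x) \<partial>(\<Pi>\<^sub>M k\<in>{1..<n}. lborel))"
proof -
  let ?M = "\<Pi>\<^sub>M k\<in>{1..<n}. (lborel :: real measure)"
  note graph = measurable_hyperplane_graph[OF n] and f' = borel_measurable_surface_measure(1)[OF f]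
  have "(\<integral>\<^sup>+z. f z \<partial>surface_measure n)
      = (\<integral>\<^sup>+x. f (hyperplane_graph n x) \<partial>scale_measure (ennreal (sqrt (real n))) ?M)"
    unfolding surface_measure_def by (rule nn_integral_distr) (use graph f' in simp_all)
  also have "\<dots> = ennreal (sqrt (real n)) * (\<integral>\<^sup>+x. f (hyperplane_graph n x) \<partial>?M)"
    by (rule nn_integral_scale_measure[OF measurable_compose[OF graph f']])
  finally show ?thesis .
qed

lemma centered_weight_on_hyperplane:
  assumes "z \<in> hyperplane n"
  shows "centered_weight b \<sigma> n s t z = exp (s * z 1 + t * z 2) * gibbs_weight b \<sigma> n z"
  using assms by (simp add: centered_weight_def hyperplane_def)

text \<open>The constants from the surface measure, from the slab and from counting permutations are common to
numerator and partition function.\<close>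

lemma L2_inf_eq_gap_rate_sum:
  assumes n: "n \<ge> 2" and prim1: "prim b 1 = 0"
    and pos: "\<And>i j k. i \<in> {1..n} \<Longrightarrow> j \<in> {1..n} \<Longrightarrow> i \<noteq> j \<Longrightarrow> k \<in> {1..<n} \<Longrightarrow> 0 < gap_rate b \<sigma> n s t i j k"
    and pos0: "\<And>k. k \<in> {1..<n} \<Longrightarrow> 0 < gap_rate b \<sigma> n 0 0 1 1 k"
  shows "L2_inf b \<sigma> n s t = ennreal (1 / (real n * (real n - 1)) *
    (\<Sum>i\<in>{1..n}. \<Sum>j\<in>{1..n} - {i}. \<Prod>k=1..<n. gap_rate b \<sigma> n 0 0 1 1 k / gap_rate b \<sigma> n s t i j k))"
proof -
  let ?M = "\<Pi>\<^sub>M k\<in>{1..<n}. (lborel :: real measure)"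
  define S where "S s t = (\<Sum>i\<in>{1..n}. \<Sum>j\<in>{1..n} - {i}. \<Prod>k=1..<n. 1 / gap_rate b \<sigma> n s t i j k)" for s t
  define C where "C = sqrt (real n) * (fact n / (real n * (real n * (real n - 1))))"
  define \<Lambda> where "\<Lambda> = (\<Prod>k=1..<n. gap_rate b \<sigma> n 0 0 1 1 k)"
  have C: "C > 0" using n by (simp add: C_def)
  have \<Lambda>: "\<Lambda> > 0" unfolding \<Lambda>_def using pos0 by (rule prod_pos)
  have rate0: "gap_rate b \<sigma> n 0 0 i j k = gap_rate b \<sigma> n 0 0 1 1 k" for i j k
    by (simp add: gap_rate_def)
  have S_nonneg: "0 \<le> S s t"
    unfolding S_def using pos by (intro sum_nonneg prod_nonneg) (auto intro!: less_imp_le)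
  have meas [measurable]: "(\<lambda>z. ennreal (centered_weight b \<sigma> n s t z)) \<in> borel_measurable (\<Pi>\<^sub>M k\<in>{1..n}. (lborel :: real measure))" for s t
    using borel_measurable_centered_weight[OF n] by measurable
  have int: "(\<integral>\<^sup>+z. ennreal (centered_weight b \<sigma> n s t z) \<partial>surface_measure n) = ennreal (C * S s t)"
    if "\<And>i j k. i \<in> {1..n} \<Longrightarrow> j \<in> {1..n} \<Longrightarrow> i \<noteq> j \<Longrightarrow> k \<in> {1..<n} \<Longrightarrow> 0 < gap_rate b \<sigma> n s t i j k" for s t
    using n nn_integral_centered_weight_graph[OF n prim1 that]
    by (subst nn_integral_surface_measure[OF _ meas]) (simp_all add: S_def C_def ennreal_mult'[symmetric] mult.assoc)
  have S0: "S 0 0 = real n * (real n - 1) / \<Lambda>"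
  proof -
    have "S 0 0 = (\<Sum>i\<in>{1..n}. \<Sum>j\<in>{1..n} - {i}. 1 / \<Lambda>)"
      unfolding S_def \<Lambda>_def by (subst rate0) (simp add: prod_dividef)
    also have "\<dots> = real n * (real n - 1) / \<Lambda>"
      using n by (simp add: of_nat_diff)
    finally show ?thesis .
  qed
  have Z: "partition_fn b \<sigma> n = ennreal (C * (real n * (real n - 1) / \<Lambda>))"
  proof -
    have "partition_fn b \<sigma> n = (\<integral>\<^sup>+z. ennreal (centered_weight b \<sigma> n 0 0 z) \<partial>surface_measure n)"
      unfolding partition_fn_def by (simp add: centered_weight_def)
    also have "\<dots> = ennreal (C * S 0 0)"
      by (rule int, subst rate0, rule pos0)
    finally show ?thesis by (simp add: S0)
  qed
  have "L2_inf b \<sigma> n s t = (\<integral>\<^sup>+z. 1 / partition_fn b \<sigma> n * ennreal (centered_weight b \<sigma> n s t z) \<partial>surface_measure n)"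
    unfolding L2_inf_def p_inf_n_def
    by (rule nn_integral_cong)
      (simp add: space_surface_measure centered_weight_on_hyperplane ennreal_mult' mult.left_commute gibbs_weight_def)
  also have "\<dots> = 1 / partition_fn b \<sigma> n * (\<integral>\<^sup>+z. ennreal (centered_weight b \<sigma> n s t z) \<partial>surface_measure n)"
    by (rule nn_integral_cmult, rule borel_measurable_surface_measure) (rule meas)
  also have "\<dots> = 1 / ennreal (C * (real n * (real n - 1) / \<Lambda>)) * ennreal (C * S s t)"
  proof -
    have "(\<integral>\<^sup>+z. ennreal (centered_weight b \<sigma> n s t z) \<partial>surface_measure n) = ennreal (C * S s t)"
      by (rule int, rule pos)
    then show ?thesis by (simp only: Z)
  qed
  also have "\<dots> = ennreal (1 / (C * (real n * (real n - 1) / \<Lambda>)) * (C * S s t))"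
  proof -
    have pos: "0 < C * (real n * (real n - 1) / \<Lambda>)" using C \<Lambda> n by simp
    have "1 / ennreal x * ennreal y = ennreal (1 / x * y)" if "x > 0" for x y :: real
    proof -
      have "1 / ennreal x = ennreal (1 / x)" using divide_ennreal[of 1 x] that by simp
      then show ?thesis using that by (simp only: ennreal_mult' zero_le_divide_1_iff less_imp_le)
    qed
    from this[OF pos] show ?thesis .
  qed
  also have "1 / (C * (real n * (real n - 1) / \<Lambda>)) * (C * S s t) = 1 / (real n * (real n - 1)) * (\<Lambda> * S s t)"
    using C \<Lambda> by simp
  also have "\<Lambda> * S s t = (\<Sum>i\<in>{1..n}. \<Sum>j\<in>{1..n} - {i}. \<Prod>k=1..<n. gap_rate b \<sigma> n 0 0 1 1 k / gap_rate b \<sigma> n s t i j k)"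
    unfolding S_def \<Lambda>_def sum_distrib_left by (simp add: prod.distrib[symmetric] del: of_nat_Suc)
  finally show ?thesis .
qed

section \<open>Products close to one and Riemann sums\<close>

text \<open>Near \<open>1\<close> continuity gives \<open>g < \<gamma>\<close>; away from \<open>1\<close> a large slope dominates the bounded function \<open>g\<close>.\<close>

lemma continuous_le_affine:
  fixes g :: "real \<Rightarrow> real"
  assumes cont: "continuous_on {0..1} g" and less: "g 1 < \<gamma>"
  shows "\<exists>C\<ge>0. \<forall>x\<in>{0..1}. g x \<le> \<gamma> + C * (1 - x)"
proof -
  obtain \<delta> where \<delta>: "\<delta> > 0" "\<And>x. x \<in> {0..1} \<Longrightarrow> dist x 1 < \<delta> \<Longrightarrow> dist (g x) (g 1) < \<gamma> - g 1"
    using cont less unfolding continuous_on_iff by (metis atLeastAtMost_iff diff_gt_0_iff_gt order_refl zero_le_one)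
  have "compact (g ` {0..1})" using cont by (intro compact_continuous_image) auto
  then obtain M where M: "\<And>x. x \<in> {0..1} \<Longrightarrow> \<bar>g x\<bar> \<le> M"
    by (metis compact_imp_bounded bounded_iff image_eqI real_norm_def)
  have M0: "0 \<le> M" using M[of 0] by simp
  define C where "C = (M + \<bar>\<gamma>\<bar>) / \<delta>"
  have C: "C \<ge> 0" using M0 \<delta>(1) by (simp add: C_def)
  have "g x \<le> \<gamma> + C * (1 - x)" if x: "x \<in> {0..1}" for x
  proof (cases "1 - x < \<delta>")
    case True
    then have "g x < \<gamma>" using \<delta>(2)[OF x] x by (auto simp: dist_real_def)
    then show ?thesis using C x by (simp add: add_increasing2)
  next
    case False
    then have "C * \<delta> \<le> C * (1 - x)" using C by (intro mult_left_mono) auto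
    then have "M + \<bar>\<gamma>\<bar> \<le> C * (1 - x)" using \<delta>(1) by (simp add: C_def)
    then show ?thesis using M[OF x] by linarith
  qed
  then show ?thesis using C by blast
qed

lemma continuous_le_affine':
  fixes g :: "real \<Rightarrow> real"
  assumes cont: "continuous_on {0..1} g" and less: "g 0 < \<gamma>"
  shows "\<exists>C\<ge>0. \<forall>x\<in>{0..1}. g x \<le> \<gamma> + C * x"
proof -
  have "continuous_on {0..1} (\<lambda>x. g (1 - x))"
    by (rule continuous_on_compose2[OF cont]) (auto intro!: continuous_intros)
  then obtain C where C: "C \<ge> 0" "\<And>x. x \<in> {0..1} \<Longrightarrow> g (1 - x) \<le> \<gamma> + C * (1 - x)"
    using continuous_le_affine[of "\<lambda>x. g (1 - x)" \<gamma>] less by auto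
  have "g x \<le> \<gamma> + C * x" if "x \<in> {0..1}" for x
    using C(2)[of "1 - x"] that by simp
  then show ?thesis using C(1) by blast
qed

lemma one_minus_powr_le:
  fixes x \<gamma> :: real
  assumes "0 \<le> x" "x < 1" "0 \<le> \<gamma>" "\<gamma> \<le> 1"
  shows "(1 - x) powr \<gamma> \<le> 1 - \<gamma> * x"
  using Youngs_inequality_0[of \<gamma> "1 - \<gamma>" "1 - x" 1] assms by (simp add: algebra_simps)

lemma inverse_one_minus_le_exp:
  fixes y :: real
  assumes "0 \<le> y" "y \<le> 1 / 2"
  shows "1 / (1 - y) \<le> exp (2 * y)"
proof -
  have "0 \<le> y * (1 - 2 * y)" using assms by (intro mult_nonneg_nonneg) auto
  then have "1 \<le> (1 + 2 * y) * (1 - y)" by (simp add: algebra_simps)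
  then have "1 / (1 - y) \<le> 1 + 2 * y" using assms by (simp add: pos_divide_le_eq)
  also have "\<dots> \<le> exp (2 * y)" by (rule exp_ge_add_one_self)
  finally show ?thesis .
qed

text \<open>The concavity estimate \<open>one_minus_powr_le\<close> makes each factor at most \<open>(k / (k - 1))\<^sup>\<gamma>\<close>, and these telescope.\<close>

lemma prod_inverse_one_minus_le:
  fixes \<gamma> :: real
  assumes \<gamma>: "0 \<le> \<gamma>" "\<gamma> < 1" and p: "2 \<le> p" "p \<le> n"
  shows "(\<Prod>k=p..<n. 1 / (1 - \<gamma> / real k)) \<le> (real (n - 1) / real (p - 1)) powr \<gamma>"
  using p(2)
proof (induction n rule: dec_induct)
  case base
  then show ?case using p(1) by simp
next
  case (step n)
  have n: "n \<ge> 2" using step.hyps p by simp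
  have *: "1 / (1 - \<gamma> / real n) \<le> (real n / real (n - 1)) powr \<gamma>"
  proof -
    have "(1 - 1 / real n) powr \<gamma> \<le> 1 - \<gamma> * (1 / real n)"
      using n \<gamma> by (intro one_minus_powr_le) auto
    moreover have "0 < (1 - 1 / real n) powr \<gamma>" using n by simp
    moreover have "0 < 1 - \<gamma> / real n" using n \<gamma> by (simp add: divide_less_eq)
    ultimately have "1 / (1 - \<gamma> / real n) \<le> 1 / (1 - 1 / real n) powr \<gamma>"
      by (intro divide_left_mono mult_pos_pos) auto
    also have "\<dots> = (1 / (1 - 1 / real n)) powr \<gamma>" using n by (simp add: powr_divide)
    also have "1 / (1 - 1 / real n) = real n / real (n - 1)" using n by (simp add: of_nat_diff field_simps)
    finally show ?thesis .
  qed
  have "(\<Prod>k=p..<Suc n. 1 / (1 - \<gamma> / real k)) = (\<Prod>k=p..<n. 1 / (1 - \<gamma> / real k)) * (1 / (1 - \<gamma> / real n))"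
    using step.hyps(1) by (rule prod.atLeastLessThan_Suc)
  also have "\<dots> \<le> (real (n - 1) / real (p - 1)) powr \<gamma> * (real n / real (n - 1)) powr \<gamma>"
    using step.IH * \<gamma> n by (intro mult_mono) (auto simp: field_simps)
  also have "\<dots> = (real n / real (p - 1)) powr \<gamma>"
    using n p(1) by (subst powr_mult[symmetric]) auto
  finally show ?case by simp
qed

text \<open>The factor at \<open>k = 1\<close> is not covered by the telescoping estimate; it accounts for \<open>1 / (1 - \<gamma>)\<close>.\<close>

lemma prod_inverse_one_minus_ge_threshold_le:
  fixes \<gamma> V :: real
  assumes \<gamma>: "0 \<le> \<gamma>" "\<gamma> < 1" and V: "0 < V" "V \<le> 1"
  shows "(\<Prod>k | k \<in> {1..<n} \<and> V \<le> real k / real n. 1 / (1 - \<gamma> / real k)) \<le> 2 / (1 - \<gamma>) * V powr (- \<gamma>)"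
proof -
  have rhs1: "1 \<le> 2 / (1 - \<gamma>) * V powr (- \<gamma>)"
  proof -
    have "1 \<le> V powr (- \<gamma>)" using V \<gamma> by (simp add: powr_minus_divide powr_le1)
    moreover have "1 \<le> 2 / (1 - \<gamma>)" using \<gamma> by simp
    ultimately have "1 * 1 \<le> 2 / (1 - \<gamma>) * V powr (- \<gamma>)" using \<gamma> by (intro mult_mono) auto
    then show ?thesis by simp
  qed
  define p where "p = nat \<lceil>V * real n\<rceil>"
  show ?thesis
  proof (cases "p < n")
    case False
    have "{k. k \<in> {1..<n} \<and> V \<le> real k / real n} = {}"
    proof (rule ccontr)
      assume "\<not> ?thesis"
      then obtain k where k: "k < n" "V \<le> real k / real n" "n > 0" by auto
      then have "V * real n \<le> real k" by (simp add: field_simps)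
      then have "p \<le> k" unfolding p_def by (simp add: ceiling_le_iff nat_le_iff)
      then show False using False k by simp
    qed
    with rhs1 show ?thesis by (simp only: prod.empty)
  next
    case True
    then have n: "n > 0" by simp
    have pV: "V * real n \<le> real p" unfolding p_def using V by (simp add: real_nat_ceiling_ge)
    then have p: "p \<ge> 1" proof -
      have "0 < V * real n" using V n by simp
      then have "0 < real p" using pV by (rule less_le_trans)
      then show ?thesis by simp
    qed
    have set: "{k. k \<in> {1..<n} \<and> V \<le> real k / real n} = {p..<n}"
    proof -
      have "V \<le> real k / real n \<longleftrightarrow> p \<le> k" for k
      proof -
        have "V \<le> real k / real n \<longleftrightarrow> V * real n \<le> real k"
          using n by (intro pos_le_divide_eq) simp
        also have "\<dots> \<longleftrightarrow> p \<le> k" by (simp only: p_def nat_le_iff ceiling_le_iff of_int_of_nat_eq)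
        finally show ?thesis .
      qed
      then have "{k. k \<in> {1..<n} \<and> V \<le> real k / real n} = {k. k \<in> {1..<n} \<and> p \<le> k}" by (simp only:)
      also have "\<dots> = {p..<n}" using p by auto
      finally show ?thesis .
    qed
    have bound: "(2 * real n / real p) powr \<gamma> \<le> 2 * V powr (- \<gamma>)"
    proof -
      have "real n / real p \<le> 1 / V" using pV V p n by (simp add: field_simps)
      then have "(2 * real n / real p) powr \<gamma> \<le> (2 * (1 / V)) powr \<gamma>"
        using \<gamma> by (intro powr_mono2) auto
      also have "\<dots> = 2 powr \<gamma> * V powr (- \<gamma>)"
        using V by (simp add: powr_divide powr_minus_divide)
      also have "\<dots> \<le> 2 powr 1 * V powr (- \<gamma>)"
        using \<gamma> by (intro mult_right_mono powr_mono) auto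
      finally show ?thesis by simp
    qed
    have "(\<Prod>k=p..<n. 1 / (1 - \<gamma> / real k)) \<le> 1 / (1 - \<gamma>) * (2 * real n / real p) powr \<gamma>"
    proof (cases "p = 1")
      case False
      then have p2: "p \<ge> 2" using p by simp
      have "(\<Prod>k=p..<n. 1 / (1 - \<gamma> / real k)) \<le> (real (n - 1) / real (p - 1)) powr \<gamma>"
        using \<gamma> p2 True by (intro prod_inverse_one_minus_le) auto
      also have "\<dots> \<le> (2 * real n / real p) powr \<gamma>"
      proof (intro powr_mono2 divide_nonneg_nonneg)
        have "real (n - 1) / real (p - 1) \<le> real n / (real p / 2)"
          using p2 by (intro frac_le) auto
        then show "real (n - 1) / real (p - 1) \<le> 2 * real n / real p" by (simp add: mult.commute)
      qed (use \<gamma> in auto)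
      also have "\<dots> \<le> 1 / (1 - \<gamma>) * (2 * real n / real p) powr \<gamma>"
        using \<gamma> mult_right_mono[of 1 "1 / (1 - \<gamma>)" "(2 * real n / real p) powr \<gamma>"] by simp
      finally show ?thesis .
    next
      case True
      have n2: "n \<ge> 2" using True \<open>p < n\<close> by simp
      have "(\<Prod>k=2..<n. 1 / (1 - \<gamma> / real k)) \<le> (real (n - 1) / real (2 - 1)) powr \<gamma>"
        using \<gamma> n2 by (intro prod_inverse_one_minus_le) auto
      also have "\<dots> \<le> (2 * real n / real p) powr \<gamma>"
        using True \<gamma> by (intro powr_mono2) auto
      finally have "1 / (1 - \<gamma>) * (\<Prod>k=2..<n. 1 / (1 - \<gamma> / real k)) \<le> 1 / (1 - \<gamma>) * (2 * real n / real p) powr \<gamma>"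
        using \<gamma> by (intro mult_left_mono) auto
      moreover have "{p..<n} = insert 1 {2..<n}" using True n2 by auto
      ultimately show ?thesis by simp
    qed
    also have "\<dots> \<le> 1 / (1 - \<gamma>) * (2 * V powr (- \<gamma>))"
      using bound \<gamma> by (intro mult_left_mono) auto
    finally show ?thesis unfolding set by simp
  qed
qed

lemma prod_inverse_one_minus_lt_threshold_le:
  fixes \<gamma> U :: real
  assumes \<gamma>: "0 \<le> \<gamma>" "\<gamma> < 1" and U: "0 \<le> U" "U < 1"
  shows "(\<Prod>k | k \<in> {1..<n} \<and> real k / real n < U. 1 / (1 - \<gamma> / real (n - k))) \<le> 2 / (1 - \<gamma>) * (1 - U) powr (- \<gamma>)"
proof -
  have "(\<Prod>k | k \<in> {1..<n} \<and> real k / real n < U. 1 / (1 - \<gamma> / real (n - k)))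
      = (\<Prod>k | k \<in> {1..<n} \<and> 1 - U < real k / real n. 1 / (1 - \<gamma> / real k))"
    by (rule prod.reindex_bij_witness[where i = "\<lambda>k. n - k" and j = "\<lambda>k. n - k"])
      (auto simp: of_nat_diff field_simps)
  also have "\<dots> \<le> (\<Prod>k | k \<in> {1..<n} \<and> 1 - U \<le> real k / real n. 1 / (1 - \<gamma> / real k))"
  proof (rule prod_mono2)
    fix k assume "k \<in> {k. k \<in> {1..<n} \<and> 1 - U \<le> real k / real n} - {k. k \<in> {1..<n} \<and> 1 - U < real k / real n}"
    then have "real k \<ge> 1" by auto
    then have "0 < 1 - \<gamma> / real k" using \<gamma> by (simp add: divide_less_eq)
    then show "1 \<le> 1 / (1 - \<gamma> / real k)" using \<gamma> by simp
  next
    fix k assume "k \<in> {k. k \<in> {1..<n} \<and> 1 - U < real k / real n}"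
    then have "real k \<ge> 1" by auto
    then have "0 < 1 - \<gamma> / real k" using \<gamma> by (simp add: divide_less_eq)
    then show "0 \<le> 1 / (1 - \<gamma> / real k)" by simp
  qed auto
  also have "\<dots> \<le> 2 / (1 - \<gamma>) * (1 - U) powr (- \<gamma>)"
    using \<gamma> U by (intro prod_inverse_one_minus_ge_threshold_le) auto
  finally show ?thesis .
qed

text \<open>A sum of samples, as the integral of the step function that rounds its argument up to the grid.\<close>

lemma has_integral_step:
  fixes G :: "nat \<Rightarrow> real"
  assumes n: "n > 0"
  shows "((\<lambda>x. G (nat \<lceil>real n * x\<rceil>)) has_integral (\<Sum>k=1..m. G k) / real n) {0..real m / real n}"
proof (induction m)
  case 0
  show ?case using has_integral_refl(1)[of _ "0 :: real"] by simp
next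
  case (Suc m)
  let ?f = "\<lambda>x. G (nat \<lceil>real n * x\<rceil>)"
  have "(?f has_integral G (Suc m) * (real (Suc m) / real n - real m / real n)) {real m / real n..real (Suc m) / real n}"
  proof (rule has_integral_spike_finite[of "{real m / real n}"])
    show "((\<lambda>_. G (Suc m)) has_integral G (Suc m) * (real (Suc m) / real n - real m / real n))
        {real m / real n..real (Suc m) / real n}"
      using has_integral_const_real[of "G (Suc m)" "real m / real n" "real (Suc m) / real n"] n
      by (simp add: divide_right_mono mult.commute)
    fix x assume "x \<in> {real m / real n..real (Suc m) / real n} - {real m / real n}"
    then have "real m < real n * x" "real n * x \<le> real (Suc m)"
      using n by (auto simp: field_simps)
    then have "\<lceil>real n * x\<rceil> = int (Suc m)" by (simp add: ceiling_eq_iff)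
    then show "?f x = G (Suc m)" by (simp only: nat_int)
  qed simp
  moreover have "G (Suc m) * (real (Suc m) / real n - real m / real n) = G (Suc m) / real n"
    by (simp add: diff_divide_distrib[symmetric])
  ultimately have "(?f has_integral ((\<Sum>k=1..m. G k) / real n + G (Suc m) / real n)) {0..real (Suc m) / real n}"
    by (intro has_integral_combine[OF _ _ Suc.IH]) (auto simp: divide_right_mono)
  then show ?case by (simp add: add_divide_distrib)
qed

lemma ceiling_ratio_tendsto:
  fixes x :: real
  assumes "0 \<le> x"
  shows "(\<lambda>n. real (nat \<lceil>real n * x\<rceil>) / real n) \<longlonglongrightarrow> x"
proof (rule real_tendsto_sandwich)
  show "eventually (\<lambda>n. x \<le> real (nat \<lceil>real n * x\<rceil>) / real n) sequentially"
    using eventually_gt_at_top[of 0]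
    by eventually_elim (use assms in \<open>simp add: field_simps real_nat_ceiling_ge\<close>)
  show "eventually (\<lambda>n. real (nat \<lceil>real n * x\<rceil>) / real n \<le> x + 1 / real n) sequentially"
    using eventually_gt_at_top[of 0]
  proof eventually_elim
    case (elim n)
    have "real (nat \<lceil>real n * x\<rceil>) \<le> real n * x + 1"
      using assms by (simp add: of_nat_ceiling)
    then show ?case using elim by (simp add: field_simps)
  qed
  show "(\<lambda>n. x + 1 / real n) \<longlonglongrightarrow> x"
    using tendsto_add[OF tendsto_const[of x] lim_1_over_n] by simp
qed simp

lemma riemann_sum_tendsto:
  fixes G :: "real \<Rightarrow> real"
  assumes bounded: "\<And>x. x \<in> {0..1} \<Longrightarrow> \<bar>G x\<bar> \<le> M"
    and S: "finite S" and cont: "\<And>x. x \<in> {0<..<1} - S \<Longrightarrow> isCont G x"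
  shows "G integrable_on {0..1}"
    and "(\<lambda>n. (\<Sum>k=1..n. G (real k / real n)) / real n) \<longlonglongrightarrow> integral {0..1} G"
proof -
  let ?g = "\<lambda>n x. G (real (nat \<lceil>real (Suc n) * x\<rceil>) / real (Suc n))"
  let ?A = "{0<..<1} - S"
  have step: "(?g n has_integral (\<Sum>k=1..Suc n. G (real k / real (Suc n))) / real (Suc n)) {0..1}" for n
    using has_integral_step[of "Suc n" "\<lambda>k. G (real k / real (Suc n))" "Suc n"] by simp
  \<comment> \<open>dominated convergence needs convergence at every point, so the exceptional points are removed\<close>
  have spike: "(f has_integral I) ?A \<longleftrightarrow> (f has_integral I) {0..1}" for f :: "real \<Rightarrow> real" and I
  proof (rule has_integral_spike_set_eq)
    have "negligible (insert 0 (insert 1 S))" using S by (intro negligible_finite) auto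
    then show "negligible {x \<in> ?A - {0..1}. f x \<noteq> 0}" "negligible {x \<in> {0..1} - ?A. f x \<noteq> 0}"
      by (rule negligible_subset; auto)+
  qed
  have g_int: "?g n integrable_on ?A" for n using step spike by (meson integrable_on_def)
  have M_int: "(\<lambda>_. M) integrable_on ?A"
      using spike[of "\<lambda>_. M"] integrable_const_ivl[of M 0 1] unfolding integrable_on_def by blast
  have g_le: "norm (?g n x) \<le> M" if "x \<in> ?A" for n x
  proof -
    have "real (Suc n) * x \<le> real (Suc n)" using that by (simp add: mult_le_cancel_left1)
    then have "\<lceil>real (Suc n) * x\<rceil> \<le> int (Suc n)" by (simp add: ceiling_le_iff)
    then have "real (nat \<lceil>real (Suc n) * x\<rceil>) \<le> real (Suc n)" by (simp add: nat_le_iff)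
    then show ?thesis using bounded by (simp add: divide_le_eq)
  qed
  have g_lim: "(\<lambda>n. ?g n x) \<longlonglongrightarrow> G x" if "x \<in> ?A" for x
  proof -
    have "(\<lambda>n. real (nat \<lceil>real (Suc n) * x\<rceil>) / real (Suc n)) \<longlonglongrightarrow> x"
      using ceiling_ratio_tendsto[of x] that by (intro LIMSEQ_Suc) auto
    then show ?thesis using isCont_tendsto_compose[OF cont[OF that]] by simp
  qed
  have *: "G integrable_on ?A" "(\<lambda>n. integral ?A (?g n)) \<longlonglongrightarrow> integral ?A G"
    using dominated_convergence[of ?g ?A "\<lambda>_. M" G, OF g_int M_int g_le g_lim] by auto
  show "G integrable_on {0..1}" using *(1) spike by (meson integrable_on_def)
  have "integral ?A f = integral {0..1} f" for f :: "real \<Rightarrow> real"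
    unfolding integral_def integrable_on_def using spike by simp
  then have "(\<lambda>n. integral {0..1} (?g n)) \<longlonglongrightarrow> integral {0..1} G" using *(2) by simp
  moreover have "integral {0..1} (?g n) = (\<Sum>k=1..Suc n. G (real k / real (Suc n))) / real (Suc n)" for n
    using step by (rule integral_unique)
  ultimately show "(\<lambda>n. (\<Sum>k=1..n. G (real k / real n)) / real n) \<longlonglongrightarrow> integral {0..1} G"
    by (intro LIMSEQ_imp_Suc[of "\<lambda>n. (\<Sum>k=1..n. G (real k / real n)) / real n"]) (simp only:)
qed

text \<open>The logarithm of the product differs from the Riemann sum of \<open>G\<close> by at most \<open>n\<close> terms of order \<open>1 / n\<^sup>2\<close>.\<close>

lemma riemann_product_tendsto:
  fixes G :: "real \<Rightarrow> real"
  assumes bounded: "\<And>x. x \<in> {0..1} \<Longrightarrow> \<bar>G x\<bar> \<le> M"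
    and S: "finite S" and cont: "\<And>x. x \<in> {0<..<1} - S \<Longrightarrow> isCont G x"
  shows "(\<lambda>n. \<Prod>k=1..n. 1 / (1 - G (real k / real n) / real n)) \<longlonglongrightarrow> exp (integral {0..1} G)"
proof -
  define d where "d n = (\<Sum>k=1..n. - ln (1 - G (real k / real n) / real n))" for n
  have M: "M \<ge> 0" using bounded[of 0] by simp
  have small: "\<bar>G (real k / real n) / real n\<bar> \<le> M / real n \<and> M / real n \<le> 1 / 2"
    if "n > nat \<lceil>2 * M\<rceil>" "k \<in> {1..n}" for n k
  proof -
    have "2 * M \<le> real n" using that(1) by linarith
    moreover have "\<bar>G (real k / real n)\<bar> \<le> M" using that by (intro bounded) (auto simp: divide_le_eq)
    ultimately show ?thesis using that by (auto simp: field_simps abs_divide)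
  qed
  have ev: "eventually (\<lambda>n. n > nat \<lceil>2 * M\<rceil>) sequentially" by (rule eventually_gt_at_top)
  have "(\<lambda>n. d n - (\<Sum>k=1..n. G (real k / real n)) / real n) \<longlonglongrightarrow> 0"
  proof (rule Lim_null_comparison)
    show "(\<lambda>n. 2 * M\<^sup>2 * (1 / real n)) \<longlonglongrightarrow> 0"
      using tendsto_mult_left[OF lim_1_over_n, of "2 * M\<^sup>2"] by simp
    show "eventually (\<lambda>n. norm (d n - (\<Sum>k=1..n. G (real k / real n)) / real n) \<le> 2 * M\<^sup>2 * (1 / real n)) sequentially"
      using ev
    proof eventually_elim
      case (elim n)
      have "\<bar>- ln (1 - G (real k / real n) / real n) - G (real k / real n) / real n\<bar> \<le> 2 * (M / real n)\<^sup>2"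
        if "k \<in> {1..n}" for k
      proof -
        let ?y = "G (real k / real n) / real n"
        have y: "\<bar>?y\<bar> \<le> M / real n" "M / real n \<le> 1 / 2" using small[OF elim that] by auto
        then have "\<bar>ln (1 + (- ?y)) - (- ?y)\<bar> \<le> 2 * (- ?y)\<^sup>2"
          by (intro abs_ln_one_plus_x_minus_x_bound) linarith
        moreover have "(- ?y)\<^sup>2 \<le> (M / real n)\<^sup>2" using y by (simp only: power2_minus) (rule power2_le_iff_abs_le[THEN iffD2], use y M in auto)
        ultimately show ?thesis by (simp add: abs_minus_commute)
      qed
      then have "\<bar>\<Sum>k=1..n. - ln (1 - G (real k / real n) / real n) - G (real k / real n) / real n\<bar>
          \<le> (\<Sum>k=1..n. 2 * (M / real n)\<^sup>2)"
        by (intro order_trans[OF sum_abs] sum_mono) auto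
      also have "\<dots> = 2 * M\<^sup>2 * (1 / real n)"
        using elim by (simp add: power2_eq_square)
      also have "(\<Sum>k=1..n. - ln (1 - G (real k / real n) / real n) - G (real k / real n) / real n)
          = d n - (\<Sum>k=1..n. G (real k / real n)) / real n"
        by (simp add: d_def sum_subtractf sum_divide_distrib)
      finally show ?case by simp
    qed
  qed
  from tendsto_add[OF this riemann_sum_tendsto(2)[OF assms]]
  have "d \<longlonglongrightarrow> integral {0..1} G" by simp
  then have "(\<lambda>n. exp (d n)) \<longlonglongrightarrow> exp (integral {0..1} G)" by (rule tendsto_exp)
  moreover have "eventually (\<lambda>n. exp (d n) = (\<Prod>k=1..n. 1 / (1 - G (real k / real n) / real n))) sequentially"
    using ev
  proof eventually_elim
    case (elim n)
    have "exp (d n) = (\<Prod>k=1..n. exp (- ln (1 - G (real k / real n) / real n)))"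
      unfolding d_def by (rule exp_sum) simp
    also have "\<dots> = (\<Prod>k=1..n. 1 / (1 - G (real k / real n) / real n))"
    proof (rule prod.cong)
      fix k assume "k \<in> {1..n}"
      from small[OF elim this] have "0 < 1 - G (real k / real n) / real n" by linarith
      then show "exp (- ln (1 - G (real k / real n) / real n)) = 1 / (1 - G (real k / real n) / real n)"
        by (simp add: exp_minus inverse_eq_divide)
    qed simp
    finally show ?case .
  qed
  ultimately show ?thesis by (rule Lim_transform_eventually)
qed

section \<open>The primitive of a decreasing drift\<close>

text \<open>The integrand whose integral over \<open>[0,1]\<close> is \<open>Phi b \<sigma> u\<close>. At \<open>x = 1\<close> the denominator vanishes, so the
kernel has the value \<open>0\<close> there.\<close>

definition step_kernel :: "(real \<Rightarrow> real) \<Rightarrow> real \<Rightarrow> real \<Rightarrow> real \<Rightarrow> real" where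
  "step_kernel b \<sigma> u x = \<sigma>\<^sup>2 / 2 * (if x < u then x else x - 1) / prim b x"

locale decreasing_drift =
  fixes b :: "real \<Rightarrow> real" and \<sigma> :: real
  assumes cont: "continuous_on {0..1} b"
    and sigma: "\<sigma> \<noteq> 0"
    and prim1: "prim b 1 = 0"
    and decr: "strict_antimono_on {0..1} b"
begin

lemma sigma2: "\<sigma>\<^sup>2 > 0"
  using sigma by simp

lemma decrD: "0 \<le> x \<Longrightarrow> x < y \<Longrightarrow> y \<le> 1 \<Longrightarrow> b y < b x"
  using monotone_onD[OF decr, of x y] by simp

lemma prim0: "prim b 0 = 0"
  by (simp add: prim_def)

lemma has_derivative_prim:
  "u \<in> {0..1} \<Longrightarrow> (prim b has_real_derivative b u) (at u within {0..1})"
  unfolding prim_def[abs_def] by (rule integral_has_real_derivative[OF cont])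

lemma continuous_on_prim: "continuous_on {0..1} (prim b)"
  by (meson DERIV_continuous continuous_on_eq_continuous_within has_derivative_prim)

lemma prim_mvt:
  assumes "0 \<le> x" "x < y" "y \<le> 1"
  obtains z where "x < z" "z < y" "prim b y - prim b x = (y - x) * b z"
proof -
  have "(prim b has_derivative (*) (b z)) (at z within {x..y})" if "x \<le> z" "z \<le> y" for z
    using has_field_derivative_subset[OF has_derivative_prim, of z "{x..y}"] that assms
    by (auto simp: has_field_derivative_def)
  then obtain z where "z \<in> {x<..<y}" "prim b y - prim b x = b z * (y - x)"
    using mvt_simple[OF assms(2), of "prim b" "\<lambda>z. (*) (b z)"] by blast
  then show ?thesis by (intro that[of z]) (simp_all add: mult.commute)
qed

lemma drift_endpoints: "b 0 > 0" "b 1 < 0"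
proof -
  obtain z where "0 < z" "z < 1" "prim b 1 - prim b 0 = (1 - 0) * b z"
    by (rule prim_mvt[of 0 1]) auto
  then show "b 0 > 0" "b 1 < 0"
    using decrD[of 0 z] decrD[of z 1] prim0 prim1 by auto
qed

lemma prim_le:
  assumes "0 < u" "u < 1"
  shows "prim b u \<le> b 0 * u" "prim b u \<le> - b 1 * (1 - u)"
proof -
  obtain z where z: "0 < z" "z < u" "prim b u - prim b 0 = (u - 0) * b z"
    by (rule prim_mvt[of 0 u]) (use assms in auto)
  have "b z \<le> b 0" using z assms decrD[of 0 z] by simp
  then have "u * b z \<le> u * b 0" using assms by (intro mult_left_mono) auto
  then show "prim b u \<le> b 0 * u" using z prim0 by (simp add: mult.commute)
  obtain z where z: "u < z" "z < 1" "prim b 1 - prim b u = (1 - u) * b z"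
    by (rule prim_mvt[of u 1]) (use assms in auto)
  have "b 1 \<le> b z" using z assms decrD[of z 1] by simp
  then have "(1 - u) * b 1 \<le> (1 - u) * b z" using assms by (intro mult_left_mono) auto
  then show "prim b u \<le> - b 1 * (1 - u)" using z(3) prim1 by (simp add: algebra_simps)
qed

lemma prim_pos:
  assumes "0 < u" "u < 1"
  shows "prim b u > 0"
proof (rule ccontr)
  assume neg: "\<not> prim b u > 0"
  obtain z where z: "0 < z" "z < u" "prim b u - prim b 0 = (u - 0) * b z"
    by (rule prim_mvt[of 0 u]) (use assms in auto)
  obtain y where y: "u < y" "y < 1" "prim b 1 - prim b u = (1 - u) * b y"
    by (rule prim_mvt[of u 1]) (use assms in auto)
  have "b z \<le> 0" using z neg assms prim0 by (simp add: not_less mult_le_0_iff)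
  moreover have "0 \<le> b y" using y neg assms prim1
    by (metis diff_0 diff_gt_0_iff_gt neg_0_le_iff_le not_less zero_le_mult_iff order_less_le not_le)
  moreover have "b y < b z" using y z assms by (intro decrD) auto
  ultimately show False by simp
qed

text \<open>The function \<open>x * (1 - x) / B x\<close>, extended by its limits to a continuous function on \<open>[0,1]\<close>. It
separates the bounded part of \<open>step_kernel\<close> from the singularities \<open>1 / (1 - x)\<close> and \<open>1 / x\<close>.\<close>

definition eta :: "real \<Rightarrow> real" where
  "eta x = (if x = 0 then 1 / b 0 else if x = 1 then - 1 / b 1 else x * (1 - x) / prim b x)"

lemma eta_endpoints: "eta 0 = 1 / b 0" "eta 1 = - 1 / b 1"
  by (simp_all add: eta_def)

text \<open>At the endpoints the difference quotient of \<open>prim b\<close> tends to \<open>b 0\<close> and \<open>b 1\<close>, which do not vanish.\<close>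

lemma continuous_on_eta: "continuous_on {0..1} eta"
  unfolding continuous_on_def
proof
  fix x :: real assume x: "x \<in> {0..1}"
  let ?F = "at x within {0..1}"
  have quot: "((\<lambda>y. (prim b y - prim b x) / (y - x)) \<longlongrightarrow> b x) ?F"
    using has_derivative_prim[OF x] by (simp add: has_field_derivative_iff)
  have ne: "eventually (\<lambda>y. y \<noteq> x \<and> y \<in> {0..1}) ?F"
    by (auto simp: eventually_at_filter)
  have id: "((\<lambda>y. y) \<longlongrightarrow> x) ?F" by (rule tendsto_ident_at)
  consider "x = 0" | "x = 1" | "0 < x" "x < 1" using x by force
  then show "(eta \<longlongrightarrow> eta x) ?F"
  proof cases
    case 1
    have "((\<lambda>y. (1 - y) / ((prim b y - prim b x) / (y - x))) \<longlongrightarrow> (1 - x) / b x) ?F"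
      using drift_endpoints 1 by (intro tendsto_intros quot id) auto
    moreover have "eventually (\<lambda>y. (1 - y) / ((prim b y - prim b x) / (y - x)) = eta y) ?F"
    proof -
      have "eventually (\<lambda>y. y < 1) ?F" using order_tendstoD(2)[OF id, of 1] 1 by simp
      with ne show ?thesis by eventually_elim (use 1 prim0 in \<open>auto simp: eta_def\<close>)
    qed
    ultimately have "(eta \<longlongrightarrow> (1 - x) / b x) ?F" by (rule Lim_transform_eventually)
    then show ?thesis using 1 by (simp add: eta_def)
  next
    case 2
    have "((\<lambda>y. - y / ((prim b y - prim b x) / (y - x))) \<longlongrightarrow> - x / b x) ?F"
      using drift_endpoints 2 by (intro tendsto_intros quot id) auto
    moreover have "eventually (\<lambda>y. - y / ((prim b y - prim b x) / (y - x)) = eta y) ?F"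
    proof -
      have "eventually (\<lambda>y. y > 0) ?F" using order_tendstoD(1)[OF id, of 0] 2 by simp
      with ne show ?thesis by eventually_elim (use 2 prim1 in \<open>auto simp: eta_def minus_mult_right\<close>)
    qed
    ultimately have "(eta \<longlongrightarrow> - x / b x) ?F" by (rule Lim_transform_eventually)
    then show ?thesis using 2 by (simp add: eta_def)
  next
    case 3
    have "((\<lambda>y. y * (1 - y) / prim b y) \<longlongrightarrow> x * (1 - x) / prim b x) ?F"
      using prim_pos[of x] 3 continuous_on_prim x unfolding continuous_on_def
      by (intro tendsto_intros id) auto
    moreover have "eventually (\<lambda>y. y * (1 - y) / prim b y = eta y) ?F"
    proof -
      have "eventually (\<lambda>y. y > 0) ?F" "eventually (\<lambda>y. y < 1) ?F"
        using order_tendstoD[OF id] 3 by auto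
      then show ?thesis by eventually_elim (auto simp: eta_def)
    qed
    ultimately have "(eta \<longlongrightarrow> x * (1 - x) / prim b x) ?F" by (rule Lim_transform_eventually)
    then show ?thesis using 3 by (simp add: eta_def)
  qed
qed

lemma step_kernel_eq_eta:
  assumes "0 < x" "x < 1"
  shows "step_kernel b \<sigma> u x = \<sigma>\<^sup>2 / 2 * eta x * (if x < u then 1 / (1 - x) else - 1 / x)"
  using assms prim_pos[of x] by (simp add: step_kernel_def eta_def field_simps)

lemma zero_in_V: "0 \<in> V_set b \<sigma>"
  using drift_endpoints sigma2 by (simp add: V_set_def divide_neg_pos)

text \<open>Membership in \<open>V_set\<close> means that \<open>r * \<sigma>\<^sup>2 / 2 * eta\<close> is less than \<open>1\<close> at \<open>1\<close> and its negative is less than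
\<open>1\<close> at \<open>0\<close>. By continuity this leaves room for some \<open>\<gamma> < 1\<close>, up to an error that vanishes at the endpoint
in question and therefore cancels the singularity of the kernel there.\<close>

lemma V_affine_bounds:
  assumes r: "r \<in> V_set b \<sigma>"
  shows "\<exists>\<gamma> C. 0 \<le> \<gamma> \<and> \<gamma> < 1 \<and> 0 \<le> C \<and> (\<forall>x\<in>{0..1}.
    r * (\<sigma>\<^sup>2 / 2 * eta x) \<le> \<gamma> + C * (1 - x) \<and> - r * (\<sigma>\<^sup>2 / 2 * eta x) \<le> \<gamma> + C * x)"
proof -
  have 1: "r * (\<sigma>\<^sup>2 / 2 * eta 1) < 1" and 0: "- r * (\<sigma>\<^sup>2 / 2 * eta 0) < 1"
    using r drift_endpoints sigma2 by (simp_all add: eta_endpoints V_set_def field_simps)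
  define m where "m = max 0 (max (r * (\<sigma>\<^sup>2 / 2 * eta 1)) (- r * (\<sigma>\<^sup>2 / 2 * eta 0)))"
  have "m < 1" using 0 1 by (simp add: m_def)
  then obtain \<gamma> where \<gamma>: "m < \<gamma>" "\<gamma> < 1" using dense by blast
  have "continuous_on {0..1} (\<lambda>x. r * (\<sigma>\<^sup>2 / 2 * eta x))" "continuous_on {0..1} (\<lambda>x. - r * (\<sigma>\<^sup>2 / 2 * eta x))"
    by (intro continuous_intros continuous_on_eta)+
  from continuous_le_affine[OF this(1), of \<gamma>] continuous_le_affine'[OF this(2), of \<gamma>] \<gamma>
  obtain C D where C: "C \<ge> 0" "\<And>x. x \<in> {0..1} \<Longrightarrow> r * (\<sigma>\<^sup>2 / 2 * eta x) \<le> \<gamma> + C * (1 - x)"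
    and D: "D \<ge> 0" "\<And>x. x \<in> {0..1} \<Longrightarrow> - r * (\<sigma>\<^sup>2 / 2 * eta x) \<le> \<gamma> + D * x"
    by (auto simp: m_def)
  have "r * (\<sigma>\<^sup>2 / 2 * eta x) \<le> \<gamma> + max C D * (1 - x) \<and> - r * (\<sigma>\<^sup>2 / 2 * eta x) \<le> \<gamma> + max C D * x"
    if x: "x \<in> {0..1}" for x
  proof -
    have "C * (1 - x) \<le> max C D * (1 - x)" "D * x \<le> max C D * x"
      using x by (auto intro!: mult_right_mono)
    then show ?thesis using C(2)[OF x] D(2)[OF x] by linarith
  qed
  moreover have "0 \<le> \<gamma>" "0 \<le> max C D" using \<gamma> C(1) by (auto simp: m_def)
  ultimately show ?thesis using \<gamma>(2) by blast
qed

lemma V_affine_bounds_finite: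
  assumes "finite R" "R \<subseteq> V_set b \<sigma>"
  shows "\<exists>\<gamma> C. 0 \<le> \<gamma> \<and> \<gamma> < 1 \<and> 0 \<le> C \<and> (\<forall>r\<in>R. \<forall>x\<in>{0..1}.
    r * (\<sigma>\<^sup>2 / 2 * eta x) \<le> \<gamma> + C * (1 - x) \<and> - r * (\<sigma>\<^sup>2 / 2 * eta x) \<le> \<gamma> + C * x)"
  using assms
proof (induction R rule: finite_induct)
  case empty
  show ?case by (intro exI[of _ 0]) auto
next
  case (insert r R)
  obtain \<gamma> C where gC: "0 \<le> \<gamma>" "\<gamma> < 1" "0 \<le> C" "\<And>r x. r \<in> R \<Longrightarrow> x \<in> {0..1} \<Longrightarrow>
    r * (\<sigma>\<^sup>2 / 2 * eta x) \<le> \<gamma> + C * (1 - x) \<and> - r * (\<sigma>\<^sup>2 / 2 * eta x) \<le> \<gamma> + C * x"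
    using insert by auto
  obtain \<delta> D where dD: "0 \<le> \<delta>" "\<delta> < 1" "0 \<le> D" "\<And>x. x \<in> {0..1} \<Longrightarrow>
    r * (\<sigma>\<^sup>2 / 2 * eta x) \<le> \<delta> + D * (1 - x) \<and> - r * (\<sigma>\<^sup>2 / 2 * eta x) \<le> \<delta> + D * x"
    using V_affine_bounds[of r] insert.prems by auto
  have "q * (\<sigma>\<^sup>2 / 2 * eta x) \<le> max \<gamma> \<delta> + max C D * (1 - x) \<and> - q * (\<sigma>\<^sup>2 / 2 * eta x) \<le> max \<gamma> \<delta> + max C D * x"
    if q: "q \<in> insert r R" and x: "x \<in> {0..1}" for q x
  proof -
    have "C * (1 - x) \<le> max C D * (1 - x)" "D * x \<le> max C D * x" "D * (1 - x) \<le> max C D * (1 - x)" "C * x \<le> max C D * x"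
      using x by (auto intro!: mult_right_mono)
    then show ?thesis using q gC(4)[of q x] dD(4)[of x] x by fastforce
  qed
  then show ?case using gC dD by (intro exI[of _ "max \<gamma> \<delta>"] exI[of _ "max C D"]) auto
qed

text \<open>The singularity at \<open>1\<close> has the coefficient \<open>s + t\<close> left of both thresholds, and between them the
coefficient that belongs to the larger threshold; the singularity at \<open>0\<close> has the coefficient \<open>- (s + t)\<close>
right of both, and between them the negative of the one that belongs to the smaller threshold. Hence
\<open>V_affine_bounds_finite\<close> applies to \<open>s\<close>, \<open>t\<close> and \<open>s + t\<close>. It matters that the singularity at \<open>1\<close> only
occurs left of \<open>max u v\<close> and that at \<open>0\<close> only right of \<open>min u v\<close>.\<close>

lemma step_kernel_combination_le:
  assumes st: "(s, t) \<in> V2_set b \<sigma>"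
  shows "\<exists>\<gamma> C. 0 \<le> \<gamma> \<and> \<gamma> < 1 \<and> 0 \<le> C \<and> (\<forall>u v x. 0 < x \<longrightarrow> x < 1 \<longrightarrow>
    s * step_kernel b \<sigma> u x + t * step_kernel b \<sigma> v x
      \<le> (if x < max u v then \<gamma> / (1 - x) else 0) + (if min u v \<le> x then \<gamma> / x else 0) + 2 * C)"
proof -
  have "{s, t, s + t} \<subseteq> V_set b \<sigma>" using st by (auto simp: V2_set_def)
  from V_affine_bounds_finite[OF _ this] obtain \<gamma> C where gC: "0 \<le> \<gamma>" "\<gamma> < 1" "0 \<le> C"
    and bd: "\<And>r x. r \<in> {s, t, s + t} \<Longrightarrow> x \<in> {0..1} \<Longrightarrow>
    r * (\<sigma>\<^sup>2 / 2 * eta x) \<le> \<gamma> + C * (1 - x) \<and> - r * (\<sigma>\<^sup>2 / 2 * eta x) \<le> \<gamma> + C * x"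
    by blast
  have "s * step_kernel b \<sigma> u x + t * step_kernel b \<sigma> v x
      \<le> (if x < max u v then \<gamma> / (1 - x) else 0) + (if min u v \<le> x then \<gamma> / x else 0) + 2 * C"
    if x: "0 < x" "x < 1" for u v x
  proof -
    let ?h = "\<sigma>\<^sup>2 / 2 * eta x"
    have up: "r * ?h * (1 / (1 - x)) \<le> \<gamma> / (1 - x) + C" if "r \<in> {s, t, s + t}" for r
    proof -
      have "r * ?h / (1 - x) \<le> (\<gamma> + C * (1 - x)) / (1 - x)"
        using bd[OF that, of x] x by (intro divide_right_mono) auto
      then show ?thesis using x by (simp add: add_divide_distrib)
    qed
    have down: "r * ?h * (- 1 / x) \<le> \<gamma> / x + C" if "r \<in> {s, t, s + t}" for r
    proof -
      have "- r * ?h / x \<le> (\<gamma> + C * x) / x"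
        using bd[OF that, of x] x by (intro divide_right_mono) auto
      then show ?thesis using x by (simp add: add_divide_distrib)
    qed
    have st: "s * step_kernel b \<sigma> u x + t * step_kernel b \<sigma> v x
        = s * ?h * (if x < u then 1 / (1 - x) else - 1 / x) + t * ?h * (if x < v then 1 / (1 - x) else - 1 / x)"
      by (simp only: step_kernel_eq_eta[OF x] mult.assoc)
    have g: "0 \<le> \<gamma> / x" "0 \<le> \<gamma> / (1 - x)" using gC x by auto
    consider "x < u" "x < v" | "x < u" "v \<le> x" | "u \<le> x" "x < v" | "u \<le> x" "v \<le> x" by linarith
    then show ?thesis
    proof cases
      case 1
      have "s * ?h * (1 / (1 - x)) + t * ?h * (1 / (1 - x)) = (s + t) * ?h * (1 / (1 - x))"
        by (simp only: distrib_right)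
      moreover have "x < max u v" "\<not> min u v \<le> x" using 1 by auto
      ultimately show ?thesis using up[of "s + t"] 1 gC(3) unfolding st by simp
    next
      case 2
      then show ?thesis using up[of s] down[of t] unfolding st by simp
    next
      case 3
      then show ?thesis using up[of t] down[of s] unfolding st by simp
    next
      case 4
      have "s * ?h * (- 1 / x) + t * ?h * (- 1 / x) = (s + t) * ?h * (- 1 / x)"
        by (simp only: distrib_right)
      moreover have "\<not> x < max u v" "min u v \<le> x" using 4 by auto
      ultimately show ?thesis using down[of "s + t"] 4 gC(3) unfolding st by simp
    qed
  qed
  then show ?thesis using gC by blast
qed

section \<open>Uniform bounds and limits of the gap products\<close>

text \<open>At \<open>u = i / n\<close> and \<open>v = j / n\<close> this is \<open>J_prod b \<sigma> n i j s t\<close>. Real arguments make it a step function on the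
unit square, as is needed for the passage to the limit.\<close>

definition gap_product :: "nat \<Rightarrow> real \<Rightarrow> real \<Rightarrow> real \<Rightarrow> real \<Rightarrow> real" where
  "gap_product n s t u v =
     (\<Prod>k=1..<n. 1 / (1 - (s * step_kernel b \<sigma> u (real k / real n) + t * step_kernel b \<sigma> v (real k / real n)) / real n))"

text \<open>The density of a Beta distribution up to its normalisation, integrable for \<open>\<gamma> < 1\<close>.\<close>

definition endpoint_weight :: "real \<Rightarrow> real \<Rightarrow> real" where
  "endpoint_weight \<gamma> u = u powr (- \<gamma>) * (1 - u) powr (- \<gamma>)"

text \<open>The bound of \<open>step_kernel_combination_le\<close> at \<open>x = k / n\<close>, divided by \<open>n\<close>, reads \<open>P + Q + 2 C / n\<close> with
\<open>P = \<gamma> / (n - k)\<close> for \<open>k / n < max u v\<close> and \<open>Q = \<gamma> / k\<close> for \<open>min u v \<le> k / n\<close>. Since \<open>P * Q\<close> is of order \<open>1 / n\<close>,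
each factor of the product is at least \<open>(1 - P) * (1 - Q) * (1 - E / n)\<close> for a constant \<open>E\<close>. This is
positive for large \<open>n\<close>; the product of the last terms stays bounded away from zero, and those of the
first two contribute powers of \<open>1 - max u v\<close> and of \<open>min u v\<close>.\<close>

lemma gap_product_bounds:
  assumes st: "(s, t) \<in> V2_set b \<sigma>"
  shows "\<exists>\<gamma> K N. 0 \<le> \<gamma> \<and> \<gamma> < 1 \<and> 0 \<le> K \<and> (\<forall>n\<ge>N.
    (\<forall>u v. \<forall>k\<in>{1..<n}. 0 < 1 - (s * step_kernel b \<sigma> u (real k / real n) + t * step_kernel b \<sigma> v (real k / real n)) / real n)
    \<and> (\<forall>u v. 0 < u \<longrightarrow> u < 1 \<longrightarrow> 0 < v \<longrightarrow> v < 1 \<longrightarrow> gap_product n s t u v \<le> K * (endpoint_weight \<gamma> u * endpoint_weight \<gamma> v)))"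
proof -
  obtain \<gamma> C where gC: "0 \<le> \<gamma>" "\<gamma> < 1" "0 \<le> C" and le: "\<And>u v x. 0 < x \<Longrightarrow> x < 1 \<Longrightarrow>
    s * step_kernel b \<sigma> u x + t * step_kernel b \<sigma> v x
      \<le> (if x < max u v then \<gamma> / (1 - x) else 0) + (if min u v \<le> x then \<gamma> / x else 0) + 2 * C"
    using step_kernel_combination_le[OF st] by blast
  define E where "E = (2 * C + 2) / (1 - \<gamma>)\<^sup>2"
  have E: "E > 0" using gC by (simp add: E_def)
  define K where "K = exp (2 * E) * (2 / (1 - \<gamma>))\<^sup>2"
  have K: "K \<ge> 0" by (simp add: K_def)
  define N where "N = max 2 (nat \<lceil>2 * E\<rceil>)"
  define P where "P n u v k = (if real k / real n < max u v then \<gamma> / real (n - k) else 0)"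
    for n u v and k :: nat
  define Q where "Q n u v k = (if min u v \<le> real k / real n then \<gamma> / real k else 0)"
    for n :: nat and u v and k :: nat
  define F where "F n u v k = s * step_kernel b \<sigma> u (real k / real n) + t * step_kernel b \<sigma> v (real k / real n)"
    for n :: nat and u v and k :: nat
  have PQ_bounds: "0 \<le> P n u v k" "P n u v k \<le> \<gamma>" "0 \<le> Q n u v k" "Q n u v k \<le> \<gamma>"
    if k: "k \<in> {1..<n}" for n k u v
  proof -
    have nk: "real k \<ge> 1" "real (n - k) \<ge> 1" using k by auto
    have div_le: "\<gamma> / m \<le> \<gamma>" if "m \<ge> 1" for m :: real
      using gC that by (simp add: divide_le_eq mult_le_cancel_left1)
    show "0 \<le> P n u v k" "P n u v k \<le> \<gamma>" "0 \<le> Q n u v k" "Q n u v k \<le> \<gamma>"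
      using gC div_le[OF nk(1)] div_le[OF nk(2)] by (auto simp: P_def Q_def)
  qed
  have factor: "(1 - P n u v k) * (1 - Q n u v k) * (1 - E / real n) \<le> 1 - F n u v k / real n"
    if n: "n \<ge> N" and k: "k \<in> {1..<n}" for n k u v
  proof -
    let ?P = "P n u v k" and ?Q = "Q n u v k" and ?F = "F n u v k"
    have nk: "real k \<ge> 1" "real (n - k) \<ge> 1" "n \<ge> 2" using k n by (auto simp: N_def)
    note P = PQ_bounds(1,2)[OF k, of u v] and Q = PQ_bounds(3,4)[OF k, of u v]
    have "?F / real n \<le> ((if real k / real n < max u v then \<gamma> / (1 - real k / real n) else 0)
        + (if min u v \<le> real k / real n then \<gamma> / (real k / real n) else 0) + 2 * C) / real n"
      unfolding F_def using k nk by (intro divide_right_mono le) auto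
    also have "\<dots> = ?P + ?Q + 2 * C / real n"
    proof -
      have "\<gamma> / (1 - real k / real n) / real n = \<gamma> / real (n - k)"
        using k nk by (simp add: of_nat_diff field_simps)
      moreover have "\<gamma> / (real k / real n) / real n = \<gamma> / real k"
        using k nk by simp
      ultimately show ?thesis by (simp add: P_def Q_def add_divide_distrib)
    qed
    finally have F: "?F / real n \<le> ?P + ?Q + 2 * C / real n" .
    have PQ: "?P * ?Q \<le> 2 / real n"
    proof -
      have "?P \<le> 1 / real (n - k)" "?Q \<le> 1 / real k"
        using gC nk by (auto simp: P_def Q_def intro!: divide_right_mono)
      then have "?P * ?Q \<le> 1 / real (n - k) * (1 / real k)"
        using P Q by (intro mult_mono) auto
      also have "\<dots> \<le> 2 / real n"
      proof -
        \<comment> \<open>\<open>k * (n - k)\<close> is smallest for \<open>k = 1\<close> and \<open>k = n - 1\<close>\<close>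
        have "0 \<le> (real k - 1) * (real (n - k) - 1)" using nk by (intro mult_nonneg_nonneg) auto
        then have "real n - 1 \<le> real (n - k) * real k"
          using k by (simp add: of_nat_diff algebra_simps)
        then have "real n \<le> 2 * (real (n - k) * real k)" using nk by linarith
        then show ?thesis using nk by (simp add: field_simps)
      qed
      finally show ?thesis .
    qed
    have "(1 - \<gamma>)\<^sup>2 \<le> (1 - ?P) * (1 - ?Q)"
      unfolding power2_eq_square using P Q gC by (intro mult_mono) auto
    then have "(1 - \<gamma>)\<^sup>2 * (E / real n) \<le> (1 - ?P) * (1 - ?Q) * (E / real n)"
      using E by (intro mult_right_mono) auto
    moreover have "(1 - \<gamma>)\<^sup>2 * (E / real n) = 2 * C / real n + 2 / real n"
    proof -
      have "(1 - \<gamma>)\<^sup>2 * E = 2 * C + 2" using gC by (simp add: E_def)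
      then show ?thesis by (simp only: times_divide_eq_right add_divide_distrib)
    qed
    moreover have "(1 - ?P) * (1 - ?Q) = 1 - ?P - ?Q + ?P * ?Q"
      by (simp add: algebra_simps)
    moreover have "(1 - ?P) * (1 - ?Q) * (1 - E / real n)
        = (1 - ?P) * (1 - ?Q) - (1 - ?P) * (1 - ?Q) * (E / real n)"
      by (simp only: right_diff_distrib mult_1_right)
    ultimately show "(1 - ?P) * (1 - ?Q) * (1 - E / real n) \<le> 1 - ?F / real n"
      using F PQ by linarith
  qed
  have En: "E / real n \<le> 1 / 2" "0 < real n" if "n \<ge> N" for n
  proof -
    have "2 * E \<le> real n" using that by (simp add: N_def nat_le_iff ceiling_le_iff)
    moreover show "0 < real n" using that by (simp add: N_def)
    ultimately show "E / real n \<le> 1 / 2" by (simp add: field_simps)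
  qed
  have "(\<forall>u v. \<forall>k\<in>{1..<n}. 0 < 1 - (s * step_kernel b \<sigma> u (real k / real n) + t * step_kernel b \<sigma> v (real k / real n)) / real n)
    \<and> (\<forall>u v. 0 < u \<longrightarrow> u < 1 \<longrightarrow> 0 < v \<longrightarrow> v < 1 \<longrightarrow> gap_product n s t u v \<le> K * (endpoint_weight \<gamma> u * endpoint_weight \<gamma> v))"
    if n: "n \<ge> N" for n
  proof (intro conjI allI ballI impI)
    fix u v k assume k: "k \<in> {1..<n}"
    have "0 < (1 - P n u v k) * (1 - Q n u v k) * (1 - E / real n)"
      using PQ_bounds[OF k, of u v] gC En[OF n] by (intro mult_pos_pos) linarith+
    then show "0 < 1 - (s * step_kernel b \<sigma> u (real k / real n) + t * step_kernel b \<sigma> v (real k / real n)) / real n"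
      using factor[OF n k, of u v] unfolding F_def by (rule less_le_trans)
  next
    fix u v :: real assume uv: "0 < u" "u < 1" "0 < v" "v < 1"
    have PQ: "0 < 1 - P n u v k" "0 < 1 - Q n u v k" if "k \<in> {1..<n}" for k
      using PQ_bounds[OF that, of u v] gC by linarith+
    have E1: "0 < 1 - E / real n" using En[OF n] by linarith
    have "gap_product n s t u v
        \<le> (\<Prod>k=1..<n. 1 / (1 - P n u v k) * (1 / (1 - Q n u v k)) * (1 / (1 - E / real n)))"
      unfolding gap_product_def F_def[symmetric]
    proof (rule prod_mono)
      fix k assume k: "k \<in> {1..<n}"
      have pos: "0 < (1 - P n u v k) * (1 - Q n u v k) * (1 - E / real n)" using PQ[OF k] E1 by simp
      note f = factor[OF n k, of u v]
      show "0 \<le> 1 / (1 - F n u v k / real n) \<and> 1 / (1 - F n u v k / real n)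
          \<le> 1 / (1 - P n u v k) * (1 / (1 - Q n u v k)) * (1 / (1 - E / real n))"
        using frac_le[OF _ _ pos f, of 1 1] less_le_trans[OF pos f] by (simp add: less_imp_le)
    qed
    also have "\<dots> = (\<Prod>k=1..<n. 1 / (1 - P n u v k)) * (\<Prod>k=1..<n. 1 / (1 - Q n u v k))
        * (\<Prod>k=1..<n. 1 / (1 - E / real n))"
      by (simp only: prod.distrib)
    also have "\<dots> \<le> (2 / (1 - \<gamma>) * (1 - max u v) powr (- \<gamma>)) * (2 / (1 - \<gamma>) * min u v powr (- \<gamma>)) * exp (2 * E)"
    proof (intro mult_mono)
      have "(\<Prod>k=1..<n. 1 / (1 - P n u v k))
          = (\<Prod>k | k \<in> {1..<n} \<and> real k / real n < max u v. 1 / (1 - \<gamma> / real (n - k)))"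
        by (subst prod.inter_filter) (auto simp: P_def intro!: prod.cong)
      also have "\<dots> \<le> 2 / (1 - \<gamma>) * (1 - max u v) powr (- \<gamma>)"
        using gC uv by (intro prod_inverse_one_minus_lt_threshold_le) auto
      finally show "(\<Prod>k=1..<n. 1 / (1 - P n u v k)) \<le> 2 / (1 - \<gamma>) * (1 - max u v) powr (- \<gamma>)" .
      have "(\<Prod>k=1..<n. 1 / (1 - Q n u v k))
          = (\<Prod>k | k \<in> {1..<n} \<and> min u v \<le> real k / real n. 1 / (1 - \<gamma> / real k))"
        by (subst prod.inter_filter) (auto simp: Q_def intro!: prod.cong)
      also have "\<dots> \<le> 2 / (1 - \<gamma>) * min u v powr (- \<gamma>)"
        using gC uv by (intro prod_inverse_one_minus_ge_threshold_le) auto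
      finally show "(\<Prod>k=1..<n. 1 / (1 - Q n u v k)) \<le> 2 / (1 - \<gamma>) * min u v powr (- \<gamma>)" .
      let ?y = "E / real n"
      have y: "0 \<le> ?y" "?y \<le> 1 / 2" using E En[OF n] by auto
      have "1 / (1 - ?y) \<le> exp (2 * ?y)" by (rule inverse_one_minus_le_exp[OF y])
      then have "(\<Prod>k=1..<n. 1 / (1 - ?y)) \<le> (\<Prod>k=1..<n. exp (2 * ?y))"
        using E1 by (intro prod_mono) auto
      also have "\<dots> = exp (real (n - 1) * (2 * ?y))" by (simp only: exp_of_nat_mult) simp
      also have "\<dots> \<le> exp (real n * (2 * ?y))" unfolding exp_le_cancel_iff using y
          by (intro mult_right_mono) auto
      also have "real n * (2 * ?y) = 2 * E" using En[OF n] by simp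
      finally show "(\<Prod>k=1..<n. 1 / (1 - ?y)) \<le> exp (2 * E)" .
    qed (use PQ E1 gC in \<open>auto intro!: prod_nonneg mult_nonneg_nonneg simp: less_imp_le\<close>)
    also have "\<dots> = K * ((1 - max u v) powr (- \<gamma>) * min u v powr (- \<gamma>))"
      by (simp add: K_def power2_eq_square)
    also have "\<dots> \<le> K * (endpoint_weight \<gamma> u * endpoint_weight \<gamma> v)"
    proof (rule mult_left_mono[OF _ K])
      have ge1: "1 \<le> y powr (- \<gamma>)" if "0 < y" "y < 1" for y
        using that gC by (simp add: powr_minus_divide powr_le1)
      have "(1 - v) powr (- \<gamma>) * u powr (- \<gamma>) \<le> endpoint_weight \<gamma> u * endpoint_weight \<gamma> v"
        if "0 < u" "u < 1" "0 < v" "v < 1" for u v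
      proof -
        have "1 * 1 \<le> (1 - u) powr (- \<gamma>) * v powr (- \<gamma>)" using that by (intro mult_mono ge1) auto
        then have "(1 - v) powr (- \<gamma>) * u powr (- \<gamma>) * 1
            \<le> (1 - v) powr (- \<gamma>) * u powr (- \<gamma>) * ((1 - u) powr (- \<gamma>) * v powr (- \<gamma>))"
          by (intro mult_left_mono) auto
        then show ?thesis by (simp add: endpoint_weight_def mult_ac)
      qed
      from this[of u v] this[of v u] uv
      show "(1 - max u v) powr (- \<gamma>) * min u v powr (- \<gamma>) \<le> endpoint_weight \<gamma> u * endpoint_weight \<gamma> v"
        by (cases "u \<le> v") (auto simp: mult.commute)
    qed
    finally show "gap_product n s t u v \<le> K * (endpoint_weight \<gamma> u * endpoint_weight \<gamma> v)" .
  qed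
  then show ?thesis using gC K by blast
qed

lemma step_kernel_at_1: "step_kernel b \<sigma> u 1 = 0"
  by (simp add: step_kernel_def prim1)

lemma step_kernel_bounded:
  assumes u: "0 < u" "u < 1"
  shows "\<exists>M. \<forall>x\<in>{0..1}. \<bar>step_kernel b \<sigma> u x\<bar> \<le> M"
proof -
  have "compact (eta ` {0..1})" by (intro compact_continuous_image continuous_on_eta) auto
  then obtain H where H: "\<And>x. x \<in> {0..1} \<Longrightarrow> \<bar>eta x\<bar> \<le> H"
    by (metis compact_imp_bounded bounded_iff image_eqI real_norm_def)
  have H0: "0 \<le> H" using H[of 0] by simp
  define c where "c = max (1 / (1 - u)) (1 / u)"
  have c: "c \<ge> 0" using u by (simp add: c_def le_max_iff_disj)
  have "\<bar>step_kernel b \<sigma> u x\<bar> \<le> \<sigma>\<^sup>2 / 2 * H * c" if x: "x \<in> {0..1}" for x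
  proof (cases "x = 0 \<or> x = 1")
    case True
    then have "step_kernel b \<sigma> u x = 0" by (auto simp: step_kernel_def prim0 prim1)
    then show ?thesis using H0 c by simp
  next
    case False
    then have x': "0 < x" "x < 1" using x by auto
    have "\<bar>if x < u then 1 / (1 - x) else - 1 / x\<bar> \<le> c"
    proof (cases "x < u")
      case True
      then have "1 / (1 - x) \<le> 1 / (1 - u)" using u by (intro frac_le) auto
      then show ?thesis using True x' by (simp add: c_def le_max_iff_disj)
    next
      case False
      then have "1 / x \<le> 1 / u" using u by (intro frac_le) auto
      then show ?thesis using False x' by (simp add: c_def le_max_iff_disj)
    qed
    then show ?thesis
      unfolding step_kernel_eq_eta[OF x'] abs_mult using H[OF x] H0
      by (intro mult_mono) auto
  qed
  then show ?thesis by blast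
qed

lemma isCont_step_kernel:
  assumes x: "0 < x" "x < 1" "x \<noteq> u"
  shows "isCont (step_kernel b \<sigma> u) x"
proof -
  have prim: "isCont (prim b) x"
    using continuous_on_interior[OF continuous_on_prim, of x] x by simp
  have pos: "prim b x \<noteq> 0" using prim_pos[of x] x by simp
  consider "x < u" | "u < x" using x by linarith
  then show ?thesis
  proof cases
    case 1
    have "isCont (\<lambda>x. \<sigma>\<^sup>2 / 2 * x / prim b x) x" using prim pos by (intro continuous_intros) auto
    moreover have "eventually (\<lambda>y. step_kernel b \<sigma> u y = \<sigma>\<^sup>2 / 2 * y / prim b y) (nhds x)"
      using eventually_nhds_in_open[of "{..<u}" x] 1 by (auto elim!: eventually_mono simp: step_kernel_def)
    ultimately show ?thesis by (simp add: isCont_cong)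
  next
    case 2
    have "isCont (\<lambda>x. \<sigma>\<^sup>2 / 2 * (x - 1) / prim b x) x" using prim pos by (intro continuous_intros) auto
    moreover have "eventually (\<lambda>y. step_kernel b \<sigma> u y = \<sigma>\<^sup>2 / 2 * (y - 1) / prim b y) (nhds x)"
      using eventually_nhds_in_open[of "{u<..}" x] 2 by (auto elim!: eventually_mono simp: step_kernel_def)
    ultimately show ?thesis by (simp add: isCont_cong)
  qed
qed

lemma step_kernel_integrable:
  assumes u: "0 < u" "u < 1"
  shows "step_kernel b \<sigma> u integrable_on {0..1}"
proof -
  obtain M where "\<And>x. x \<in> {0..1} \<Longrightarrow> \<bar>step_kernel b \<sigma> u x\<bar> \<le> M" using step_kernel_bounded[OF u] by blast
  then show ?thesis by (rule riemann_sum_tendsto(1)[where S = "{u}"]) (auto intro: isCont_step_kernel)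
qed

text \<open>The two integrals in the definition of \<open>Phi\<close> are those of the kernel to the left and to the right of \<open>u\<close>.\<close>

lemma Phi_eq_integral_step_kernel:
  assumes u: "0 < u" "u < 1"
  shows "Phi b \<sigma> u = integral {0..1} (step_kernel b \<sigma> u)"
proof -
  note int = step_kernel_integrable[OF u]
  have "integral {0..u} (step_kernel b \<sigma> u) = integral {0..u} (\<lambda>v. v * \<sigma>\<^sup>2 / (2 * prim b v))"
    by (rule integral_spike[of "{u}"]) (auto simp: step_kernel_def)
  moreover have "integral {u..1} (step_kernel b \<sigma> u) = integral {u..1} (\<lambda>v. - ((1 - v) * \<sigma>\<^sup>2 / (2 * prim b v)))"
    by (rule integral_cong)
      (auto simp: step_kernel_def left_diff_distrib right_diff_distrib diff_divide_distrib mult.commute)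
  moreover have "integral {0..u} (step_kernel b \<sigma> u) + integral {u..1} (step_kernel b \<sigma> u) = integral {0..1} (step_kernel b \<sigma> u)"
    using u int by (intro Henstock_Kurzweil_Integration.integral_combine) auto
  ultimately show ?thesis by (simp add: Phi_def)
qed

lemma gap_product_tendsto:
  assumes u: "0 < u" "u < 1" and v: "0 < v" "v < 1"
  shows "(\<lambda>n. gap_product n s t u v) \<longlonglongrightarrow> exp (s * Phi b \<sigma> u + t * Phi b \<sigma> v)"
proof -
  let ?G = "\<lambda>x. s * step_kernel b \<sigma> u x + t * step_kernel b \<sigma> v x"
  obtain M N where M: "\<And>x. x \<in> {0..1} \<Longrightarrow> \<bar>step_kernel b \<sigma> u x\<bar> \<le> M"
    and N: "\<And>x. x \<in> {0..1} \<Longrightarrow> \<bar>step_kernel b \<sigma> v x\<bar> \<le> N"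
    using step_kernel_bounded[OF u] step_kernel_bounded[OF v] by blast
  have "\<bar>?G x\<bar> \<le> \<bar>s\<bar> * M + \<bar>t\<bar> * N" if "x \<in> {0..1}" for x
    using abs_triangle_ineq[of "s * step_kernel b \<sigma> u x" "t * step_kernel b \<sigma> v x"]
      mult_left_mono[OF M[OF that], of "\<bar>s\<bar>"] mult_left_mono[OF N[OF that], of "\<bar>t\<bar>"]
    unfolding abs_mult by linarith
  then have "(\<lambda>n. \<Prod>k=1..n. 1 / (1 - ?G (real k / real n) / real n)) \<longlonglongrightarrow> exp (integral {0..1} ?G)"
    by (rule riemann_product_tendsto[where S = "{u, v}"]) (auto intro!: continuous_intros isCont_step_kernel)
  moreover have "integral {0..1} ?G = s * Phi b \<sigma> u + t * Phi b \<sigma> v"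
    using step_kernel_integrable[OF u] step_kernel_integrable[OF v]
    by (subst integral_add) (simp_all add: Phi_eq_integral_step_kernel u v integrable_on_mult_right)
  moreover have "eventually (\<lambda>n. (\<Prod>k=1..n. 1 / (1 - ?G (real k / real n) / real n)) = gap_product n s t u v) sequentially"
    using eventually_ge_at_top[of 1]
  proof eventually_elim
    case (elim n)
    \<comment> \<open>the factor at \<open>k = n\<close> is \<open>1\<close> because the kernel vanishes at \<open>1\<close>\<close>
    then have "{1..n} = insert n {1..<n}" by auto
    then show ?case using elim by (simp add: gap_product_def step_kernel_at_1)
  qed
  ultimately show ?thesis by (simp add: Lim_transform_eventually)
qed

section \<open>The limiting distribution\<close>

text \<open>For two thresholds the kernels differ only between them, by \<open>\<sigma>\<^sup>2 / (2 * prim b v)\<close>.\<close>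

lemma Phi_diff:
  assumes "0 < a" "a < x" "x < 1"
  shows "Phi b \<sigma> x = Phi b \<sigma> a + integral {a..x} (\<lambda>v. \<sigma>\<^sup>2 / (2 * prim b v))"
proof -
  have "Phi b \<sigma> x - Phi b \<sigma> a = integral {0..1} (\<lambda>v. step_kernel b \<sigma> x v - step_kernel b \<sigma> a v)"
    using assms step_kernel_integrable[of a] step_kernel_integrable[of x]
    by (simp add: Phi_eq_integral_step_kernel integral_diff)
  also have "\<dots> = integral {0..1} (\<lambda>v. if v \<in> {a..x} then \<sigma>\<^sup>2 / (2 * prim b v) else 0)"
    by (rule integral_spike[of "{x}"])
      (use assms in \<open>auto simp: step_kernel_def left_diff_distrib right_diff_distrib diff_divide_distrib mult.commute\<close>)
  also have "\<dots> = integral {a..x} (\<lambda>v. \<sigma>\<^sup>2 / (2 * prim b v))"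
    using assms by (simp only: integral_restrict_Int) (simp add: Int_absorb1)
  finally show ?thesis by simp
qed

lemma has_derivative_Phi:
  assumes u: "0 < u" "u < 1"
  shows "(Phi b \<sigma> has_real_derivative \<sigma>\<^sup>2 / (2 * prim b u)) (at u)"
proof -
  define a where "a = u / 2"
  define d where "d = (u + 1) / 2"
  have ad: "0 < a" "a < u" "u < d" "d < 1" using u by (auto simp: a_def d_def)
  let ?q = "\<lambda>v. \<sigma>\<^sup>2 / (2 * prim b v)"
  have "continuous_on {a..d} ?q"
    using ad by (intro continuous_intros continuous_on_subset[OF continuous_on_prim])
      (auto dest!: prim_pos[OF less_le_trans[OF ad(1)] le_less_trans[OF _ ad(4)]])
  then have "((\<lambda>x. integral {a..x} ?q) has_real_derivative ?q u) (at u within {a..d})"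
    using ad by (intro integral_has_real_derivative) auto
  then have "((\<lambda>x. integral {a..x} ?q) has_real_derivative ?q u) (at u)"
    using ad by (simp add: at_within_Icc_at)
  then have "((\<lambda>x. Phi b \<sigma> a + integral {a..x} ?q) has_real_derivative ?q u) (at u)"
    by (auto intro!: derivative_eq_intros)
  moreover have "eventually (\<lambda>x. Phi b \<sigma> x = Phi b \<sigma> a + integral {a..x} ?q) (nhds u)"
    using eventually_nhds_in_open[of "{a<..<d}" u] ad
    by (auto elim!: eventually_mono intro!: Phi_diff)
  ultimately show ?thesis
    by (simp add: DERIV_cong_ev[OF refl _ refl])
qed

lemma Phi_strict_mono:
  assumes "0 < x" "x < y" "y < 1"
  shows "Phi b \<sigma> x < Phi b \<sigma> y"
proof (rule DERIV_pos_imp_increasing[OF assms(2)])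
  fix u assume "x \<le> u" "u \<le> y"
  then show "\<exists>y. (Phi b \<sigma> has_real_derivative y) (at u) \<and> 0 < y"
    using has_derivative_Phi[of u] prim_pos[of u] sigma2 assms
    by (intro exI[of _ "\<sigma>\<^sup>2 / (2 * prim b u)"]) auto
qed

lemma inj_on_Phi: "inj_on (Phi b \<sigma>) {0<..<1}"
  by (rule linorder_inj_onI') (use Phi_strict_mono in force)

text \<open>Since \<open>prim b x \<le> - b 1 * (1 - x)\<close>, the derivative of \<open>Phi\<close> is at least a positive multiple of \<open>1 / (1 - x)\<close>,
so \<open>Phi\<close> grows at least logarithmically near \<open>1\<close>. The behaviour near \<open>0\<close> is treated in the same way.\<close>

lemma Phi_unbounded_above: "\<exists>u. 1 / 2 < u \<and> u < 1 \<and> y < Phi b \<sigma> u"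
proof -
  define \<kappa> where "\<kappa> = \<sigma>\<^sup>2 / (2 * (- b 1))"
  have \<kappa>: "\<kappa> > 0" unfolding \<kappa>_def using drift_endpoints sigma2 by (intro divide_pos_pos) auto
  have mono: "Phi b \<sigma> (1/2) + \<kappa> * ln (1 - 1/2) \<le> Phi b \<sigma> u + \<kappa> * ln (1 - u)" if u: "1 / 2 \<le> u" "u < 1" for u
  proof (rule DERIV_nonneg_imp_nondecreasing[OF u(1)])
    fix x :: real assume "1 / 2 \<le> x" "x \<le> u"
    then have x: "0 < x" "x < 1" using u by auto
    have "((\<lambda>x. Phi b \<sigma> x + \<kappa> * ln (1 - x)) has_real_derivative \<sigma>\<^sup>2 / (2 * prim b x) - \<kappa> / (1 - x)) (at x)"
      using x by (auto intro!: derivative_eq_intros has_derivative_Phi)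
    moreover have "\<kappa> / (1 - x) \<le> \<sigma>\<^sup>2 / (2 * prim b x)"
    proof -
      have "\<kappa> / (1 - x) = \<sigma>\<^sup>2 / (2 * (- b 1 * (1 - x)))" by (simp add: \<kappa>_def)
      also have "\<dots> \<le> \<sigma>\<^sup>2 / (2 * prim b x)"
        using prim_le(2)[OF x] prim_pos[OF x] by (intro frac_le) auto
      finally show ?thesis .
    qed
    ultimately show "\<exists>y. ((\<lambda>x. Phi b \<sigma> x + \<kappa> * ln (1 - x)) has_real_derivative y) (at x) \<and> 0 \<le> y"
      by (intro exI[of _ "\<sigma>\<^sup>2 / (2 * prim b x) - \<kappa> / (1 - x)"]) simp
  qed
  \<comment> \<open>the point \<open>1 - exp L\<close>: the bound \<open>L \<le> - 1\<close> keeps it right of \<open>1 / 2\<close>, the other makes \<open>Phi\<close> large\<close>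
  define L where "L = min (- 1) ((Phi b \<sigma> (1/2) + \<kappa> * ln (1 - 1/2) - y - 1) / \<kappa>)"
  define u where "u = 1 - exp L"
  have "exp L \<le> exp (- 1)" by (simp add: L_def)
  also have "exp (- 1 :: real) < 1 / 2"
    using exp_lower_Taylor_quadratic[of "1 :: real"] by (simp add: exp_minus divide_simps)
  finally have u: "1 / 2 < u" "u < 1" by (auto simp: u_def)
  have "\<kappa> * L \<le> Phi b \<sigma> (1/2) + \<kappa> * ln (1 - 1/2) - y - 1"
  proof -
    have "\<kappa> * L \<le> \<kappa> * ((Phi b \<sigma> (1/2) + \<kappa> * ln (1 - 1/2) - y - 1) / \<kappa>)"
      using \<kappa> by (intro mult_left_mono) (auto simp: L_def)
    then show ?thesis using \<kappa> by simp
  qed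
  then have "y < Phi b \<sigma> u" using mono[of u] u by (simp add: u_def)
  then show ?thesis using u by blast
qed

lemma Phi_unbounded_below: "\<exists>u. 0 < u \<and> u < 1 / 2 \<and> Phi b \<sigma> u < y"
proof -
  define \<kappa> where "\<kappa> = \<sigma>\<^sup>2 / (2 * b 0)"
  have \<kappa>: "\<kappa> > 0" using drift_endpoints sigma2 by (simp add: \<kappa>_def)
  have mono: "Phi b \<sigma> u - \<kappa> * ln u \<le> Phi b \<sigma> (1/2) - \<kappa> * ln (1/2)" if u: "0 < u" "u \<le> 1 / 2" for u
  proof (rule DERIV_nonneg_imp_nondecreasing[OF u(2)])
    fix x :: real assume "u \<le> x" "x \<le> 1 / 2"
    then have x: "0 < x" "x < 1" using u by auto
    have "((\<lambda>x. Phi b \<sigma> x - \<kappa> * ln x) has_real_derivative \<sigma>\<^sup>2 / (2 * prim b x) - \<kappa> / x) (at x)"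
      using x by (auto intro!: derivative_eq_intros has_derivative_Phi)
    moreover have "\<kappa> / x \<le> \<sigma>\<^sup>2 / (2 * prim b x)"
    proof -
      have "\<kappa> / x = \<sigma>\<^sup>2 / (2 * (b 0 * x))" by (simp add: \<kappa>_def)
      also have "\<dots> \<le> \<sigma>\<^sup>2 / (2 * prim b x)"
        using prim_le(1)[OF x] prim_pos[OF x] by (intro frac_le) auto
      finally show ?thesis .
    qed
    ultimately show "\<exists>y. ((\<lambda>x. Phi b \<sigma> x - \<kappa> * ln x) has_real_derivative y) (at x) \<and> 0 \<le> y"
      by (intro exI[of _ "\<sigma>\<^sup>2 / (2 * prim b x) - \<kappa> / x"]) simp
  qed
  \<comment> \<open>the point \<open>exp L\<close>: the bound \<open>L \<le> - 1\<close> keeps it left of \<open>1 / 2\<close>, the other makes \<open>Phi\<close> small\<close>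
  define L where "L = min (- 1) ((y - 1 - Phi b \<sigma> (1/2) + \<kappa> * ln (1/2)) / \<kappa>)"
  define u where "u = exp L"
  have "exp L \<le> exp (- 1)" by (simp add: L_def)
  also have "exp (- 1 :: real) < 1 / 2"
    using exp_lower_Taylor_quadratic[of "1 :: real"] by (simp add: exp_minus divide_simps)
  finally have u: "0 < u" "u < 1 / 2" by (auto simp: u_def)
  have "\<kappa> * L \<le> y - 1 - Phi b \<sigma> (1/2) + \<kappa> * ln (1/2)"
  proof -
    have "\<kappa> * L \<le> \<kappa> * ((y - 1 - Phi b \<sigma> (1/2) + \<kappa> * ln (1/2)) / \<kappa>)"
      using \<kappa> by (intro mult_left_mono) (auto simp: L_def)
    then show ?thesis using \<kappa> by simp
  qed
  then have "Phi b \<sigma> u < y" using mono[of u] u by (simp add: u_def)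
  then show ?thesis using u by blast
qed

lemma Phi_image: "Phi b \<sigma> ` {0<..<1} = UNIV"
proof -
  have "\<exists>u\<in>{0<..<1}. Phi b \<sigma> u = y" for y
  proof -
    obtain l where l: "0 < l" "l < 1 / 2" "Phi b \<sigma> l < y" using Phi_unbounded_below by blast
    obtain r where r: "1 / 2 < r" "r < 1" "y < Phi b \<sigma> r" using Phi_unbounded_above by blast
    have "\<exists>x\<ge>l. x \<le> r \<and> Phi b \<sigma> x = y"
    proof (rule IVT)
      show "\<forall>x. l \<le> x \<and> x \<le> r \<longrightarrow> isCont (Phi b \<sigma>) x"
        using l r by (auto intro!: DERIV_isCont[OF has_derivative_Phi])
    qed (use l r in auto)
    then show ?thesis using l r by force
  qed
  then have "y \<in> Phi b \<sigma> ` {0<..<1}" for y by (metis image_eqI)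
  then show ?thesis by blast
qed

lemma F_inf_Phi: "u \<in> {0<..<1} \<Longrightarrow> F_inf b \<sigma> (Phi b \<sigma> u) = u"
  unfolding F_inf_def by (rule the_inv_into_f_f[OF inj_on_Phi])

lemma p_inf_Phi: "u \<in> {0<..<1} \<Longrightarrow> \<sigma>\<^sup>2 / (2 * prim b u) * p_inf b \<sigma> (Phi b \<sigma> u) = 1"
  using prim_pos[of u] sigma2 by (simp add: p_inf_def F_inf_Phi)

lemma p_inf_nonneg: "p_inf b \<sigma> x \<ge> 0"
proof -
  obtain u where "u \<in> {0<..<1}" "x = Phi b \<sigma> u" using Phi_image by blast
  then show ?thesis using prim_pos[of u] by (simp add: p_inf_def F_inf_Phi)
qed

lemma isCont_Phi: "u \<in> {0<..<1} \<Longrightarrow> isCont (Phi b \<sigma>) u"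
  using has_derivative_Phi[of u] by (auto intro: DERIV_isCont)

lemma borel_measurable_exp_Phi:
  "(\<lambda>u. indicator {0<..<1} u * exp (r * Phi b \<sigma> u)) \<in> borel_measurable borel"
proof -
  have "continuous_on {0<..<1} (\<lambda>u. exp (r * Phi b \<sigma> u))"
    by (intro continuous_intros continuous_at_imp_continuous_on) (use isCont_Phi in auto)
  then have "(\<lambda>u. indicator {0<..<1} u *\<^sub>R exp (r * Phi b \<sigma> u)) \<in> borel_measurable borel"
    by (rule borel_measurable_continuous_on_indicator[rotated]) simp
  then show ?thesis by simp
qed

lemma exp_Phi_change_of_variables:
  assumes int: "(\<lambda>u. exp (r * Phi b \<sigma> u)) absolutely_integrable_on {0<..<1}"
  shows "(\<lambda>x. exp (r * x) * p_inf b \<sigma> x) absolutely_integrable_on UNIV"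
    and "integral UNIV (\<lambda>x. exp (r * x) * p_inf b \<sigma> x) = integral {0<..<1} (\<lambda>u. exp (r * Phi b \<sigma> u))"
proof -
  let ?f = "\<lambda>x. exp (r * x) * p_inf b \<sigma> x"
  have eq: "\<bar>\<sigma>\<^sup>2 / (2 * prim b u)\<bar> * ?f (Phi b \<sigma> u) = exp (r * Phi b \<sigma> u)" if "u \<in> {0<..<1}" for u
  proof -
    have "\<bar>\<sigma>\<^sup>2 / (2 * prim b u)\<bar> = \<sigma>\<^sup>2 / (2 * prim b u)" using prim_pos[of u] that by simp
    then show ?thesis using p_inf_Phi[OF that] by (simp only: mult.left_commute[of _ "exp _"] mult_1_right)
  qed
  have "(\<lambda>u. \<bar>\<sigma>\<^sup>2 / (2 * prim b u)\<bar> * ?f (Phi b \<sigma> u)) absolutely_integrable_on {0<..<1}"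
    by (rule absolutely_integrable_spike[OF int, of "{}"]) (use eq in auto)
  moreover have "integral {0<..<1} (\<lambda>u. \<bar>\<sigma>\<^sup>2 / (2 * prim b u)\<bar> * ?f (Phi b \<sigma> u))
      = integral {0<..<1} (\<lambda>u. exp (r * Phi b \<sigma> u))"
    by (rule integral_cong) (rule eq)
  moreover have "{0<..<1 :: real} \<in> sets lebesgue" by simp
  moreover have "(Phi b \<sigma> has_field_derivative \<sigma>\<^sup>2 / (2 * prim b u)) (at u within {0<..<1})" if "u \<in> {0<..<1}" for u
    using has_derivative_Phi[of u] that by (auto intro: has_field_derivative_at_within)
  ultimately have "?f absolutely_integrable_on (Phi b \<sigma> ` {0<..<1}) \<and>
      integral (Phi b \<sigma> ` {0<..<1}) ?f = integral {0<..<1} (\<lambda>u. exp (r * Phi b \<sigma> u))"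
    using has_absolute_integral_change_of_variables_1'[of "{0<..<1}" "Phi b \<sigma>" "\<lambda>u. \<sigma>\<^sup>2 / (2 * prim b u)" ?f
        "integral {0<..<1} (\<lambda>u. exp (r * Phi b \<sigma> u))", OF _ _ inj_on_Phi]
    by blast
  then show "?f absolutely_integrable_on UNIV"
    and "integral UNIV ?f = integral {0<..<1} (\<lambda>u. exp (r * Phi b \<sigma> u))"
    by (simp_all add: Phi_image)
qed

section \<open>Convergence of the Laplace transforms\<close>

lemma endpoint_weight_nonneg: "0 \<le> endpoint_weight \<gamma> u"
  by (simp add: endpoint_weight_def)

lemma endpoint_weight_has_integral:
  assumes "\<gamma> < 1"
  shows "(endpoint_weight \<gamma> has_integral Beta (1 - \<gamma>) (1 - \<gamma>)) {0..1}"
  using has_integral_Beta_real[of "1 - \<gamma>" "1 - \<gamma>"] assms by (simp add: endpoint_weight_def[abs_def])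

lemma nn_integral_endpoint_weight:
  assumes "\<gamma> < 1"
  shows "(\<integral>\<^sup>+u. ennreal (endpoint_weight \<gamma> u) * indicator {0<..<1} u \<partial>lborel) < \<infinity>"
proof -
  have "(\<integral>\<^sup>+u. ennreal (endpoint_weight \<gamma> u) * indicator {0<..<1} u \<partial>lborel)
      \<le> (\<integral>\<^sup>+u. ennreal (endpoint_weight \<gamma> u) * indicator {0..1} u \<partial>lborel)"
    by (intro nn_integral_mono mult_left_mono) (auto split: split_indicator)
  also have "\<dots> = ennreal (Beta (1 - \<gamma>) (1 - \<gamma>))"
    by (rule nn_integral_has_integral_lebesgue'[OF endpoint_weight_nonneg endpoint_weight_has_integral[OF assms]])
  finally show ?thesis by (rule le_less_trans) simp
qed

text \<open>The limit of the bounds on \<open>gap_product\<close> with \<open>t = 0\<close>, at \<open>v = 1 / 2\<close>.\<close>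

lemma exp_Phi_bound:
  assumes r: "r \<in> V_set b \<sigma>"
  obtains \<gamma> K where "0 \<le> \<gamma>" "\<gamma> < 1" "\<And>u. u \<in> {0<..<1} \<Longrightarrow> exp (r * Phi b \<sigma> u) \<le> K * endpoint_weight \<gamma> u"
proof -
  have "(r, 0) \<in> V2_set b \<sigma>" using r zero_in_V by (simp add: V2_set_def)
  from gap_product_bounds[OF this] obtain \<gamma> K N where g: "0 \<le> \<gamma>" "\<gamma> < 1" "0 \<le> K"
    and bd: "\<And>n u v. n \<ge> N \<Longrightarrow> 0 < u \<Longrightarrow> u < 1 \<Longrightarrow> 0 < v \<Longrightarrow> v < 1 \<Longrightarrow>
      gap_product n r 0 u v \<le> K * (endpoint_weight \<gamma> u * endpoint_weight \<gamma> v)"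
    by blast
  have "exp (r * Phi b \<sigma> u) \<le> (K * endpoint_weight \<gamma> (1/2)) * endpoint_weight \<gamma> u" if u: "u \<in> {0<..<1}" for u
  proof -
    have "(\<lambda>n. gap_product n r 0 u (1/2)) \<longlonglongrightarrow> exp (r * Phi b \<sigma> u)"
      using gap_product_tendsto[of u "1/2" r 0] u by simp
    then have "exp (r * Phi b \<sigma> u) \<le> K * (endpoint_weight \<gamma> u * endpoint_weight \<gamma> (1/2))"
      by (rule LIMSEQ_le_const2) (use bd[of _ u "1/2"] u in auto)
    then show ?thesis by (simp add: mult_ac)
  qed
  then show ?thesis using that g by blast
qed

lemma exp_Phi_absolutely_integrable:
  assumes r: "r \<in> V_set b \<sigma>"
  shows "(\<lambda>u. exp (r * Phi b \<sigma> u)) absolutely_integrable_on {0<..<1}"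
proof -
  obtain \<gamma> K where g: "0 \<le> \<gamma>" "\<gamma> < 1" and bd: "\<And>u. u \<in> {0<..<1} \<Longrightarrow> exp (r * Phi b \<sigma> u) \<le> K * endpoint_weight \<gamma> u"
    by (rule exp_Phi_bound[OF r], rule that)
  show ?thesis
  proof (rule measurable_bounded_by_integrable_imp_absolutely_integrable)
    have "continuous_on {0<..<1} (\<lambda>u. exp (r * Phi b \<sigma> u))"
      by (intro continuous_intros continuous_at_imp_continuous_on) (use isCont_Phi in auto)
    then show "(\<lambda>u. exp (r * Phi b \<sigma> u)) \<in> borel_measurable (lebesgue_on {0<..<1})"
      by (rule continuous_imp_measurable_on_sets_lebesgue) simp
    have "endpoint_weight \<gamma> integrable_on {0<..<1}"
      using endpoint_weight_has_integral[OF g(2)] integrable_on_Icc_iff_Ioo[of "endpoint_weight \<gamma>" 0 1] by (auto simp: integrable_on_def)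
    then show "(\<lambda>u. K * endpoint_weight \<gamma> u) integrable_on {0<..<1}"
      by (rule integrable_on_mult_right)
  qed (use bd in auto)
qed

lemma L_inf_eq:
  assumes r: "r \<in> V_set b \<sigma>"
  shows "L_inf b \<sigma> r < \<infinity>"
    and "L_inf b \<sigma> r = (\<integral>\<^sup>+u. ennreal (exp (r * Phi b \<sigma> u)) * indicator {0<..<1} u \<partial>lborel)"
proof -
  note int = exp_Phi_absolutely_integrable[OF r]
  let ?I = "integral {0<..<1} (\<lambda>u. exp (r * Phi b \<sigma> u))"
  have "((\<lambda>u. exp (r * Phi b \<sigma> u)) has_integral ?I) {0<..<1}"
    using int by (simp add: absolutely_integrable_on_def has_integral_integral)
  then have 1: "(\<integral>\<^sup>+u. ennreal (exp (r * Phi b \<sigma> u)) * indicator {0<..<1} u \<partial>lborel) = ennreal ?I"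
    by (rule nn_integral_has_integral_lebesgue'[rotated]) simp
  have "((\<lambda>x. exp (r * x) * p_inf b \<sigma> x) has_integral ?I) UNIV"
    using exp_Phi_change_of_variables[OF int]
    by (metis absolutely_integrable_on_def has_integral_integral)
  from nn_integral_has_integral_lebesgue'[OF _ this]
  have 2: "L_inf b \<sigma> r = ennreal ?I"
    using p_inf_nonneg by (simp add: L_inf_def)
  show "L_inf b \<sigma> r < \<infinity>" by (simp add: 2)
  show "L_inf b \<sigma> r = (\<integral>\<^sup>+u. ennreal (exp (r * Phi b \<sigma> u)) * indicator {0<..<1} u \<partial>lborel)"
    by (simp only: 1 2)
qed

lemma rank_slope_eq_step_kernel:
  assumes "n > 0" "k \<in> {1..<n}"
  shows "rank_slope n i k * (\<sigma>\<^sup>2 / (2 * real n) / prim b (real k / real n))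
    = step_kernel b \<sigma> (real i / real n) (real k / real n) / real n"
proof -
  have "real k / real n < real i / real n \<longleftrightarrow> k < i" using assms by (simp add: divide_less_cancel)
  then show ?thesis by (simp add: rank_slope_def step_kernel_def mult_ac)
qed

lemma gap_rate_eq:
  assumes k: "k \<in> {1..<n}"
  shows "gap_rate b \<sigma> n s t i j k = 2 * real n / \<sigma>\<^sup>2 * prim b (real k / real n)
    * (1 - (s * step_kernel b \<sigma> (real i / real n) (real k / real n)
          + t * step_kernel b \<sigma> (real j / real n) (real k / real n)) / real n)"
proof -
  have n: "n > 0" using k by simp
  let ?c = "2 * real n / \<sigma>\<^sup>2 * prim b (real k / real n)"
  have c: "?c * (\<sigma>\<^sup>2 / (2 * real n) / prim b (real k / real n)) = 1"
    using n sigma2 prim_pos[of "real k / real n"] k by simp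
  have "rank_slope n i k = ?c * (step_kernel b \<sigma> (real i / real n) (real k / real n) / real n)" for i
    using c by (simp only: rank_slope_eq_step_kernel[OF n k, symmetric] mult.left_commute[of ?c] mult_1_right)
  then have "gap_rate b \<sigma> n s t i j k = ?c - s * (?c * (step_kernel b \<sigma> (real i / real n) (real k / real n) / real n))
      - t * (?c * (step_kernel b \<sigma> (real j / real n) (real k / real n) / real n))"
    unfolding gap_rate_def by (simp only:)
  also have "c - s * (c * (x / m)) - t * (c * (y / m)) = c * (1 - (s * x + t * y) / m)" for c x y m :: real
    by (simp add: right_diff_distrib distrib_left add_divide_distrib mult_ac)
  finally show ?thesis .
qed

lemma gap_rate_zero_pos:
  assumes k: "k \<in> {1..<n}"
  shows "0 < gap_rate b \<sigma> n 0 0 i j k"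
  using k sigma2 prim_pos[of "real k / real n"] by (simp add: gap_rate_def)

lemma gap_product_eq_prod_gap_rate:
  "(\<Prod>k=1..<n. gap_rate b \<sigma> n 0 0 1 1 k / gap_rate b \<sigma> n s t i j k)
    = gap_product n s t (real i / real n) (real j / real n)"
  unfolding gap_product_def
proof (rule prod.cong)
  fix k assume k: "k \<in> {1..<n}"
  have "0 < 2 * real n / \<sigma>\<^sup>2 * prim b (real k / real n)"
    using gap_rate_zero_pos[OF k, of 1 1] by (simp add: gap_rate_def)
  then have "2 * real n / \<sigma>\<^sup>2 * prim b (real k / real n) \<noteq> 0"
    by (rule less_imp_neq[THEN not_sym])
  then show "gap_rate b \<sigma> n 0 0 1 1 k / gap_rate b \<sigma> n s t i j k
      = 1 / (1 - (s * step_kernel b \<sigma> (real i / real n) (real k / real n)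
          + t * step_kernel b \<sigma> (real j / real n) (real k / real n)) / real n)"
    unfolding gap_rate_eq[OF k] by simp
qed simp

text \<open>Splitting the range of \<open>k\<close> at \<open>min i j\<close> and \<open>max i j\<close> fixes the branches of the kernels and yields the
three products of \<open>J_prod\<close>.\<close>

lemma gap_product_eq_J_prod:
  assumes ij: "i \<in> {1..n}" "j \<in> {1..n}" "i \<noteq> j"
  shows "gap_product n s t (real i / real n) (real j / real n) = J_prod b \<sigma> n i j s t"
proof -
  have n: "n > 0" using ij by simp
  define c where "c = \<sigma>\<^sup>2 / (2 * real n)"
  define l where "l k = (real k / real n) / prim b (real k / real n)" for k
  define u where "u k = (1 - real k / real n) / prim b (real k / real n)" for k
  have ker: "step_kernel b \<sigma> (real i / real n) (real k / real n) / real n = (if k < i then c * l k else - (c * u k))"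
    if "k \<in> {1..<n}" for i k
    using rank_slope_eq_step_kernel[OF n that, of i]
    by (auto simp: rank_slope_def c_def l_def u_def diff_divide_distrib left_diff_distrib right_diff_distrib mult.commute)
  let ?f = "\<lambda>k. 1 / (1 - (s * (if k < i then c * l k else - (c * u k)) + t * (if k < j then c * l k else - (c * u k))))"
  have "gap_product n s t (real i / real n) (real j / real n) = prod ?f {1..<n}"
    unfolding gap_product_def
    by (rule prod.cong) (simp_all only: add_divide_distrib times_divide_eq_right[symmetric] ker)
  also have "\<dots> = prod ?f {1..<min i j} * prod ?f {min i j..<max i j} * prod ?f {max i j..<n}"
  proof -
    have "1 \<le> min i j" "min i j \<le> max i j" "1 \<le> max i j" "max i j \<le> n" using ij by auto
    then show ?thesis by (simp only: prod.atLeastLessThan_concat)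
  qed
  also have "\<dots> = J_prod b \<sigma> n i j s t"
  proof (cases "i < j")
    case True
    then have m: "min i j = i" "max i j = j" by auto
    show ?thesis
      unfolding J_prod_def Let_def c_def[symmetric] l_def[symmetric] u_def[symmetric] m
      using True by (simp, intro arg_cong2[where f = "(*)"] prod.cong) (auto simp: algebra_simps)
  next
    case False
    then have m: "min i j = j" "max i j = i" using ij by auto
    show ?thesis
      unfolding J_prod_def Let_def c_def[symmetric] l_def[symmetric] u_def[symmetric] m
      using False by (simp, intro arg_cong2[where f = "(*)"] prod.cong) (auto simp: algebra_simps)
  qed
  finally show ?thesis .
qed

text \<open>On the grid the kernel does not change when its threshold is rounded up to a grid point.\<close>

lemma step_kernel_ceiling:
  assumes "n > 0" "0 < u"
  shows "step_kernel b \<sigma> (real (nat \<lceil>real n * u\<rceil>) / real n) (real k / real n) = step_kernel b \<sigma> u (real k / real n)"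
proof -
  have "real k / real n < real (nat \<lceil>real n * u\<rceil>) / real n \<longleftrightarrow> k < nat \<lceil>real n * u\<rceil>"
  proof -
    have "real k / real n < real m / real n \<longleftrightarrow> k < m" for m using assms by (simp add: divide_less_cancel)
    then show ?thesis .
  qed
  also have "\<dots> \<longleftrightarrow> int k < \<lceil>real n * u\<rceil>" by linarith
  also have "\<dots> \<longleftrightarrow> real k < real n * u" by (simp add: less_ceiling_iff)
  also have "\<dots> \<longleftrightarrow> real k / real n < u"
    using assms(1) by (simp add: pos_divide_less_eq mult.commute)
  finally show ?thesis by (simp only: step_kernel_def)
qed

lemma gap_product_ceiling:
  assumes "n > 0" "0 < u" "0 < v"
  shows "gap_product n s t (real (nat \<lceil>real n * u\<rceil>) / real n) (real (nat \<lceil>real n * v\<rceil>) / real n) = gap_product n s t u v"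
  by (simp only: gap_product_def step_kernel_ceiling assms)

lemma L2_inf_eq_gap_product_sum:
  assumes n: "n \<ge> 2"
    and pos: "\<And>u v k. k \<in> {1..<n} \<Longrightarrow>
      0 < 1 - (s * step_kernel b \<sigma> u (real k / real n) + t * step_kernel b \<sigma> v (real k / real n)) / real n"
  shows "L2_inf b \<sigma> n s t = ennreal (1 / (real n * (real n - 1)) *
      (\<Sum>i\<in>{1..n}. \<Sum>j\<in>{1..n} - {i}. gap_product n s t (real i / real n) (real j / real n)))"
proof -
  have "0 < gap_rate b \<sigma> n s t i j k" if k: "k \<in> {1..<n}" for i j k
  proof -
    have "0 < 2 * real n / \<sigma>\<^sup>2 * prim b (real k / real n)"
      using gap_rate_zero_pos[OF k, of 1 1] by (simp add: gap_rate_def)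
    then show ?thesis unfolding gap_rate_eq[OF k] using pos[OF k] by (rule mult_pos_pos)
  qed
  then show ?thesis
    using L2_inf_eq_gap_rate_sum[OF n prim1, of \<sigma> s t] gap_rate_zero_pos
    by (simp only: gap_product_eq_prod_gap_rate)
qed

text \<open>The cells \<open>((i - 1) / n, i / n]\<close>, without the point \<open>1\<close>, partition the open unit interval.\<close>

definition cell :: "nat \<Rightarrow> nat \<Rightarrow> real set" where
  "cell n i = {real (i - 1) / real n<..real i / real n} \<inter> {0<..<1}"

lemma emeasure_cell:
  assumes n: "n > 0" and i: "i \<in> {1..n}"
  shows "emeasure lborel (cell n i) = ennreal (1 / real n)"
proof -
  have len: "real i / real n - real (i - 1) / real n = 1 / real n"
    using i by (simp add: of_nat_diff diff_divide_distrib)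
  have le: "real (i - 1) / real n \<le> real i / real n" by (simp add: divide_right_mono)
  have lo: "0 \<le> real (i - 1) / real n" by simp
  have Ioo: "{a<..b} \<inter> {0<..<1} = {a<..<b}" if "0 \<le> a" "b = 1" for a b :: real
    using that by auto
  have Ioc: "{a<..b} \<inter> {0<..<1} = {a<..b}" if "0 \<le> a" "b < 1" for a b :: real
    using that by auto
  have "i = n \<or> i < n" using i by auto
  then show ?thesis
  proof
    assume "i = n"
    then have "cell n i = {real (i - 1) / real n<..<real i / real n}"
      unfolding cell_def using n by (intro Ioo lo) simp
    then show ?thesis using le len by simp
  next
    assume "i < n"
    then have "cell n i = {real (i - 1) / real n<..real i / real n}"
      unfolding cell_def using n by (intro Ioc lo) simp
    then show ?thesis using le len by simp
  qed
qed

lemma mem_cell_iff: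
  assumes n: "n > 0" and u: "u \<in> {0<..<1}"
  shows "u \<in> cell n i \<and> i \<in> {1..n} \<longleftrightarrow> i = nat \<lceil>real n * u\<rceil>"
proof -
  have "0 < real n * u" "real n * u < real n" using n u by auto
  then have c: "0 < \<lceil>real n * u\<rceil>" "\<lceil>real n * u\<rceil> \<le> int n"
    by linarith+
  have "u \<in> cell n i \<longleftrightarrow> real (i - 1) < real n * u \<and> real n * u \<le> real i"
    using n u by (auto simp: cell_def pos_divide_less_eq pos_le_divide_eq mult.commute)
  also have "i \<in> {1..n} \<Longrightarrow> (real (i - 1) < real n * u \<and> real n * u \<le> real i) \<longleftrightarrow> \<lceil>real n * u\<rceil> = int i"
    by (auto simp: ceiling_eq_iff of_nat_diff)
  finally have iff: "i \<in> {1..n} \<Longrightarrow> u \<in> cell n i \<longleftrightarrow> \<lceil>real n * u\<rceil> = int i" .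
  show ?thesis
  proof
    assume "u \<in> cell n i \<and> i \<in> {1..n}"
    with iff show "i = nat \<lceil>real n * u\<rceil>" by (metis nat_int)
  next
    assume i: "i = nat \<lceil>real n * u\<rceil>"
    then have "\<lceil>real n * u\<rceil> = int i" using c by linarith
    moreover from this have "i \<in> {1..n}" unfolding atLeastAtMost_iff using c by linarith
    ultimately show "u \<in> cell n i \<and> i \<in> {1..n}" using iff by blast
  qed
qed

text \<open>The step function on the unit square that is \<open>gap_product\<close> off the diagonal cells and \<open>0\<close> on them. Up to the
factor \<open>n / (n - 1)\<close> its integral is the
average over pairs of distinct ranks.\<close>

definition grid_product :: "nat \<Rightarrow> real \<Rightarrow> real \<Rightarrow> real \<times> real \<Rightarrow> ennreal" where
  "grid_product n s t p = (\<Sum>i\<in>{1..n}. \<Sum>j\<in>{1..n} - {i}.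
     ennreal (gap_product n s t (real i / real n) (real j / real n)) * (indicator (cell n i) (fst p) * indicator (cell n j) (snd p)))"

lemma cell_sets [measurable]: "cell n i \<in> sets borel"
  by (simp add: cell_def)

lemma grid_product_measurable [measurable]: "grid_product n s t \<in> borel_measurable (lborel \<Otimes>\<^sub>M lborel)"
  unfolding grid_product_def[abs_def] by measurable

lemma nn_integral_grid_product:
  assumes n: "n > 0" and nonneg: "\<And>u v. 0 \<le> gap_product n s t u v"
  shows "(\<integral>\<^sup>+p. grid_product n s t p \<partial>(lborel \<Otimes>\<^sub>M lborel)) = ennreal (1 / (real n * real n) *
    (\<Sum>i\<in>{1..n}. \<Sum>j\<in>{1..n} - {i}. gap_product n s t (real i / real n) (real j / real n)))"
proof -
  have rect: "(\<integral>\<^sup>+p. indicator (cell n i) (fst p) * indicator (cell n j) (snd p) \<partial>(lborel \<Otimes>\<^sub>M lborel))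
      = ennreal (1 / (real n * real n))" if "i \<in> {1..n}" "j \<in> {1..n}" for i j
  proof -
    have "(\<integral>\<^sup>+p. indicator (cell n i) (fst p) * indicator (cell n j) (snd p) \<partial>(lborel \<Otimes>\<^sub>M lborel))
        = (\<integral>\<^sup>+p. indicator (cell n i \<times> cell n j) p \<partial>(lborel \<Otimes>\<^sub>M (lborel :: real measure)))"
      by (intro nn_integral_cong) (auto split: split_indicator)
    also have "\<dots> = emeasure lborel (cell n i) * emeasure lborel (cell n j)"
      by (subst nn_integral_indicator) (auto simp: lborel.emeasure_pair_measure_Times)
    finally show ?thesis
      using that by (simp add: emeasure_cell[OF n] ennreal_mult[symmetric])
  qed
  have "(\<integral>\<^sup>+p. grid_product n s t p \<partial>(lborel \<Otimes>\<^sub>M lborel)) = (\<Sum>i\<in>{1..n}. \<Sum>j\<in>{1..n} - {i}.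
      ennreal (gap_product n s t (real i / real n) (real j / real n)) * ennreal (1 / (real n * real n)))"
    unfolding grid_product_def
    by (subst nn_integral_sum, measurable, rule sum.cong[OF refl],
        subst nn_integral_sum, measurable, rule sum.cong[OF refl],
        subst nn_integral_cmult, measurable) (simp add: rect)
  also have "\<dots> = ennreal (\<Sum>i\<in>{1..n}. \<Sum>j\<in>{1..n} - {i}.
      gap_product n s t (real i / real n) (real j / real n) * (1 / (real n * real n)))"
    using nonneg by (simp add: ennreal_mult[symmetric] sum_ennreal sum_nonneg)
  finally show ?thesis by (simp only: sum_distrib_right mult.commute[of "1 / (real n * real n)"])
qed

lemma grid_product_eq:
  assumes n: "n > 0" and u: "u \<in> {0<..<1}" and v: "v \<in> {0<..<1}"
  shows "grid_product n s t (u, v)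
    = (if nat \<lceil>real n * u\<rceil> \<noteq> nat \<lceil>real n * v\<rceil> then ennreal (gap_product n s t u v) else 0)"
proof -
  define p q where "p = nat \<lceil>real n * u\<rceil>" and "q = nat \<lceil>real n * v\<rceil>"
  have p: "p \<in> {1..n}" and q: "q \<in> {1..n}"
    using mem_cell_iff[OF n u, of p] mem_cell_iff[OF n v, of q] by (auto simp: p_def q_def)
  have cu: "indicator (cell n i) u = (if i = p then 1 else 0 :: ennreal)" if "i \<in> {1..n}" for i
    using mem_cell_iff[OF n u, of i] that by (auto simp: p_def split: split_indicator)
  have cv: "indicator (cell n j) v = (if j = q then 1 else 0 :: ennreal)" if "j \<in> {1..n}" for j
    using mem_cell_iff[OF n v, of j] that by (auto simp: q_def split: split_indicator)
  let ?g = "\<lambda>i j. ennreal (gap_product n s t (real i / real n) (real j / real n))"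
  have "grid_product n s t (u, v) = (\<Sum>i\<in>{1..n}. if i = p then (\<Sum>j\<in>{1..n} - {i}. if j = q then ?g i j else 0) else 0)"
  proof -
    have "grid_product n s t (u, v) = (\<Sum>i\<in>{1..n}. \<Sum>j\<in>{1..n} - {i}. if i = p \<and> j = q then ?g i j else 0)"
      unfolding grid_product_def
      by (rule sum.cong[OF refl], rule sum.cong[OF refl]) (simp only: fst_conv snd_conv cu cv Diff_iff, simp)
    also have "\<dots> = (\<Sum>i\<in>{1..n}. if i = p then (\<Sum>j\<in>{1..n} - {i}. if j = q then ?g i j else 0) else 0)"
      by (rule sum.cong[OF refl]) simp
    finally show ?thesis .
  qed
  also have "\<dots> = (\<Sum>j\<in>{1..n} - {p}. if j = q then ?g p j else 0)"
    using p by (subst sum.delta) auto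
  also have "\<dots> = (if p \<noteq> q then ?g p q else 0)"
    using q by (subst sum.delta) auto
  also have "?g p q = ennreal (gap_product n s t u v)"
    using gap_product_ceiling[OF n, of u v s t] u v by (simp add: p_def q_def)
  finally show ?thesis by (simp only: p_def q_def)
qed

lemma grid_product_outside:
  assumes "\<not> (u \<in> {0<..<1} \<and> v \<in> {0<..<1})"
  shows "grid_product n s t (u, v) = 0"
  unfolding grid_product_def
  by (intro sum.neutral ballI) (use assms in \<open>auto simp: cell_def split: split_indicator\<close>)

lemma eventually_ceiling_neq:
  fixes u v :: real
  assumes "0 < u" "u < v"
  shows "eventually (\<lambda>n. nat \<lceil>real n * u\<rceil> \<noteq> nat \<lceil>real n * v\<rceil>) sequentially"
proof -
  have "filterlim (\<lambda>n. real n * (v - u)) at_top sequentially"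
    using assms
    by (intro filterlim_at_top_mult_tendsto_pos[OF tendsto_const] filterlim_real_sequentially) simp
  then have "eventually (\<lambda>n. 1 < real n * (v - u)) sequentially"
    by (simp add: filterlim_at_top_dense)
  then show ?thesis
  proof eventually_elim
    case (elim n)
    then have "real n * u + 1 < real n * v" by (simp add: right_diff_distrib)
    moreover have "0 \<le> real n * u" using assms by simp
    ultimately have "\<lceil>real n * u\<rceil> < \<lceil>real n * v\<rceil>" "0 \<le> \<lceil>real n * u\<rceil>" by linarith+
    then have "nat \<lceil>real n * u\<rceil> < nat \<lceil>real n * v\<rceil>" by (subst nat_less_eq_zless)
    then show ?case by (rule less_imp_neq)
  qed
qed

text \<open>Off the diagonal of the square, \<open>u\<close> and \<open>v\<close> eventually lie in different cells.\<close>

lemma grid_product_tendsto: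
  assumes ne: "u \<noteq> v"
  shows "(\<lambda>n. grid_product n s t (u, v)) \<longlonglongrightarrow>
    ennreal (exp (s * Phi b \<sigma> u)) * indicator {0<..<1} u * (ennreal (exp (t * Phi b \<sigma> v)) * indicator {0<..<1} v)"
proof (cases "u \<in> {0<..<1} \<and> v \<in> {0<..<1}")
  case True
  then have u: "0 < u" "u < 1" and v: "0 < v" "v < 1" by auto
  have "eventually (\<lambda>n. nat \<lceil>real n * u\<rceil> \<noteq> nat \<lceil>real n * v\<rceil>) sequentially"
    using ne eventually_ceiling_neq[OF u(1), of v] eventually_ceiling_neq[OF v(1), of u]
    by (cases "u < v") (auto elim: eventually_mono)
  then have "eventually (\<lambda>n. ennreal (gap_product n s t u v) = grid_product n s t (u, v)) sequentially"
    using eventually_gt_at_top[of 0]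
    by eventually_elim (use True in \<open>simp add: grid_product_eq\<close>)
  moreover have "(\<lambda>n. ennreal (gap_product n s t u v)) \<longlonglongrightarrow> ennreal (exp (s * Phi b \<sigma> u + t * Phi b \<sigma> v))"
    by (intro tendsto_ennrealI gap_product_tendsto u v)
  ultimately have "(\<lambda>n. grid_product n s t (u, v)) \<longlonglongrightarrow> ennreal (exp (s * Phi b \<sigma> u + t * Phi b \<sigma> v))"
    by (rule Lim_transform_eventually[rotated])
  then show ?thesis using True by (simp add: exp_add ennreal_mult)
next
  case False
  then show ?thesis by (auto simp: grid_product_outside split: split_indicator)
qed

lemma grid_integral_tendsto:
  assumes st: "(s, t) \<in> V2_set b \<sigma>"
  shows "(\<lambda>n. \<integral>\<^sup>+p. grid_product n s t p \<partial>(lborel \<Otimes>\<^sub>M lborel)) \<longlonglongrightarrow> L_inf b \<sigma> s * L_inf b \<sigma> t"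
proof -
  have s: "s \<in> V_set b \<sigma>" and t: "t \<in> V_set b \<sigma>" using st by (auto simp: V2_set_def)
  obtain \<gamma> K N where g: "0 \<le> \<gamma>" "\<gamma> < 1" "0 \<le> K"
    and bd: "\<And>n u v. n \<ge> N \<Longrightarrow> 0 < u \<Longrightarrow> u < 1 \<Longrightarrow> 0 < v \<Longrightarrow> v < 1 \<Longrightarrow>
      gap_product n s t u v \<le> K * (endpoint_weight \<gamma> u * endpoint_weight \<gamma> v)"
    using gap_product_bounds[OF st] by blast
  let ?P = "lborel \<Otimes>\<^sub>M (lborel :: real measure)"
  let ?e = "\<lambda>r u. ennreal (exp (r * Phi b \<sigma> u)) * indicator {0<..<1} u"
  let ?w = "\<lambda>u. ennreal (endpoint_weight \<gamma> u) * indicator {0<..<1} u"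
  have [measurable]: "?e r \<in> borel_measurable borel" for r
  proof -
    have "?e r = (\<lambda>u. ennreal (indicator {0<..<1} u * exp (r * Phi b \<sigma> u)))"
      by (auto simp: fun_eq_iff split: split_indicator)
    then show ?thesis using borel_measurable_exp_Phi[of r] by simp
  qed
  have [measurable]: "?w \<in> borel_measurable borel"
    unfolding endpoint_weight_def by measurable
  have prod: "(\<integral>\<^sup>+p. f (fst p) * g (snd p) \<partial>?P) = (\<integral>\<^sup>+u. f u \<partial>lborel) * (\<integral>\<^sup>+v. g v \<partial>lborel)"
    if [measurable]: "f \<in> borel_measurable borel" "g \<in> borel_measurable borel" for f g :: "real \<Rightarrow> ennreal"
    by (subst lborel.nn_integral_fst[symmetric]) (simp_all add: nn_integral_cmult nn_integral_multc)
  have "(\<lambda>n. \<integral>\<^sup>+p. grid_product (n + Suc N) s t p \<partial>?P) \<longlonglongrightarrow> (\<integral>\<^sup>+p. ?e s (fst p) * ?e t (snd p) \<partial>?P)"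
  proof (rule nn_integral_dominated_convergence[where w = "\<lambda>p. ennreal K * (?w (fst p) * ?w (snd p))"])
    show "AE p in ?P. grid_product (n + Suc N) s t p \<le> ennreal K * (?w (fst p) * ?w (snd p))" for n
    proof (rule AE_I2)
      fix p :: "real \<times> real"
      obtain u v where p: "p = (u, v)" by (cases p)
      show "grid_product (n + Suc N) s t p \<le> ennreal K * (?w (fst p) * ?w (snd p))"
      proof (cases "u \<in> {0<..<1} \<and> v \<in> {0<..<1}")
        case True
        then have "ennreal (gap_product (n + Suc N) s t u v) \<le> ennreal (K * (endpoint_weight \<gamma> u * endpoint_weight \<gamma> v))"
          by (intro ennreal_leI bd) auto
        also have "\<dots> = ennreal K * (?w u * ?w v)"
          using True g by (simp add: ennreal_mult endpoint_weight_nonneg)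
        finally show ?thesis using True by (simp add: p grid_product_eq)
      next
        case False
        then show ?thesis by (simp add: p grid_product_outside)
      qed
    qed
    have "(\<integral>\<^sup>+p. ennreal K * (?w (fst p) * ?w (snd p)) \<partial>?P)
        = ennreal K * ((\<integral>\<^sup>+u. ?w u \<partial>lborel) * (\<integral>\<^sup>+v. ?w v \<partial>lborel))"
    proof -
      have meas: "(\<lambda>p. ?w (fst p) * ?w (snd p)) \<in> borel_measurable ?P" by measurable
      have "(\<integral>\<^sup>+p. ?w (fst p) * ?w (snd p) \<partial>?P) = (\<integral>\<^sup>+u. ?w u \<partial>lborel) * (\<integral>\<^sup>+v. ?w v \<partial>lborel)"
        by (rule prod) measurable
      then show ?thesis by (simp only: nn_integral_cmult[OF meas])
    qed
    also have "\<dots> < \<infinity>"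
      using nn_integral_endpoint_weight[OF g(2)] by (simp add: ennreal_mult_less_top)
    finally show "(\<integral>\<^sup>+p. ennreal K * (?w (fst p) * ?w (snd p)) \<partial>?P) < \<infinity>" .
    show "AE p in ?P. (\<lambda>n. grid_product (n + Suc N) s t p) \<longlonglongrightarrow> ?e s (fst p) * ?e t (snd p)"
    proof -
      have "AE p in ?P. fst p \<noteq> snd p"
      proof (rule lborel_pair.AE_pair_measure)
        show "{p \<in> space ?P. fst p \<noteq> snd p} \<in> sets ?P" by measurable
        show "AE u in lborel. AE v in lborel. fst (u, v) \<noteq> snd (u, v)"
          by (rule AE_I2, rule AE_mp[OF AE_lborel_singleton], rule AE_I2) auto
      qed
      then show ?thesis
      proof eventually_elim
        case (elim p)
        then show ?case
          using LIMSEQ_ignore_initial_segment[OF grid_product_tendsto[of "fst p" "snd p" s t], of "Suc N"] by simp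
      qed
    qed
  qed measurable
  also have "(\<integral>\<^sup>+p. ?e s (fst p) * ?e t (snd p) \<partial>?P) = L_inf b \<sigma> s * L_inf b \<sigma> t"
    by (subst prod) (simp_all add: L_inf_eq(2) s t)
  finally show ?thesis by (rule LIMSEQ_offset)
qed

lemma L2_inf_eventually:
  assumes st: "(s, t) \<in> V2_set b \<sigma>"
  shows "\<exists>n0\<ge>2. \<forall>n\<ge>n0. L2_inf b \<sigma> n s t = ennreal (1 / (real n * (real n - 1)) *
      (\<Sum>i\<in>{1..n}. \<Sum>j\<in>{1..n} - {i}. gap_product n s t (real i / real n) (real j / real n)))
    \<and> (\<forall>u v. 0 \<le> gap_product n s t u v)"
proof -
  obtain N where N: "\<And>n u v k. n \<ge> N \<Longrightarrow> k \<in> {1..<n} \<Longrightarrow>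
      0 < 1 - (s * step_kernel b \<sigma> u (real k / real n) + t * step_kernel b \<sigma> v (real k / real n)) / real n"
    using gap_product_bounds[OF st] by blast
  have "L2_inf b \<sigma> n s t = ennreal (1 / (real n * (real n - 1)) *
      (\<Sum>i\<in>{1..n}. \<Sum>j\<in>{1..n} - {i}. gap_product n s t (real i / real n) (real j / real n)))
    \<and> (\<forall>u v. 0 \<le> gap_product n s t u v)" if n: "n \<ge> max 2 N" for n
  proof
    show "L2_inf b \<sigma> n s t = ennreal (1 / (real n * (real n - 1)) *
      (\<Sum>i\<in>{1..n}. \<Sum>j\<in>{1..n} - {i}. gap_product n s t (real i / real n) (real j / real n)))"
      by (rule L2_inf_eq_gap_product_sum) (use n N in auto)
    show "\<forall>u v. 0 \<le> gap_product n s t u v"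
      unfolding gap_product_def using n N by (intro allI prod_nonneg) (auto intro!: less_imp_le)
  qed
  then show ?thesis by (intro exI[of _ "max 2 N"]) auto
qed

lemma L2_inf_tendsto:
  assumes st: "(s, t) \<in> V2_set b \<sigma>"
  shows "(\<lambda>n. L2_inf b \<sigma> n s t) \<longlonglongrightarrow> L_inf b \<sigma> s * L_inf b \<sigma> t"
proof -
  have s: "s \<in> V_set b \<sigma>" and t: "t \<in> V_set b \<sigma>" using st by (auto simp: V2_set_def)
  obtain n0 where n0: "n0 \<ge> 2" "\<And>n. n \<ge> n0 \<Longrightarrow> L2_inf b \<sigma> n s t = ennreal (1 / (real n * (real n - 1)) *
      (\<Sum>i\<in>{1..n}. \<Sum>j\<in>{1..n} - {i}. gap_product n s t (real i / real n) (real j / real n)))"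
      "\<And>n u v. n \<ge> n0 \<Longrightarrow> 0 \<le> gap_product n s t u v"
    using L2_inf_eventually[OF st] by blast
  have "(\<lambda>n. real n / (real n - 1)) \<longlonglongrightarrow> 1"
    by real_asymp
  then have "(\<lambda>n. ennreal (real n / (real n - 1)) * (\<integral>\<^sup>+p. grid_product n s t p \<partial>(lborel \<Otimes>\<^sub>M lborel)))
      \<longlonglongrightarrow> ennreal 1 * (L_inf b \<sigma> s * L_inf b \<sigma> t)"
    using L_inf_eq(1)[OF s] L_inf_eq(1)[OF t]
    by (intro tendsto_mult_ennreal tendsto_ennrealI grid_integral_tendsto st) auto
  moreover have "eventually (\<lambda>n. ennreal (real n / (real n - 1)) * (\<integral>\<^sup>+p. grid_product n s t p \<partial>(lborel \<Otimes>\<^sub>M lborel))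
      = L2_inf b \<sigma> n s t) sequentially"
    using eventually_ge_at_top[of n0]
  proof eventually_elim
    case (elim n)
    then have n: "n \<ge> 2" using n0(1) by simp
    have "real n / (real n - 1) * (1 / (real n * real n) * S) = 1 / (real n * (real n - 1)) * S" for S
      using n by simp
    moreover have "ennreal (real n / (real n - 1)) * ennreal S = ennreal (real n / (real n - 1) * S)" for S
      by (rule ennreal_mult'[symmetric]) (use n in simp)
    moreover have "n > 0" using n by simp
    ultimately show ?case
      by (simp only: n0(2)[OF elim] nn_integral_grid_product n0(3)[OF elim])
  qed
  ultimately show ?thesis by (simp add: Lim_transform_eventually)
qed

end

theorem theorem5:
  fixes b :: "real \<Rightarrow> real" and \<sigma> :: real
  assumes "continuous_on {0..1} b"
    and "\<sigma> \<noteq> 0"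
    and "prim b 1 = 0"
    and "strict_antimono_on {0..1} b"
  shows "(\<forall>r \<in> V_set b \<sigma>.
            L_inf b \<sigma> r < \<infinity> \<and>
            L_inf b \<sigma> r = (\<integral>\<^sup>+u\<in>{0<..<1}. ennreal (exp (r * Phi b \<sigma> u)) \<partial>lborel))
       \<and> (\<forall>(s, t) \<in> V2_set b \<sigma>. \<exists>n0\<ge>2. \<forall>n\<ge>n0.
            L2_inf b \<sigma> n s t < \<infinity> \<and>
            enn2real (L2_inf b \<sigma> n s t) =
              1 / (real n * (real n - 1)) *
              (\<Sum>i\<in>{1..n}. \<Sum>j\<in>{1..n} - {i}. J_prod b \<sigma> n i j s t))
       \<and> (\<forall>(s, t) \<in> V2_set b \<sigma>.
            (\<lambda>n. L2_inf b \<sigma> n s t) \<longlonglongrightarrow> L_inf b \<sigma> s * L_inf b \<sigma> t)"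
proof -
  interpret decreasing_drift b \<sigma> using assms by unfold_locales
  have "\<exists>n0\<ge>2. \<forall>n\<ge>n0. L2_inf b \<sigma> n s t < \<infinity> \<and>
      enn2real (L2_inf b \<sigma> n s t) = 1 / (real n * (real n - 1)) *
        (\<Sum>i\<in>{1..n}. \<Sum>j\<in>{1..n} - {i}. J_prod b \<sigma> n i j s t)"
    if st: "(s, t) \<in> V2_set b \<sigma>" for s t
  proof -
    obtain n0 where n0: "n0 \<ge> 2" and L2: "\<And>n. n \<ge> n0 \<Longrightarrow> L2_inf b \<sigma> n s t = ennreal (1 / (real n * (real n - 1)) *
        (\<Sum>i\<in>{1..n}. \<Sum>j\<in>{1..n} - {i}. gap_product n s t (real i / real n) (real j / real n)))"
      and nonneg: "\<And>n u v. n \<ge> n0 \<Longrightarrow> 0 \<le> gap_product n s t u v"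
      using L2_inf_eventually[OF st] by blast
    have "L2_inf b \<sigma> n s t < \<infinity> \<and>
      enn2real (L2_inf b \<sigma> n s t) = 1 / (real n * (real n - 1)) *
        (\<Sum>i\<in>{1..n}. \<Sum>j\<in>{1..n} - {i}. J_prod b \<sigma> n i j s t)" if n: "n \<ge> n0" for n
    proof
      show "L2_inf b \<sigma> n s t < \<infinity>" by (simp add: L2[OF n])
      have "0 \<le> 1 / (real n * (real n - 1)) *
          (\<Sum>i\<in>{1..n}. \<Sum>j\<in>{1..n} - {i}. gap_product n s t (real i / real n) (real j / real n))"
        using n n0 by (intro mult_nonneg_nonneg sum_nonneg nonneg) auto
      then have "enn2real (L2_inf b \<sigma> n s t) = 1 / (real n * (real n - 1)) *
          (\<Sum>i\<in>{1..n}. \<Sum>j\<in>{1..n} - {i}. gap_product n s t (real i / real n) (real j / real n))"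
        unfolding L2[OF n] by (rule enn2real_ennreal)
      also have "(\<Sum>i\<in>{1..n}. \<Sum>j\<in>{1..n} - {i}. gap_product n s t (real i / real n) (real j / real n))
          = (\<Sum>i\<in>{1..n}. \<Sum>j\<in>{1..n} - {i}. J_prod b \<sigma> n i j s t)"
        by (intro sum.cong refl gap_product_eq_J_prod) auto
      finally show "enn2real (L2_inf b \<sigma> n s t) = 1 / (real n * (real n - 1)) *
        (\<Sum>i\<in>{1..n}. \<Sum>j\<in>{1..n} - {i}. J_prod b \<sigma> n i j s t)" .
    qed
    with n0 show ?thesis by blast
  qed
  then show ?thesis
    using L_inf_eq L2_inf_tendsto by blast
qed

end
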